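(* Let $d=2$, let $\Omega\subset\mathbb R^2$ be a bounded convex domain, let $g\in W^{2,\infty}(\Omega)$, and let $f\in C^0(\overline\Omega)$ be uniformly positive. Assume that $u\in W^{2,\infty}(\Omega)$ is uniformly convex and satisfies the Monge--Ampère problem $$\det D^2u=f\quad\text{in }\Omega,\qquad u=g\quad\text{on }\partial\Omega.$$ Then there exists $\xi\in(0,1/4]$, dependent upon $|u|_{W^{2,\infty}(\Omega)}$, such that $u$ is also the unique solution (in $H^2(\Omega)$) of $$\sup_{W\in X_\xi}\{-W:D^2u+2(\det W)^{1/2}f^{1/2}\}=0\quad\text{a.e. in }\Omega,\qquad u=g\quad\text{on }\partial\Omega.$$
   Context: $X:=\{W\in\mathbb R^{2\times2}:W\ge0,\ W=W^T,\ \operatorname{Trace}(W)=1\}$, where $W\ge0$ means positive semidefinite, and $X_\xi:=\{W\in X:\det W\ge\xi\}$. $W:M=\sum_{i,j}W_{ij}M_{ij}$. The Monge--Ampère equation is understood to hold a.e. in $\Omega$. "Uniformly positive" means $\inf_{\overline\Omega}f>0$; $u\in W^{2,\infty}(\Omega)$ uniformly convex means there is $c>0$ with $\xi^TD^2u\,\xi\ge c|\xi|^2$ for all $\xi\in\mathbb R^2$, a.e. in $\Omega$. $|u|_{W^{2,\infty}(\Omega)}$ is the $W^{2,\infty}$-seminorm. *)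

theory Defs
  imports "HOL-Analysis.Analysis" "HOL-Probability.Essential_Supremum"
begin

subsection \<open>Test functions\<close>

definition partial_deriv :: "'n::finite \<Rightarrow> (real^'n \<Rightarrow> real) \<Rightarrow> real^'n \<Rightarrow> real" where
  "partial_deriv i f = (\<lambda>x. frechet_derivative f (at x) (axis i 1))"

text \<open>A list of coordinate indices plays the role of a multi-index: \<open>[i, j]\<close> stands for
  \<open>\<partial>\<^sub>i \<partial>\<^sub>j\<close>, and the order of the derivative is the length of the list.\<close>

primrec partial_derivs :: "'n::finite list \<Rightarrow> (real^'n \<Rightarrow> real) \<Rightarrow> real^'n \<Rightarrow> real" where
  "partial_derivs [] f = f"
| "partial_derivs (i # \<alpha>) f = partial_deriv i (partial_derivs \<alpha> f)"

definition smooth :: "(real^'n::finite \<Rightarrow> real) \<Rightarrow> bool" where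
  "smooth \<phi> \<longleftrightarrow> (\<forall>\<alpha> x. partial_derivs \<alpha> \<phi> differentiable (at x))"

definition test_functions :: "(real^'n::finite) set \<Rightarrow> (real^'n \<Rightarrow> real) set" where
  "test_functions \<Omega> = {\<phi>. smooth \<phi> \<and> compact (closure {x. \<phi> x \<noteq> 0}) \<and> closure {x. \<phi> x \<noteq> 0} \<subseteq> \<Omega>}"


subsection \<open>Weak derivatives and Sobolev spaces\<close>

text \<open>Elements of the function spaces below are represented by functions on the whole space; only
  their values almost everywhere in \<open>\<Omega>\<close> matter.\<close>

definition locally_integrable :: "(real^'n::finite) set \<Rightarrow> (real^'n \<Rightarrow> real) \<Rightarrow> bool" where
  "locally_integrable \<Omega> u \<longleftrightarrow> (\<forall>K. compact K \<and> K \<subseteq> \<Omega> \<longrightarrow> integrable (lebesgue_on K) u)"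

definition has_weak_deriv ::
    "(real^'n::finite) set \<Rightarrow> 'n list \<Rightarrow> (real^'n \<Rightarrow> real) \<Rightarrow> (real^'n \<Rightarrow> real) \<Rightarrow> bool" where
  "has_weak_deriv \<Omega> \<alpha> u v \<longleftrightarrow> locally_integrable \<Omega> u \<and> locally_integrable \<Omega> v \<and>
     (\<forall>\<phi>\<in>test_functions \<Omega>.
        (LINT x|lebesgue_on \<Omega>. u x * partial_derivs \<alpha> \<phi> x) =
        (-1) ^ length \<alpha> * (LINT x|lebesgue_on \<Omega>. v x * \<phi> x))"

text \<open>Weak derivatives are unique up to null sets, so this picks some representative; it is
  meaningful only if the weak derivative exists.\<close>

definition weak_deriv ::
    "(real^'n::finite) set \<Rightarrow> 'n list \<Rightarrow> (real^'n \<Rightarrow> real) \<Rightarrow> real^'n \<Rightarrow> real" where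
  "weak_deriv \<Omega> \<alpha> u = (SOME v. has_weak_deriv \<Omega> \<alpha> u v)"

definition weak_hessian ::
    "(real^'n::finite) set \<Rightarrow> (real^'n \<Rightarrow> real) \<Rightarrow> real^'n \<Rightarrow> real^'n^'n" where
  "weak_hessian \<Omega> u x = (\<chi> i j. weak_deriv \<Omega> [i, j] u x)"

definition Lp_space :: "ereal \<Rightarrow> (real^'n::finite) set \<Rightarrow> (real^'n \<Rightarrow> real) set" where
  "Lp_space p \<Omega> = {v \<in> borel_measurable (lebesgue_on \<Omega>).
     if p = \<infinity> then esssup (lebesgue_on \<Omega>) (\<lambda>x. ereal \<bar>v x\<bar>) < \<infinity>
     else integrable (lebesgue_on \<Omega>) (\<lambda>x. \<bar>v x\<bar> powr real_of_ereal p)}"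

definition sobolev_space :: "nat \<Rightarrow> ereal \<Rightarrow> (real^'n::finite) set \<Rightarrow> (real^'n \<Rightarrow> real) set" where
  "sobolev_space k p \<Omega> = {u \<in> Lp_space p \<Omega>.
     \<forall>\<alpha>. length \<alpha> \<le> k \<longrightarrow> (\<exists>v\<in>Lp_space p \<Omega>. has_weak_deriv \<Omega> \<alpha> u v)}"

text \<open>The seminorm of \<open>W\<^bsup>k,\<infinity>\<^esup>(\<Omega>)\<close>: the maximum over all derivatives of order exactly \<open>k\<close>.\<close>

definition sobolev_inf_seminorm :: "nat \<Rightarrow> (real^'n::finite) set \<Rightarrow> (real^'n \<Rightarrow> real) \<Rightarrow> real" where
  "sobolev_inf_seminorm k \<Omega> u = real_of_ereal
     (SUP \<alpha>\<in>{\<alpha>. length \<alpha> = k}. esssup (lebesgue_on \<Omega>) (\<lambda>x. ereal \<bar>weak_deriv \<Omega> \<alpha> u x\<bar>))"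

text \<open>\<open>H\<^sup>1\<^sub>0(\<Omega>)\<close>, the closure of the test functions in \<open>H\<^sup>1(\<Omega>)\<close>.\<close>

definition H10_space :: "(real^'n::finite) set \<Rightarrow> (real^'n \<Rightarrow> real) set" where
  "H10_space \<Omega> = {w \<in> sobolev_space 1 2 \<Omega>. \<exists>\<phi> :: nat \<Rightarrow> real^'n \<Rightarrow> real.
     (\<forall>n. \<phi> n \<in> test_functions \<Omega>) \<and>
     (\<lambda>n. LINT x|lebesgue_on \<Omega>. (w x - \<phi> n x)\<^sup>2) \<longlonglongrightarrow> 0 \<and>
     (\<forall>i. (\<lambda>n. LINT x|lebesgue_on \<Omega>. (weak_deriv \<Omega> [i] w x - partial_deriv i (\<phi> n) x)\<^sup>2) \<longlonglongrightarrow> 0)}"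

text \<open>Equality on the boundary is meant in the sense of traces; the kernel of the trace operator on
  \<open>H\<^sup>1(\<Omega>)\<close> is \<open>H\<^sup>1\<^sub>0(\<Omega>)\<close>.\<close>

definition equal_on_boundary ::
    "(real^'n::finite) set \<Rightarrow> (real^'n \<Rightarrow> real) \<Rightarrow> (real^'n \<Rightarrow> real) \<Rightarrow> bool" where
  "equal_on_boundary \<Omega> u g \<longleftrightarrow> (\<lambda>x. u x - g x) \<in> H10_space \<Omega>"


subsection \<open>The Monge--Ampere and Hamilton--Jacobi--Bellman problems\<close>

definition uniformly_convex :: "(real^2) set \<Rightarrow> (real^2 \<Rightarrow> real) \<Rightarrow> bool" where
  "uniformly_convex \<Omega> u \<longleftrightarrow>
     (\<exists>c>0. AE x in lebesgue_on \<Omega>. \<forall>\<eta>. \<eta> \<bullet> (weak_hessian \<Omega> u x *v \<eta>) \<ge> c * (norm \<eta>)\<^sup>2)"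

definition monge_ampere_solution ::
    "(real^2) set \<Rightarrow> (real^2 \<Rightarrow> real) \<Rightarrow> (real^2 \<Rightarrow> real) \<Rightarrow> (real^2 \<Rightarrow> real) \<Rightarrow> bool" where
  "monge_ampere_solution \<Omega> f g u \<longleftrightarrow>
     (AE x in lebesgue_on \<Omega>. det (weak_hessian \<Omega> u x) = f x) \<and> equal_on_boundary \<Omega> u g"

definition control_set :: "(real^2^2) set" where
  "control_set = {W. (\<forall>v. v \<bullet> (W *v v) \<ge> 0) \<and> W = transpose W \<and> trace W = 1}"

definition control_set_det :: "real \<Rightarrow> (real^2^2) set" where
  "control_set_det \<xi> = {W \<in> control_set. det W \<ge> \<xi>}"

text \<open>In the Bellman operator the product \<open>W : M\<close> is the inner product of \<^typ>\<open>real^2^2\<close>.\<close>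

lemma inner_matrix_eq_sum:
  fixes W M :: "real^'n::finite^'m::finite"
  shows "W \<bullet> M = (\<Sum>i\<in>UNIV. \<Sum>j\<in>UNIV. W $ i $ j * M $ i $ j)"
  by (simp add: inner_vec_def)

text \<open>The supremum is one of reals; it is proper for \<open>0 < \<xi> \<le> 1/4\<close>, when
  \<open>control_set_det \<xi>\<close> is nonempty and compact.\<close>

definition hjb_solution ::
    "real \<Rightarrow> (real^2) set \<Rightarrow> (real^2 \<Rightarrow> real) \<Rightarrow> (real^2 \<Rightarrow> real) \<Rightarrow> (real^2 \<Rightarrow> real) \<Rightarrow> bool" where
  "hjb_solution \<xi> \<Omega> f g v \<longleftrightarrow>
     (AE x in lebesgue_on \<Omega>.
        (SUP W\<in>control_set_det \<xi>. - (W \<bullet> weak_hessian \<Omega> v x) + 2 * sqrt (det W) * sqrt (f x)) = 0) \<and>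
     equal_on_boundary \<Omega> v g"

end

(*
  Let w be the difference of two solutions of the Bellman problem and D its Hessian. The sets of
  admissible matrices are uniformly elliptic, so D(x) is orthogonal to a matrix of trace one and
  determinant at least xi; in two dimensions this gives -det D >= c |D|^2 with c > 0. On the other
  hand, if phi is concave, smooth, and vanishes on the boundary of Omega, then, q being the gradient
  of w rotated by a right angle,
    2 int phi det D = - int q . (D^2 phi) q >= 0,
  because q is divergence free with zero normal component. Hence D = 0 and w = 0. The convexity of
  Omega provides phi: the distance to the boundary, approximated by soft minima of finitely many
  affine functions and truncated near the boundary. Regularity theory and boundary curvature (the
  Miranda-Talenti estimate) do not enter.
  Conversely, det D^2 u = f makes the cofactor matrix of D^2 u, divided by its trace, a maximizer in
  the Bellman operator; its determinant f / (tr D^2 u)^2 is bounded below in terms of the seminorm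
  of u.
*)
theory Submission
  imports Defs
begin

subsection \<open>Smooth functions\<close>

text \<open>Sign and integration by parts make opposite demands on the weight. The determinant
  identity is available only for weights with compact support in \<open>\<Omega>\<close>, because
  the Hessian of w is merely square integrable and nothing is known about it near the boundary; but
  a nonnegative concave function with compact support in \<open>\<Omega>\<close> is zero. Hence two
  weights with parallel gradients, that of \<open>\<eta>\<close> being \<open>\<theta>\<close> times
  that of \<open>\<phi>\<close> with values of \<open>\<theta>\<close> in [0,1]:
  \<open>\<eta>\<close> enters the determinant identity, \<open>\<phi>\<close> provides the sign,
  and the mismatch is at most \<open>1 - \<theta>\<close> times an integrable bound of the flux.
  This bound is the same for all n because the soft minima have uniformly bounded gradients, so
  dominated convergence removes the mismatch. Vanishing trace means being a limit of test functions
  in H1, so only first derivatives of the approximants converge. Wherever they replace w, at most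
  its gradient is affected, never the Hessian. Products of two weak gradients are integrated by
  parts by comparing correlations at small shifts, for which continuity of translations is
  enough.\<close>

primrec differentiable_upto :: "nat \<Rightarrow> (real^'n::finite \<Rightarrow> real) \<Rightarrow> bool" where
  "differentiable_upto 0 f \<longleftrightarrow> True"
| "differentiable_upto (Suc k) f \<longleftrightarrow> (\<forall>x. f differentiable (at x)) \<and> (\<forall>i. differentiable_upto k (partial_deriv i f))"

lemma partial_derivs_snoc:
  "partial_derivs (\<alpha> @ [i]) f = partial_derivs \<alpha> (partial_deriv i f)"
  by (induction \<alpha>) auto

text \<open>\<open>partial_derivs\<close> applies the head of its list last, whereas the recursion
  of \<open>differentiable_upto\<close> takes the first derivative first; therefore the induction
  splits the list at its end. Counting orders is what allows product and chain rules to be proved by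
  induction.\<close>

lemma differentiable_upto_iff:
  "differentiable_upto k f \<longleftrightarrow> (\<forall>\<alpha> x. length \<alpha> < k \<longrightarrow> partial_derivs \<alpha> f differentiable (at x))"
proof (induction k arbitrary: f)
  case 0
  then show ?case by simp
next
  case (Suc k)
  show ?case
  proof
    assume L: "differentiable_upto (Suc k) f"
    show "\<forall>\<alpha> x. length \<alpha> < Suc k \<longrightarrow> partial_derivs \<alpha> f differentiable (at x)"
    proof (intro allI impI)
      fix \<alpha> :: "'a list" and x assume "length \<alpha> < Suc k"
      then show "partial_derivs \<alpha> f differentiable (at x)"
      proof (cases \<alpha> rule: rev_cases)
        case Nil
        then show ?thesis using L by simp
      next
        case (snoc ys y)
        then show ?thesis using L Suc.IH[of "partial_deriv y f"] \<open>length \<alpha> < Suc k\<close>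
          by (simp add: partial_derivs_snoc)
      qed
    qed
  next
    assume R: "\<forall>\<alpha> x. length \<alpha> < Suc k \<longrightarrow> partial_derivs \<alpha> f differentiable (at x)"
    have "differentiable_upto k (partial_deriv i f)" for i
      unfolding Suc.IH using R by (metis length_append_singleton not_less_eq partial_derivs_snoc)
    moreover have "f differentiable (at x)" for x
      using R[rule_format, of "[]" x] by simp
    ultimately show "differentiable_upto (Suc k) f" by simp
  qed
qed

lemma smooth_iff_differentiable_upto: "smooth f \<longleftrightarrow> (\<forall>k. differentiable_upto k f)"
  unfolding smooth_def differentiable_upto_iff by blast

lemma differentiable_upto_SucD: "differentiable_upto (Suc k) f \<Longrightarrow> differentiable_upto k f"
  unfolding differentiable_upto_iff by simp

lemma smooth_iff:
  "smooth f \<longleftrightarrow> (\<forall>x. f differentiable (at x)) \<and> (\<forall>i. smooth (partial_deriv i f))"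
  unfolding smooth_iff_differentiable_upto by (metis differentiable_upto.simps(2) differentiable_upto_SucD)

lemma smooth_differentiable: "smooth f \<Longrightarrow> f differentiable (at x)"
  using smooth_iff by blast

lemma smooth_partial_deriv: "smooth f \<Longrightarrow> smooth (partial_deriv i f)"
  using smooth_iff by blast

lemma smooth_continuous_on: "smooth f \<Longrightarrow> continuous_on A f"
  by (meson continuous_at_imp_continuous_on differentiable_imp_continuous_within smooth_differentiable)

lemma smooth_borel_measurable: "smooth f \<Longrightarrow> f \<in> borel_measurable borel"
  by (intro borel_measurable_continuous_onI smooth_continuous_on)

lemma partial_deriv_eqI: "(f has_derivative D) (at x) \<Longrightarrow> partial_deriv i f x = D (axis i 1)"
  unfolding partial_deriv_def by (metis frechet_derivative_at)

lemma partial_deriv_const: "partial_deriv i (\<lambda>x. c) = (\<lambda>x. 0)"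
  by (rule ext, subst partial_deriv_eqI[where D="\<lambda>h. 0"]) auto

lemma partial_deriv_inner: "partial_deriv i (\<lambda>x. a \<bullet> x) = (\<lambda>x. a $ i)"
  by (rule ext, subst partial_deriv_eqI[where D="\<lambda>h. a \<bullet> h"])
     (auto intro!: derivative_eq_intros simp: inner_axis)

lemma partial_deriv_add:
  assumes "f differentiable (at x)" "g differentiable (at x)"
  shows "partial_deriv i (\<lambda>x. f x + g x) x = partial_deriv i f x + partial_deriv i g x"
proof -
  have "((\<lambda>x. f x + g x) has_derivative
      (\<lambda>h. frechet_derivative f (at x) h + frechet_derivative g (at x) h)) (at x)"
    using assms by (intro has_derivative_add) (auto simp: frechet_derivative_works[symmetric])
  from partial_deriv_eqI[OF this, of i] show ?thesis by (simp add: partial_deriv_def)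
qed

lemma partial_deriv_mult:
  assumes "f differentiable (at x)" "g differentiable (at x)"
  shows "partial_deriv i (\<lambda>x. f x * g x) x = partial_deriv i f x * g x + f x * partial_deriv i g x"
proof -
  have "((\<lambda>x. f x * g x) has_derivative
      (\<lambda>h. f x * frechet_derivative g (at x) h + frechet_derivative f (at x) h * g x)) (at x)"
    using assms by (intro has_derivative_mult) (auto simp: frechet_derivative_works[symmetric])
  from partial_deriv_eqI[OF this, of i] show ?thesis by (simp add: partial_deriv_def)
qed

lemma partial_deriv_compose:
  assumes "f differentiable (at x)" "(F has_real_derivative d) (at (f x))"
  shows "partial_deriv i (\<lambda>x. F (f x)) x = d * partial_deriv i f x"
proof -
  have "((\<lambda>x. F (f x)) has_derivative (\<lambda>h. d * frechet_derivative f (at x) h)) (at x)"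
    using has_derivative_compose[of f "frechet_derivative f (at x)" x UNIV F "(*) d"] assms
    by (auto simp: frechet_derivative_works[symmetric] has_field_derivative_def)
  from partial_deriv_eqI[OF this, of i] show ?thesis by (simp add: partial_deriv_def)
qed

lemma differentiable_upto_const: "differentiable_upto k (\<lambda>x. c)"
  by (induction k arbitrary: c) (auto simp: partial_deriv_const)

lemma smooth_const [simp]: "smooth (\<lambda>x. c)"
  by (simp add: smooth_iff_differentiable_upto differentiable_upto_const)

lemma smooth_inner [simp]: "smooth (\<lambda>x. a \<bullet> x)"
  by (subst smooth_iff) (auto simp: partial_deriv_inner intro!: derivative_intros)

lemma differentiable_upto_add: "differentiable_upto k f \<Longrightarrow> differentiable_upto k g \<Longrightarrow> differentiable_upto k (\<lambda>x. f x + g x)"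
proof (induction k arbitrary: f g)
  case (Suc k)
  moreover have "partial_deriv i (\<lambda>x. f x + g x) = (\<lambda>x. partial_deriv i f x + partial_deriv i g x)" for i
    using Suc.prems by (auto simp: partial_deriv_add)
  ultimately show ?case by auto
qed simp

lemma differentiable_upto_mult: "differentiable_upto k f \<Longrightarrow> differentiable_upto k g \<Longrightarrow> differentiable_upto k (\<lambda>x. f x * g x)"
proof (induction k arbitrary: f g)
  case (Suc k)
  have "partial_deriv i (\<lambda>x. f x * g x) = (\<lambda>x. partial_deriv i f x * g x + f x * partial_deriv i g x)" for i
    using Suc.prems by (auto simp: partial_deriv_mult)
  moreover have "differentiable_upto k f" "differentiable_upto k g" using Suc.prems differentiable_upto_SucD by blast+
  ultimately show ?case using Suc by (auto intro: differentiable_upto_add)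
qed simp

text \<open>The shape of the derivative of \<open>F j\<close> is chosen so that the rule covers \<open>exp\<close>, \<open>ln\<close> and the
  flat functions \<open>s \<mapsto> s\<^sup>-\<^sup>j exp (-1/s)\<close>.\<close>

lemma differentiable_upto_compose:
  fixes F :: "nat \<Rightarrow> real \<Rightarrow> real"
  assumes F: "\<And>j t. t \<in> U \<Longrightarrow> (F j has_real_derivative a j * F (j + 1) t + b j * F (j + 2) t) (at t)"
    and U: "\<And>x. f x \<in> U"
  shows "differentiable_upto k f \<Longrightarrow> differentiable_upto k (\<lambda>x. F j (f x))"
proof (induction k arbitrary: j)
  case (Suc k)
  have d: "f differentiable (at x)" for x using Suc.prems by simp
  have pd: "partial_deriv i (\<lambda>x. F j (f x)) =
      (\<lambda>x. (a j * F (j + 1) (f x) + b j * F (j + 2) (f x)) * partial_deriv i f x)" for i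
    using partial_deriv_compose[OF d F[OF U]] by blast
  have "differentiable_upto k f" using Suc.prems differentiable_upto_SucD by blast
  then have "differentiable_upto k (\<lambda>x. F j (f x))" for j using Suc.IH by blast
  then have "differentiable_upto k (partial_deriv i (\<lambda>x. F j (f x)))" for i
    using Suc.prems unfolding pd by (intro differentiable_upto_mult differentiable_upto_add differentiable_upto_const) auto
  moreover have "(\<lambda>x. F j (f x)) differentiable (at x)" for x
  proof -
    have "(F j) differentiable (at (f x))"
      using F[OF U] real_differentiable_def by blast
    then show ?thesis using d by (rule differentiable_compose)
  qed
  ultimately show ?case by simp
qed simp

lemma smooth_add [intro]: "smooth f \<Longrightarrow> smooth g \<Longrightarrow> smooth (\<lambda>x. f x + g x)"
  by (simp add: smooth_iff_differentiable_upto differentiable_upto_add)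

lemma smooth_mult [intro]: "smooth f \<Longrightarrow> smooth g \<Longrightarrow> smooth (\<lambda>x. f x * g x)"
  by (simp add: smooth_iff_differentiable_upto differentiable_upto_mult)

lemma smooth_cmult [intro]: "smooth f \<Longrightarrow> smooth (\<lambda>x. c * f x)"
  by (rule smooth_mult) auto

lemma smooth_diff [intro]: "smooth f \<Longrightarrow> smooth g \<Longrightarrow> smooth (\<lambda>x. f x - g x)"
  using smooth_add[OF _ smooth_cmult[of g "-1"], of f] by simp

lemma smooth_sum [intro]: "(\<And>e. e \<in> E \<Longrightarrow> smooth (f e)) \<Longrightarrow> smooth (\<lambda>x. \<Sum>e\<in>E. f e x)"
  by (induction E rule: infinite_finite_induct) auto

lemma smooth_exp: "smooth f \<Longrightarrow> smooth (\<lambda>x. exp (f x))"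
  unfolding smooth_iff_differentiable_upto
  using differentiable_upto_compose[of UNIV "\<lambda>j. exp" "\<lambda>j. 1" "\<lambda>j. 0" f]
  by (auto intro!: derivative_eq_intros)

section \<open>Logarithms and flat functions\<close>

lemma DERIV_inverse_power:
  assumes "(t::real) \<noteq> 0"
  shows "((\<lambda>t. (1 / t) ^ n) has_real_derivative - real n * (1 / t) ^ (n + 1)) (at t)"
proof (cases n)
  case (Suc l)
  have "((\<lambda>t::real. 1 / t) has_real_derivative - ((1 / t) * (1 / t))) (at t)"
    using assms by (auto intro!: derivative_eq_intros)
  from DERIV_power[OF this, of n]
  have "((\<lambda>t. (1 / t) ^ n) has_real_derivative real n * (- ((1 / t) * (1 / t)) * (1 / t) ^ l)) (at t)"
    unfolding Suc by (simp only: diff_Suc_1 One_nat_def[symmetric])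
  moreover have "real n * (- (y * y) * y ^ l) = - real n * y ^ (n + 1)" for y :: real
    unfolding Suc by (simp add: algebra_simps)
  ultimately show ?thesis by (simp only:)
qed simp

lemma smooth_ln:
  assumes "smooth f" "\<And>x. f x > 0"
  shows "smooth (\<lambda>x. ln (f x))"
proof -
  \<comment> \<open>The powers of \<open>1/t\<close> are closed under differentiation up to factors,
    and \<open>ln\<close> precedes them as index 0.\<close>
  define F where "F j = (\<lambda>t::real. if j = 0 then ln t else (1/t)^j)" for j :: nat
  have "(F j has_real_derivative (if j = 0 then 1 else - real j) * F (j + 1) t + 0 * F (j + 2) t) (at t)"
    if "t \<in> {0<..}" for j t
  proof (cases "j = 0")
    case True
    then show ?thesis using that by (auto simp: F_def intro!: derivative_eq_intros)
  next
    case False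
    then show ?thesis using DERIV_inverse_power[of t j] that by (simp add: F_def)
  qed
  from differentiable_upto_compose[of "{0<..}", OF this, where f = f and j = 0] assms show ?thesis
    unfolding smooth_iff_differentiable_upto by (auto simp: F_def)
qed

definition flat :: "nat \<Rightarrow> real \<Rightarrow> real" where
  "flat j s = (if s > 0 then exp (- 1 / s) * (1 / s) ^ j else 0)"

lemma power_le_fact_exp: "(y::real) \<ge> 0 \<Longrightarrow> y ^ n \<le> fact n * exp y"
proof -
  assume "y \<ge> 0"
  have "(\<Sum>k\<in>{n}. y ^ k /\<^sub>R fact k) \<le> (\<Sum>k. y ^ k /\<^sub>R fact k)"
    using \<open>y \<ge> 0\<close> by (intro sum_le_suminf summable_exp_generic) auto
  then show ?thesis by (simp add: exp_def field_simps)
qed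

text \<open>The exponential series is compared at order \<open>j + 2\<close>: j powers cancel the
  pole and two remain, so the difference quotient of \<open>flat j\<close> at the origin tends to
  0.\<close>

lemma flat_le: "\<bar>flat j s\<bar> \<le> fact (j + 2) * s\<^sup>2"
proof (cases "s > 0")
  case True
  have "(1/s) ^ (j + 2) \<le> fact (j + 2) * exp (1/s)" using True by (intro power_le_fact_exp) auto
  then have "exp (- 1 / s) * (1/s) ^ (j + 2) \<le> exp (- 1 / s) * (fact (j + 2) * exp (1/s))"
    by (intro mult_left_mono) auto
  also have "\<dots> = fact (j + 2)"
    by (simp add: exp_minus)
  finally have "exp (- 1 / s) * (1/s) ^ (j + 2) \<le> fact (j + 2)" .
  then have "exp (- 1 / s) * (1/s) ^ j * (1/s)^2 \<le> fact (j + 2)"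
    by (simp only: power_add mult.assoc)
  then show ?thesis using True by (simp add: flat_def field_simps)
qed (auto simp: flat_def)

lemma flat_deriv: "(flat j has_real_derivative - real j * flat (j + 1) s + 1 * flat (j + 2) s) (at s)"
proof -
  consider "s > 0" | "s < 0" | "s = 0" by linarith
  then show ?thesis
  proof cases
    case 1
    have "((\<lambda>s. exp (- 1 / s) * (1 / s) ^ j) has_real_derivative
        - real j * flat (j + 1) s + 1 * flat (j + 2) s) (at s)"
    proof -
      have "((\<lambda>s. exp (- 1 / s)) has_real_derivative exp (- 1 / s) * (1 / s)\<^sup>2) (at s)"
        using 1 by (auto intro!: derivative_eq_intros simp: power2_eq_square)
      from DERIV_mult[OF this DERIV_inverse_power[of s j]] show ?thesis
        using 1 by (simp add: flat_def power2_eq_square algebra_simps)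
    qed
    then show ?thesis
      by (rule has_field_derivative_transform_within[where d = s]) (use 1 in \<open>auto simp: flat_def dist_real_def\<close>)
  next
    case 2
    have "((\<lambda>s. 0) has_real_derivative 0) (at s)" by simp
    then have "(flat j has_real_derivative 0) (at s)"
      by (rule has_field_derivative_transform_within[where d = "-s"]) (use 2 in \<open>auto simp: flat_def dist_real_def\<close>)
    then show ?thesis using 2 by (simp add: flat_def)
  next
    case 3
    have "((\<lambda>h. (flat j h - flat j 0) / (h - 0)) \<longlongrightarrow> 0) (at 0)"
    proof (rule Lim_null_comparison)
      have "\<bar>flat j h / h\<bar> \<le> fact (j + 2) * \<bar>h\<bar>" if "h \<noteq> 0" for h
      proof -
        have "\<bar>flat j h\<bar> \<le> (fact (j + 2) * \<bar>h\<bar>) * \<bar>h\<bar>"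
          using flat_le[of j h] by (metis mult.assoc power2_abs power2_eq_square)
        then show ?thesis using that by (subst abs_divide, subst pos_divide_le_eq) auto
      qed
      then show "\<forall>\<^sub>F h in at 0. norm ((flat j h - flat j 0) / (h - 0)) \<le> fact (j + 2) * \<bar>h\<bar>"
        by (auto simp: eventually_at_filter flat_def[of j 0] simp del: abs_divide intro!: always_eventually)
      show "((\<lambda>h::real. fact (j + 2) * \<bar>h\<bar>) \<longlongrightarrow> 0) (at 0)"
        by (auto intro!: tendsto_eq_intros)
    qed
    then show ?thesis using 3 by (simp add: has_field_derivative_iff flat_def)
  qed
qed

lemma smooth_flat: "smooth f \<Longrightarrow> smooth (\<lambda>x. flat j (f x))"
  unfolding smooth_iff_differentiable_upto
  using differentiable_upto_compose[of UNIV flat "\<lambda>j. - real j" "\<lambda>j. 1" f, OF flat_deriv] by simp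

lemma flat_nonneg: "flat j s \<ge> 0" by (simp add: flat_def)

lemma flat_pos: "s > 0 \<Longrightarrow> flat j s > 0" by (simp add: flat_def)

lemma flat_eq_0: "s \<le> 0 \<Longrightarrow> flat j s = 0" by (simp add: flat_def)

subsection \<open>Test functions\<close>

lemma test_functionsD:
  assumes "\<phi> \<in> test_functions \<Omega>"
  shows "smooth \<phi>" "compact (closure {x. \<phi> x \<noteq> 0})" "closure {x. \<phi> x \<noteq> 0} \<subseteq> \<Omega>"
  using assms by (auto simp: test_functions_def)

lemma test_functionsI:
  assumes "smooth \<phi>" "compact K" "K \<subseteq> \<Omega>" "\<And>x. \<phi> x \<noteq> 0 \<Longrightarrow> x \<in> K"
  shows "\<phi> \<in> test_functions \<Omega>"
proof -
  have "closure {x. \<phi> x \<noteq> 0} \<subseteq> K"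
    using assms by (intro closure_minimal compact_imp_closed) auto
  moreover have "compact (closure {x. \<phi> x \<noteq> 0})"
    using calculation assms(2) by (metis closed_closure compact_Int_closed inf.absorb2)
  ultimately show ?thesis using assms by (auto simp: test_functions_def)
qed

lemma support_memI: "\<phi> x \<noteq> 0 \<Longrightarrow> x \<in> closure {x. \<phi> x \<noteq> 0}"
  by (rule closure_subset[THEN subsetD]) simp

lemma test_functions_mono: "\<Omega> \<subseteq> \<Omega>' \<Longrightarrow> test_functions \<Omega> \<subseteq> test_functions \<Omega>'"
  by (auto simp: test_functions_def)

lemma partial_deriv_nonzero_imp:
  assumes "partial_deriv i \<phi> x \<noteq> 0" "closed K" "\<And>x. \<phi> x \<noteq> 0 \<Longrightarrow> x \<in> K"
  shows "x \<in> K"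
proof (rule ccontr)
  assume x: "x \<notin> K"
  have "((\<lambda>x. 0) has_derivative (\<lambda>h. 0)) (at x)" by simp
  then have "(\<phi> has_derivative (\<lambda>h. 0)) (at x)"
    by (rule has_derivative_transform_within_open[where s = "- K"]) (use assms x in auto)
  from partial_deriv_eqI[OF this, of i] assms(1) show False by simp
qed

lemma test_functions_partial_deriv:
  assumes "\<phi> \<in> test_functions \<Omega>"
  shows "partial_deriv i \<phi> \<in> test_functions \<Omega>"
proof (rule test_functionsI)
  note * = test_functionsD[OF assms]
  show "smooth (partial_deriv i \<phi>)" using * smooth_partial_deriv by blast
  show "compact (closure {x. \<phi> x \<noteq> 0})" "closure {x. \<phi> x \<noteq> 0} \<subseteq> \<Omega>" by fact+
  show "x \<in> closure {x. \<phi> x \<noteq> 0}" if "partial_deriv i \<phi> x \<noteq> 0" for x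
    using that by (rule partial_deriv_nonzero_imp) (auto intro: support_memI)
qed

lemma test_functions_mult:
  assumes "smooth f" "\<phi> \<in> test_functions \<Omega>"
  shows "(\<lambda>x. f x * \<phi> x) \<in> test_functions \<Omega>"
proof (rule test_functionsI)
  note * = test_functionsD[OF assms(2)]
  show "smooth (\<lambda>x. f x * \<phi> x)" using * assms by auto
  show "compact (closure {x. \<phi> x \<noteq> 0})" "closure {x. \<phi> x \<noteq> 0} \<subseteq> \<Omega>" by fact+
  show "x \<in> closure {x. \<phi> x \<noteq> 0}" if "f x * \<phi> x \<noteq> 0" for x
    using that by (auto intro: support_memI)
qed

lemma test_functions_diff:
  assumes "\<phi> \<in> test_functions \<Omega>" "\<psi> \<in> test_functions \<Omega>"
  shows "(\<lambda>x. \<phi> x - \<psi> x) \<in> test_functions \<Omega>"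
proof (rule test_functionsI)
  note * = test_functionsD[OF assms(1)] test_functionsD[OF assms(2)]
  show "smooth (\<lambda>x. \<phi> x - \<psi> x)" using * by auto
  show "compact (closure {x. \<phi> x \<noteq> 0} \<union> closure {x. \<psi> x \<noteq> 0})"
    "closure {x. \<phi> x \<noteq> 0} \<union> closure {x. \<psi> x \<noteq> 0} \<subseteq> \<Omega>" using * by auto
  show "x \<in> closure {x. \<phi> x \<noteq> 0} \<union> closure {x. \<psi> x \<noteq> 0}" if "\<phi> x - \<psi> x \<noteq> 0" for x
    using that by (cases "\<phi> x = 0") (auto intro: support_memI)
qed

lemma test_functions_bounded:
  assumes "\<phi> \<in> test_functions \<Omega>"
  obtains B where "B \<ge> 0" "\<And>x. \<bar>\<phi> x\<bar> \<le> B"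
proof -
  note * = test_functionsD[OF assms]
  have "compact (\<phi> ` closure {x. \<phi> x \<noteq> 0})"
    using * by (intro compact_continuous_image smooth_continuous_on)
  then have "bounded (\<phi> ` closure {x. \<phi> x \<noteq> 0})" by (rule compact_imp_bounded)
  then obtain B where B: "B > 0" "\<And>x. x \<in> closure {x. \<phi> x \<noteq> 0} \<Longrightarrow> \<bar>\<phi> x\<bar> \<le> B"
    by (auto simp: bounded_pos)
  have "\<bar>\<phi> x\<bar> \<le> B" for x
    using B closure_subset[of "{x. \<phi> x \<noteq> 0}"] by (cases "\<phi> x = 0") auto
  then show ?thesis using B that[of B] by auto
qed

lemma test_functions_measurable [measurable_dest]:
  "\<phi> \<in> test_functions \<Omega> \<Longrightarrow> \<phi> \<in> borel_measurable borel"
  using smooth_borel_measurable test_functionsD by blast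

lemma test_functions_integrable:
  assumes "\<phi> \<in> test_functions \<Omega>"
  shows "integrable lborel \<phi>"
proof -
  note * = test_functionsD[OF assms]
  let ?K = "closure {x. \<phi> x \<noteq> 0}"
  have "integrable lborel (\<lambda>x. indicator ?K x *\<^sub>R \<phi> x)"
    by (rule borel_integrable_compact) (use * smooth_continuous_on in auto)
  moreover have "(\<lambda>x. indicator ?K x *\<^sub>R \<phi> x) = \<phi>"
    using closure_subset[of "{x. \<phi> x \<noteq> 0}"] by (auto simp: indicator_def fun_eq_iff)
  ultimately show ?thesis by simp
qed

section \<open>Mean values along coordinate lines and mixed derivatives\<close>

lemma has_derivative_line:
  fixes f :: "real^'n::finite \<Rightarrow> real"
  assumes "f differentiable (at (x + t *\<^sub>R axis i 1))"
  shows "((\<lambda>t. f (x + t *\<^sub>R axis i 1)) has_real_derivative partial_deriv i f (x + t *\<^sub>R axis i 1)) (at t)"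
proof -
  let ?y = "x + t *\<^sub>R axis i 1"
  have D: "(f has_derivative frechet_derivative f (at ?y)) (at ?y)"
    using assms frechet_derivative_works by blast
  have "((\<lambda>t. x + t *\<^sub>R axis i 1) has_derivative (\<lambda>h. h *\<^sub>R axis i 1)) (at t)"
    by (auto intro!: derivative_eq_intros)
  from has_derivative_compose[OF this D]
  have "((\<lambda>t. f (x + t *\<^sub>R axis i 1)) has_derivative (\<lambda>h. frechet_derivative f (at ?y) (h *\<^sub>R axis i 1))) (at t)" .
  moreover have "frechet_derivative f (at ?y) (h *\<^sub>R axis i 1) = partial_deriv i f ?y * h" for h
    using D by (simp add: partial_deriv_def linear_simps has_derivative_bounded_linear bounded_linear.linear
      linear_cmul mult.commute)
  ultimately show ?thesis by (simp add: has_field_derivative_def)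
qed

lemma partial_deriv_mvt:
  fixes f :: "real^'n::finite \<Rightarrow> real"
  assumes "smooth f" "h > 0"
  obtains t where "0 < t" "t < h" "f (x + h *\<^sub>R axis i 1) - f x = h * partial_deriv i f (x + t *\<^sub>R axis i 1)"
proof -
  have "\<exists>z. 0 < z \<and> z < h \<and> f (x + h *\<^sub>R axis i 1) - f (x + 0 *\<^sub>R axis i 1) =
      (h - 0) * partial_deriv i f (x + z *\<^sub>R axis i 1)"
    by (rule MVT2[OF assms(2)]) (use assms has_derivative_line smooth_differentiable in blast)
  then show ?thesis using that by auto
qed

text \<open>The mean value theorem twice: for the increment in direction j as a function along
  direction i, then for the i-th partial derivative along direction j.\<close>

lemma second_difference:
  fixes f :: "real^'n::finite \<Rightarrow> real"
  assumes "smooth f" "h > 0"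
  obtains y where "dist y x \<le> 2 * h"
    "f (x + h *\<^sub>R axis i 1 + h *\<^sub>R axis j 1) - f (x + h *\<^sub>R axis i 1) - f (x + h *\<^sub>R axis j 1) + f x
      = h * (h * partial_deriv j (partial_deriv i f) y)"
proof -
  let ?a = "h *\<^sub>R axis j 1 :: real^'n"
  define g where "g z = f (z + ?a) - f z" for z
  have "((\<lambda>t. g (x + t *\<^sub>R axis i 1)) has_real_derivative
     partial_deriv i f (x + t *\<^sub>R axis i 1 + ?a) - partial_deriv i f (x + t *\<^sub>R axis i 1)) (at t)" for t
    unfolding g_def
    using has_derivative_line[of f "x + ?a" t i] has_derivative_line[of f x t i]
      smooth_differentiable[OF assms(1)]
    by (auto intro!: DERIV_diff simp: add_ac)
  then have "\<exists>z. 0 < z \<and> z < h \<and> g (x + h *\<^sub>R axis i 1) - g (x + 0 *\<^sub>R axis i 1) =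
      (h - 0) * (partial_deriv i f (x + z *\<^sub>R axis i 1 + ?a) - partial_deriv i f (x + z *\<^sub>R axis i 1))"
    by (intro MVT2[OF assms(2)])
  then obtain t where t: "0 < t" "t < h" "g (x + h *\<^sub>R axis i 1) - g x =
      h * (partial_deriv i f (x + t *\<^sub>R axis i 1 + ?a) - partial_deriv i f (x + t *\<^sub>R axis i 1))"
    by auto
  from partial_deriv_mvt[OF smooth_partial_deriv[OF assms(1), of i] assms(2), of "x + t *\<^sub>R axis i 1" j]
  obtain s where s: "0 < s" "s < h" "partial_deriv i f (x + t *\<^sub>R axis i 1 + ?a) - partial_deriv i f (x + t *\<^sub>R axis i 1)
      = h * partial_deriv j (partial_deriv i f) (x + t *\<^sub>R axis i 1 + s *\<^sub>R axis j 1)" by metis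
  have "norm (t *\<^sub>R axis i 1 + s *\<^sub>R axis j 1 :: real^'n) \<le> t + s"
    using t s by (intro norm_triangle_le) (auto simp: norm_axis_1)
  then have "dist (x + t *\<^sub>R axis i 1 + s *\<^sub>R axis j 1) x \<le> 2 * h"
    using t s by (simp add: dist_norm add.assoc)
  then show ?thesis using that t(3) s(3) by (simp add: g_def)
qed

text \<open>Schwarz's theorem. The second difference is symmetric in i and j; divided by the square
  of the step it tends to either mixed derivative, since both are continuous.\<close>

lemma partial_deriv_commute:
  fixes f :: "real^'n::finite \<Rightarrow> real"
  assumes "smooth f"
  shows "partial_deriv j (partial_deriv i f) = partial_deriv i (partial_deriv j f)"
proof
  fix x
  let ?g = "\<lambda>i j. partial_deriv j (partial_deriv i f)"
  define h where "h n = 1 / real (Suc n)" for n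
  have h: "h n > 0" for n by (simp add: h_def)
  have h0: "h \<longlonglongrightarrow> 0" unfolding h_def by (rule LIMSEQ_Suc[OF lim_1_over_n])
  define \<Delta> where "\<Delta> n = f (x + h n *\<^sub>R axis i 1 + h n *\<^sub>R axis j 1) - f (x + h n *\<^sub>R axis i 1)
      - f (x + h n *\<^sub>R axis j 1) + f x" for n
  have lim: "(\<lambda>n. \<Delta> n / (h n * h n)) \<longlonglongrightarrow> ?g k l x"
    if D: "\<And>n. \<exists>y. dist y x \<le> 2 * h n \<and> \<Delta> n = h n * (h n * ?g k l y)" for k l
  proof -
    obtain y where y: "\<And>n. dist (y n) x \<le> 2 * h n" "\<And>n. \<Delta> n = h n * (h n * ?g k l (y n))"
      using D by metis
    have "y \<longlonglongrightarrow> x"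
    proof (rule tendsto_dist_iff[THEN iffD2], rule Lim_null_comparison)
      show "\<forall>\<^sub>F n in sequentially. norm (dist (y n) x) \<le> 2 * h n" using y by simp
      show "(\<lambda>n. 2 * h n) \<longlonglongrightarrow> 0" using tendsto_mult_right_zero[OF h0] by simp
    qed
    moreover have "isCont (?g k l) x"
      using smooth_continuous_on[OF smooth_partial_deriv[OF smooth_partial_deriv[OF assms]], of UNIV]
      by (simp add: continuous_on_eq_continuous_at)
    ultimately have "(\<lambda>n. ?g k l (y n)) \<longlonglongrightarrow> ?g k l x"
      using isCont_tendsto_compose by blast
    moreover have "\<Delta> n / (h n * h n) = ?g k l (y n)" for n
      using y(2)[of n] h[of n] by simp
    ultimately show ?thesis by simp
  qed
  have "\<exists>y. dist y x \<le> 2 * h n \<and> \<Delta> n = h n * (h n * ?g i j y)" for n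
    using second_difference[OF assms h, of x n i j] unfolding \<Delta>_def by metis
  moreover have "\<exists>y. dist y x \<le> 2 * h n \<and> \<Delta> n = h n * (h n * ?g j i y)" for n
  proof -
    obtain y where y: "dist y x \<le> 2 * h n" "f (x + h n *\<^sub>R axis j 1 + h n *\<^sub>R axis i 1)
        - f (x + h n *\<^sub>R axis j 1) - f (x + h n *\<^sub>R axis i 1) + f x = h n * (h n * ?g j i y)"
      using second_difference[OF assms h, of x n j i] .
    have "x + h n *\<^sub>R axis j 1 + h n *\<^sub>R axis i 1 = x + h n *\<^sub>R axis i 1 + h n *\<^sub>R axis j 1"
      by (simp add: add_ac)
    with y show ?thesis unfolding \<Delta>_def by (intro exI[of _ y]) (simp add: add_ac)
  qed
  ultimately show "?g i j x = ?g j i x" using lim LIMSEQ_unique by blast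
qed

section \<open>Translation invariance and integrals of derivatives\<close>

lemma lborel_integrable_translate:
  fixes f :: "'a::euclidean_space \<Rightarrow> real"
  assumes "integrable lborel f"
  shows "integrable lborel (\<lambda>x. f (c + x))"
proof -
  have "integrable (distr lborel borel ((+) c)) f" using assms by (simp add: lborel_distr_plus)
  then show ?thesis by (intro integrable_distr[of "(+) c" lborel borel f]) auto
qed

lemma lborel_integral_translate:
  fixes f :: "'a::euclidean_space \<Rightarrow> real"
  assumes [measurable]: "f \<in> borel_measurable borel"
  shows "(LINT x|lborel. f (c + x)) = (LINT x|lborel. f x)"
proof -
  have "(LINT x|lborel. f x) = (LINT x|distr lborel borel ((+) c). f x)"
    by (simp only: lborel_distr_plus)
  also have "\<dots> = (LINT x|lborel. f (c + x))"
    by (intro integral_distr) auto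
  finally show ?thesis by simp
qed

text \<open>Difference quotients of \<open>\<phi>\<close> have integral 0 by translation invariance,
  and the mean value theorem bounds them by a bound of the derivative.\<close>

lemma integral_partial_deriv_eq_0:
  fixes \<phi> :: "real^'n::finite \<Rightarrow> real"
  assumes "\<phi> \<in> test_functions UNIV"
  shows "(LINT x|lborel. partial_deriv i \<phi> x) = 0"
proof -
  note sm = test_functionsD(1)[OF assms]
  note d = test_functions_partial_deriv[OF assms, of i]
  let ?K = "closure {x. \<phi> x \<noteq> 0}"
  obtain R where R: "\<And>x. x \<in> ?K \<Longrightarrow> norm x \<le> R"
    using test_functionsD(2)[OF assms] compact_imp_bounded bounded_iff by metis
  have 0: "\<phi> x = 0" if "norm x > R" for x
    using R[of x] closure_subset[of "{x. \<phi> x \<noteq> 0}"] that by force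
  obtain B where B: "B \<ge> 0" "\<And>x. \<bar>partial_deriv i \<phi> x\<bar> \<le> B" using test_functions_bounded[OF d] by blast
  define h where "h n = 1 / real (Suc n)" for n
  have h: "h n > 0" "h n \<le> 1" for n by (auto simp: h_def)
  have h0: "h \<longlonglongrightarrow> 0" unfolding h_def by (rule LIMSEQ_Suc[OF lim_1_over_n])
  define q where "q n x = (\<phi> (h n *\<^sub>R axis i 1 + x) - \<phi> x) / h n" for n x
  have meas [measurable]: "\<phi> \<in> borel_measurable borel" using assms by measurable
  have int: "(LINT x|lborel. q n x) = 0" for n
  proof -
    have "integrable lborel \<phi>" using assms test_functions_integrable by blast
    then show ?thesis using lborel_integrable_translate[of \<phi> "h n *\<^sub>R axis i 1"]
      lborel_integral_translate[of \<phi> "h n *\<^sub>R axis i 1"] by (simp add: q_def)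
  qed
  have "(\<lambda>n. LINT x|lborel. q n x) \<longlonglongrightarrow> (LINT x|lborel. partial_deriv i \<phi> x)"
  \<comment> \<open>The increments satisfy \<open>h n \<le> 1\<close>, so all quotients vanish
    outside the ball of radius \<open>R + 1\<close>.\<close>
  proof (rule integral_dominated_convergence[where w = "\<lambda>x. B * indicator (cball 0 (R + 1)) x"])
    show "partial_deriv i \<phi> \<in> borel_measurable lborel" using d by measurable
    show "q n \<in> borel_measurable lborel" for n unfolding q_def by measurable
    show "integrable lborel (\<lambda>x. B * indicator (cball 0 (R + 1)) x :: real)"
      by (intro integrable_mult_right integrable_real_indicator) (use emeasure_lborel_cball_finite[of 0 "R + 1"] in auto)
    show "AE x in lborel. (\<lambda>n. q n x) \<longlonglongrightarrow> partial_deriv i \<phi> x"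
    proof (rule AE_I2)
      fix x :: "real^'n"
      have "((\<lambda>t. (\<phi> (x + (0 + t) *\<^sub>R axis i 1) - \<phi> (x + 0 *\<^sub>R axis i 1)) / t) \<longlongrightarrow> partial_deriv i \<phi> (x + 0 *\<^sub>R axis i 1)) (at 0)"
        using has_derivative_line[of \<phi> x 0 i] smooth_differentiable[OF sm] by (auto simp: DERIV_def)
      then have "((\<lambda>t. (\<phi> (x + t *\<^sub>R axis i 1) - \<phi> x) / t) \<longlongrightarrow> partial_deriv i \<phi> x) (at 0)" by simp
      then have "(\<lambda>n. (\<phi> (x + h n *\<^sub>R axis i 1) - \<phi> x) / h n) \<longlonglongrightarrow> partial_deriv i \<phi> x"
        by (rule filterlim_compose)
          (use h h0 in \<open>auto simp: filterlim_at less_imp_neq[symmetric] intro!: always_eventually\<close>)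
      then show "(\<lambda>n. q n x) \<longlonglongrightarrow> partial_deriv i \<phi> x" by (simp add: q_def add.commute)
    qed
    show "AE x in lborel. norm (q n x) \<le> B * indicator (cball 0 (R + 1)) x" for n
    proof (rule AE_I2)
      fix x :: "real^'n"
      obtain t where t: "0 < t" "t < h n"
        "\<phi> (x + h n *\<^sub>R axis i 1) - \<phi> x = h n * partial_deriv i \<phi> (x + t *\<^sub>R axis i 1)"
        using partial_deriv_mvt[OF sm h(1)] by blast
      then have q: "q n x = partial_deriv i \<phi> (x + t *\<^sub>R axis i 1)"
        using h(1)[of n] by (simp add: q_def add.commute)
      show "norm (q n x) \<le> B * indicator (cball 0 (R + 1)) x"
      proof (cases "norm x \<le> R + 1")
        case True
        then show ?thesis using q B by simp
      next
        case False
        have "norm (x + h n *\<^sub>R axis i 1) \<ge> norm x - norm (h n *\<^sub>R axis i 1 :: real^'n)"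
          using norm_diff_ineq by blast
        then have "norm (x + h n *\<^sub>R axis i 1) > R" using False h[of n] by (simp add: norm_axis_1)
        then show ?thesis using 0 False by (simp add: q_def add.commute)
      qed
    qed
  qed
  then show ?thesis using int by (simp add: LIMSEQ_const_iff)
qed

section \<open>Bump functions\<close>

lemma smooth_norm_sq: "smooth (\<lambda>x::real^'n::finite. x \<bullet> x)"
proof -
  have "(\<lambda>x::real^'n. x \<bullet> x) = (\<lambda>x. \<Sum>i\<in>UNIV. (axis i 1 \<bullet> x) * (axis i 1 \<bullet> x))"
    by (simp only: inner_axis' inner_vec_def[of "x :: real^'n" x for x]) auto
  then show ?thesis by (simp only:) (intro smooth_sum smooth_mult smooth_inner)
qed

text \<open>A mollifier kernel without normalization: averages against it serve only to conclude
  that something vanishes. Its value depends on the distance of \<open>a\<close> and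
  \<open>x\<close> alone, so either of the two can be the variable.\<close>

definition bump :: "real^'n::finite \<Rightarrow> real \<Rightarrow> real^'n \<Rightarrow> real" where
  "bump a e x = flat 0 (e\<^sup>2 - (norm (x - a))\<^sup>2)"

lemma bump_nonneg: "bump a e x \<ge> 0"
  by (simp add: bump_def flat_nonneg)

lemma bump_pos: "norm (x - a) < e \<Longrightarrow> bump a e x > 0"
  unfolding bump_def by (intro flat_pos) (simp add: power_strict_mono)

lemma bump_eq_0: "norm (x - a) \<ge> e \<Longrightarrow> e \<ge> 0 \<Longrightarrow> bump a e x = 0"
  unfolding bump_def by (intro flat_eq_0) (simp add: power_mono)

lemma bump_eq: "bump a e = (\<lambda>x. flat 0 (e\<^sup>2 - (x \<bullet> x - 2 * (a \<bullet> x) + a \<bullet> a)))"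
  by (auto simp: bump_def fun_eq_iff power2_norm_eq_inner inner_diff inner_commute algebra_simps)

lemma smooth_bump: "smooth (bump a e)"
  unfolding bump_eq by (intro smooth_flat smooth_diff smooth_add smooth_cmult smooth_norm_sq) auto

lemma bump_test_function:
  assumes "cball a e \<subseteq> \<Omega>" "e \<ge> 0"
  shows "bump a e \<in> test_functions \<Omega>"
proof (rule test_functionsI[OF smooth_bump compact_cball assms(1)])
  show "x \<in> cball a e" if "bump a e x \<noteq> 0" for x
    using that assms(2) bump_eq_0[of e x a] by (force simp: dist_norm norm_minus_commute)
qed

lemma partial_deriv_bump:
  "partial_deriv i (bump a e) x = - 2 * (x $ i - a $ i) * flat 2 (e\<^sup>2 - (norm (x - a))\<^sup>2)"
proof -
  have "((\<lambda>x. e\<^sup>2 - (x - a) \<bullet> (x - a)) has_derivative (\<lambda>h. - (2 * ((x - a) \<bullet> h)))) (at x)"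
    by (auto intro!: derivative_eq_intros simp: inner_commute)
  then have *: "(\<lambda>x. e\<^sup>2 - (x - a) \<bullet> (x - a)) differentiable (at x)"
    "partial_deriv i (\<lambda>x. e\<^sup>2 - (x - a) \<bullet> (x - a)) x = - 2 * (x $ i - a $ i)"
    by (auto simp: differentiable_def partial_deriv_eqI inner_axis)
  have "(flat 0 has_real_derivative flat 2 t) (at t)" for t
    using flat_deriv[of 0 t] by (simp add: numeral_2_eq_2)
  from partial_deriv_compose[OF *(1) this, of i] show ?thesis
    unfolding *(2) by (simp add: bump_def[abs_def] power2_norm_eq_inner)
qed

subsection \<open>Continuity of translations\<close>

lemma integrable_bounded_mult:
  fixes f g :: "'a::euclidean_space \<Rightarrow> real"
  assumes "integrable lborel f" "g \<in> borel_measurable borel" "\<And>x. \<bar>g x\<bar> \<le> B"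
  shows "integrable lborel (\<lambda>x. f x * g x)"
proof (rule Bochner_Integration.integrable_bound)
  show "integrable lborel (\<lambda>x. B * f x)" using assms by simp
  show "(\<lambda>x. f x * g x) \<in> borel_measurable lborel" using assms by measurable
  show "AE x in lborel. norm (f x * g x) \<le> norm (B * f x)"
  proof (rule AE_I2)
    fix x
    have "\<bar>f x\<bar> * \<bar>g x\<bar> \<le> \<bar>f x\<bar> * \<bar>B\<bar>"
      using assms(3)[of x] by (intro mult_left_mono) auto
    then show "norm (f x * g x) \<le> norm (B * f x)" by (simp add: abs_mult mult.commute)
  qed
qed

lemma integrable_square_mult:
  fixes f g :: "'a \<Rightarrow> real"
  assumes [measurable]: "f \<in> borel_measurable M" "g \<in> borel_measurable M"
    and "integrable M (\<lambda>x. (f x)\<^sup>2)" "integrable M (\<lambda>x. (g x)\<^sup>2)"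
  shows "integrable M (\<lambda>x. f x * g x)"
proof (rule Bochner_Integration.integrable_bound)
  show "integrable M (\<lambda>x. (f x)\<^sup>2 + (g x)\<^sup>2)" using assms by simp
  show "AE x in M. norm (f x * g x) \<le> norm ((f x)\<^sup>2 + (g x)\<^sup>2)"
  proof (rule AE_I2)
    fix x
    have "2 * \<bar>f x * g x\<bar> \<le> (f x)\<^sup>2 + (g x)\<^sup>2"
      using sum_squares_bound[of "\<bar>f x\<bar>" "\<bar>g x\<bar>"] by (simp add: abs_mult mult.assoc)
    then show "norm (f x * g x) \<le> norm ((f x)\<^sup>2 + (g x)\<^sup>2)" by simp
  qed
qed measurable

text \<open>Young's inequality with a free parameter takes the place of Cauchy-Schwarz and keeps
  square roots out of the estimates; a factor 1/2 is given away.\<close>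

lemma integral_mult_le:
  fixes f g :: "'a \<Rightarrow> real"
  assumes [measurable]: "f \<in> borel_measurable M" "g \<in> borel_measurable M"
    and i: "integrable M (\<lambda>x. (f x)\<^sup>2)" "integrable M (\<lambda>x. (g x)\<^sup>2)" and t: "t > 0"
  shows "\<bar>LINT x|M. f x * g x\<bar> \<le> t * (LINT x|M. (f x)\<^sup>2) + (LINT x|M. (g x)\<^sup>2) / t"
proof -
  have "\<bar>LINT x|M. f x * g x\<bar> \<le> (LINT x|M. \<bar>f x * g x\<bar>)" by (rule integral_abs_bound)
  also have "\<dots> \<le> (LINT x|M. t * (f x)\<^sup>2 + (g x)\<^sup>2 / t)"
  proof (rule integral_mono)
    show "integrable M (\<lambda>x. \<bar>f x * g x\<bar>)" using integrable_square_mult[OF assms(1-4)] by simp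
    show "integrable M (\<lambda>x. t * (f x)\<^sup>2 + (g x)\<^sup>2 / t)" using i by simp
    fix x
    have "2 * \<bar>f x\<bar> * \<bar>g x\<bar> \<le> t * (f x)\<^sup>2 + (g x)\<^sup>2 / t"
      using sum_squares_bound[of "sqrt t * \<bar>f x\<bar>" "\<bar>g x\<bar> / sqrt t"] t
      by (simp add: power_mult_distrib power_divide)
    moreover have "\<bar>f x\<bar> * \<bar>g x\<bar> \<ge> 0" by simp
    ultimately show "\<bar>f x * g x\<bar> \<le> t * (f x)\<^sup>2 + (g x)\<^sup>2 / t" unfolding abs_mult by linarith
  qed
  also have "\<dots> = t * (LINT x|M. (f x)\<^sup>2) + (LINT x|M. (g x)\<^sup>2) / t" using i by simp
  finally show ?thesis .
qed

definition clamp :: "real \<Rightarrow> real \<Rightarrow> real" where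
  "clamp m t = max (- m) (min m t)"

lemma clamp_abs_le: "m \<ge> 0 \<Longrightarrow> \<bar>clamp m t\<bar> \<le> m" "m \<ge> 0 \<Longrightarrow> \<bar>clamp m t\<bar> \<le> \<bar>t\<bar>"
  by (auto simp: clamp_def)

lemma clamp_eq: "\<bar>t\<bar> \<le> m \<Longrightarrow> clamp m t = t"
  by (auto simp: clamp_def)

lemma clamp_diff_le: "m \<ge> 0 \<Longrightarrow> \<bar>t - clamp m t\<bar> \<le> \<bar>t\<bar>"
  by (auto simp: clamp_def)

lemma continuous_clamp: "continuous_on A (clamp m)"
  unfolding clamp_def by (intro continuous_intros)

lemma clamp_measurable [measurable]: "clamp m \<in> borel_measurable borel"
  by (intro borel_measurable_continuous_onI continuous_clamp)

lemma clamp_eventually_eq: "eventually (\<lambda>n. clamp (real n) t = t) sequentially"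
  using eventually_ge_at_top[of "nat \<lceil>\<bar>t\<bar>\<rceil>"]
  by eventually_elim (rule clamp_eq, linarith)

text \<open>Truncation in value and in space costs little and leaves a bounded function on a ball.
  Measurability gives continuous functions converging almost everywhere; truncating these in the
  same way makes dominated convergence applicable.\<close>

lemma L1_approx_continuous:
  fixes g :: "'a::euclidean_space \<Rightarrow> real"
  assumes g: "integrable lborel g" and "e > 0"
  obtains k R where "continuous_on UNIV k" "\<And>x. norm x \<ge> R \<Longrightarrow> k x = 0" "integrable lborel k"
    "(LINT x|lborel. \<bar>g x - k x\<bar>) < e"
proof -
  have gm [measurable]: "g \<in> borel_measurable borel" using borel_measurable_integrable[OF g] by simp
  define c where "c m x = max 0 (min 1 (real m + 1 - norm x))" for m :: nat and x :: 'a
  have cc: "continuous_on UNIV (c m)" for m unfolding c_def by (intro continuous_intros)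
  then have [measurable]: "c m \<in> borel_measurable borel" for m by (intro borel_measurable_continuous_onI)
  have c01: "0 \<le> c m x" "c m x \<le> 1" for m x by (auto simp: c_def)
  have c0: "c m x = 0" if "norm x \<ge> real m + 1" for m x using that by (simp add: c_def)
  have c1: "eventually (\<lambda>m. c m x = 1) sequentially" for x
    using eventually_ge_at_top[of "nat \<lceil>norm x\<rceil>"]
  proof eventually_elim
    case (elim m)
    then have "norm x \<le> real m" by linarith
    then show ?case by (simp add: c_def)
  qed
  define T where "T m x = c m x * clamp (real m) (g x)" for m x
  have [measurable]: "T m \<in> borel_measurable borel" for m unfolding T_def by measurable
  have "(\<lambda>m. LINT x|lborel. \<bar>g x - T m x\<bar>) \<longlonglongrightarrow> (LINT x|(lborel :: 'a measure). (0::real))"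
  proof (rule integral_dominated_convergence[where w = "\<lambda>x. 2 * \<bar>g x\<bar>"])
    show "AE x in lborel. (\<lambda>m. \<bar>g x - T m x\<bar>) \<longlonglongrightarrow> 0"
    proof (rule AE_I2)
      fix x
      have "eventually (\<lambda>m. \<bar>g x - T m x\<bar> = 0) sequentially"
        using c1[of x] clamp_eventually_eq[of "g x"] by eventually_elim (simp add: T_def)
      then show "(\<lambda>m. \<bar>g x - T m x\<bar>) \<longlonglongrightarrow> 0" by (rule tendsto_eventually)
    qed
    show "AE x in lborel. norm \<bar>g x - T m x\<bar> \<le> 2 * \<bar>g x\<bar>" for m
    proof (rule AE_I2)
      fix x
      have "\<bar>T m x\<bar> \<le> 1 * \<bar>g x\<bar>" unfolding T_def abs_mult
        using c01 by (intro mult_mono clamp_abs_le) auto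
      then show "norm \<bar>g x - T m x\<bar> \<le> 2 * \<bar>g x\<bar>" by auto
    qed
  qed (use g in auto)
  then have "eventually (\<lambda>m. (LINT x|lborel. \<bar>g x - T m x\<bar>) < e / 2) sequentially"
    using \<open>e > 0\<close> by (intro order_tendstoD(2)) auto
  then obtain m where m: "(LINT x|lborel. \<bar>g x - T m x\<bar>) < e / 2"
    by (auto simp: eventually_sequentially)
  have iT: "integrable lborel (T m)"
    by (rule Bochner_Integration.integrable_bound[OF g])
      (use c01 in \<open>auto simp: T_def abs_mult intro!: AE_I2 mult_mono[of _ 1 _ "\<bar>g x\<bar>" for x, simplified] clamp_abs_le\<close>)
  have "g measurable_on UNIV"
    by (intro lebesgue_measurable_imp_measurable_on) (auto simp: measurable_completion)
  then obtain N h where N: "negligible N" "\<And>n. continuous_on UNIV (h n)"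
    "\<And>x. x \<notin> N \<Longrightarrow> (\<lambda>n. h n x) \<longlonglongrightarrow> g x"
    by (auto simp: measurable_on_def)
  have [measurable]: "h n \<in> borel_measurable borel" for n
    by (intro borel_measurable_continuous_onI N)
  define H where "H n x = c m x * clamp (real m) (h n x)" for n x
  have [measurable]: "H n \<in> borel_measurable borel" for n unfolding H_def by measurable
  have ibd: "integrable lborel (\<lambda>x :: 'a. (2 * real m) * indicator (cball 0 (real m + 1)) x :: real)"
    by (intro integrable_mult_right integrable_real_indicator)
      (use emeasure_lborel_cball_finite[of "0::'a" "real m + 1"] in auto)
  have Hle: "\<bar>H n x\<bar> \<le> real m * indicator (cball 0 (real m + 1)) x" for n x
  proof (cases "norm x \<le> real m + 1")
    case True
    have "\<bar>H n x\<bar> \<le> 1 * real m" unfolding H_def abs_mult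
      using c01 by (intro mult_mono clamp_abs_le) auto
    then show ?thesis using True by simp
  qed (simp add: H_def c0)
  have Tle: "\<bar>T m x\<bar> \<le> real m * indicator (cball 0 (real m + 1)) x" for x
  proof (cases "norm x \<le> real m + 1")
    case True
    have "\<bar>T m x\<bar> \<le> 1 * real m" unfolding T_def abs_mult
      using c01 by (intro mult_mono clamp_abs_le) auto
    then show ?thesis using True by simp
  qed (simp add: T_def c0)
  have "AE x in lebesgue. x \<notin> N" using N(1) by (simp add: negligible_iff_null_sets AE_not_in)
  then have "AE x in lebesgue. (\<lambda>n. h n x) \<longlonglongrightarrow> g x" by eventually_elim (rule N(3))
  then have "AE x in lborel. (\<lambda>n. h n x) \<longlonglongrightarrow> g x" by (simp only: AE_completion_iff)
  then have AE: "AE x in lborel. (\<lambda>n. \<bar>T m x - H n x\<bar>) \<longlonglongrightarrow> 0"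
  proof eventually_elim
    case (elim x)
    then have "(\<lambda>n. clamp (real m) (h n x)) \<longlonglongrightarrow> clamp (real m) (g x)"
      unfolding clamp_def by (intro tendsto_max tendsto_min tendsto_const)
    then have "(\<lambda>n. \<bar>T m x - H n x\<bar>) \<longlonglongrightarrow> \<bar>T m x - T m x\<bar>"
      unfolding T_def H_def by (intro tendsto_intros)
    then show ?case by simp
  qed
  have "(\<lambda>n. LINT x|lborel. \<bar>T m x - H n x\<bar>) \<longlonglongrightarrow> (LINT x|(lborel :: 'a measure). (0::real))"
  proof (rule integral_dominated_convergence[OF _ _ ibd AE])
    show "AE x in lborel. norm \<bar>T m x - H n x\<bar> \<le> 2 * real m * indicator (cball 0 (real m + 1)) x" for n
    proof (rule AE_I2)
      fix x
      show "norm \<bar>T m x - H n x\<bar> \<le> 2 * real m * indicator (cball 0 (real m + 1)) x"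
        using Hle[of n x] Tle[of x] by simp
    qed
  qed (auto simp: H_def)
  then have "eventually (\<lambda>n. (LINT x|lborel. \<bar>T m x - H n x\<bar>) < e / 2) sequentially"
    using \<open>e > 0\<close> by (intro order_tendstoD(2)) auto
  then obtain n where n: "(LINT x|lborel. \<bar>T m x - H n x\<bar>) < e / 2"
    by (auto simp: eventually_sequentially)
  have iH: "integrable lborel (H n)"
  proof (rule Bochner_Integration.integrable_bound[OF ibd])
    show "AE x in lborel. norm (H n x) \<le> norm (2 * real m * indicator (cball 0 (real m + 1)) x :: real)"
    proof (rule AE_I2)
      fix x show "norm (H n x) \<le> norm (2 * real m * indicator (cball 0 (real m + 1)) x :: real)"
        using Hle[of n x] by (auto simp: indicator_def split: if_splits)
    qed
  qed simp
  show ?thesis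
  proof (rule that[of "H n" "real m + 1"])
    show "continuous_on UNIV (H n)"
      unfolding H_def by (intro continuous_on_mult cc continuous_on_compose2[OF continuous_clamp N(2)]) auto
    show "H n x = 0" if "norm x \<ge> real m + 1" for x using that by (simp add: H_def c0)
    show "integrable lborel (H n)" by fact
    have "(LINT x|lborel. \<bar>g x - H n x\<bar>) \<le> (LINT x|lborel. \<bar>g x - T m x\<bar> + \<bar>T m x - H n x\<bar>)"
      using g iT iH by (intro integral_mono) auto
    also have "\<dots> = (LINT x|lborel. \<bar>g x - T m x\<bar>) + (LINT x|lborel. \<bar>T m x - H n x\<bar>)"
      using g iT iH by (intro Bochner_Integration.integral_add) auto
    finally show "(LINT x|lborel. \<bar>g x - H n x\<bar>) < e" using m n by linarith
  qed
qed

text \<open>For a continuous function with bounded support this is uniform continuity. The error of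
  approximating \<open>g\<close> by such a function enters twice, and is unaffected by the
  shift.\<close>

lemma L1_translation_continuous:
  fixes g :: "'a::euclidean_space \<Rightarrow> real"
  assumes g: "integrable lborel g"
  shows "((\<lambda>z. LINT y|lborel. \<bar>g (z + y) - g y\<bar>) \<longlongrightarrow> 0) (at 0)"
proof (rule tendstoI)
  fix e :: real assume "e > 0"
  then obtain k R where k: "continuous_on UNIV k" "\<And>x. norm x \<ge> R \<Longrightarrow> k x = 0" "integrable lborel k"
    "(LINT x|lborel. \<bar>g x - k x\<bar>) < e / 4"
    using L1_approx_continuous[OF g, of "e / 4"] by (metis zero_less_divide_iff zero_less_numeral)
  have [measurable]: "g \<in> borel_measurable borel" "k \<in> borel_measurable borel"
    using borel_measurable_integrable[OF g] borel_measurable_integrable[OF k(3)] by auto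
  let ?B = "cball 0 (\<bar>R\<bar> + 1) :: 'a set"
  have ifin: "integrable lborel (\<lambda>x. c * indicator ?B x :: real)" for c
    by (intro integrable_mult_right integrable_real_indicator)
      (use emeasure_lborel_cball_finite[of "0::'a" "\<bar>R\<bar> + 1"] in auto)
  \<comment> \<open>Chosen so that \<open>d\<close> times the volume of the ball is at most
    \<open>e / 4\<close>. The ball contains the supports of \<open>k\<close> and of its shifts by
    vectors of norm below 1.\<close>
  define d where "d = e / (4 * (measure lborel ?B + 1))"
  have d: "d > 0" using \<open>e > 0\<close> by (auto simp: d_def intro!: divide_pos_pos add_nonneg_pos)
  have "uniformly_continuous_on (cball 0 (\<bar>R\<bar> + 2)) k"
    using k(1) by (intro compact_uniformly_continuous) (auto intro: continuous_on_subset)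
  then obtain r where r: "r > 0" "\<And>x y. x \<in> cball 0 (\<bar>R\<bar> + 2) \<Longrightarrow> y \<in> cball 0 (\<bar>R\<bar> + 2) \<Longrightarrow>
      dist y x < r \<Longrightarrow> dist (k y) (k x) < d"
    unfolding uniformly_continuous_on_def using d by metis
  show "eventually (\<lambda>z. dist (LINT y|lborel. \<bar>g (z + y) - g y\<bar>) 0 < e) (at 0)"
    unfolding eventually_at
  proof (intro exI conjI ballI impI)
    show "min r 1 > 0" using r by simp
    fix z :: 'a assume "z \<noteq> 0 \<and> dist z 0 < min r 1"
    then have z: "norm z < r" "norm z < 1" by auto
    have kd: "\<bar>k (z + y) - k y\<bar> \<le> d * indicator ?B y" for y
    proof (cases "norm y \<le> \<bar>R\<bar> + 1")
      case True
      have "norm (z + y) \<le> \<bar>R\<bar> + 2" using True z norm_triangle_ineq[of z y] by linarith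
      moreover have "dist (z + y) y < r" using z by (simp add: dist_norm)
      ultimately have "dist (k (z + y)) (k y) < d" using True by (intro r) (simp_all add: mem_cball_0)
      then show ?thesis using True by (simp add: dist_real_def)
    next
      case False
      have "norm (z + y) \<ge> R" using False z norm_triangle_ineq2[of y "- z"] by (simp add: add.commute)
      then show ?thesis using False k(2)[of y] k(2)[of "z + y"] d by auto
    qed
    have ig: "integrable lborel (\<lambda>y. g (z + y))" "integrable lborel (\<lambda>y. k (z + y))"
      using lborel_integrable_translate g k(3) by blast+
    have "(LINT y|lborel. \<bar>g (z + y) - g y\<bar>)
      \<le> (LINT y|lborel. \<bar>g (z + y) - k (z + y)\<bar> + d * indicator ?B y + \<bar>g y - k y\<bar>)"
    proof (rule integral_mono)
      fix y show "\<bar>g (z + y) - g y\<bar> \<le> \<bar>g (z + y) - k (z + y)\<bar> + d * indicator ?B y + \<bar>g y - k y\<bar>"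
        using kd[of y] by linarith
    qed (use g k ig ifin in auto)
    also have "\<dots> = (LINT y|lborel. \<bar>g (z + y) - k (z + y)\<bar>) + d * measure lborel ?B
        + (LINT y|lborel. \<bar>g y - k y\<bar>)"
      using g k(3) ig ifin[of d] by simp
    also have "(LINT y|lborel. \<bar>g (z + y) - k (z + y)\<bar>) = (LINT y|lborel. \<bar>g y - k y\<bar>)"
      by (rule lborel_integral_translate[of "\<lambda>y. \<bar>g y - k y\<bar>"]) measurable
    also have "d * measure lborel ?B \<le> e / 4"
    proof -
      have "d * measure lborel ?B \<le> d * (measure lborel ?B + 1)" using d by (intro mult_left_mono) auto
      also have "\<dots> = e / 4"
      proof -
        have "measure lborel ?B + 1 \<noteq> 0" using measure_nonneg[of lborel ?B] by linarith
        moreover have "e / (4 * t) * t = e / 4" if "t \<noteq> 0" for t using that by simp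
        ultimately show ?thesis unfolding d_def by blast
      qed
      finally show ?thesis .
    qed
    finally have "(LINT y|lborel. \<bar>g (z + y) - g y\<bar>) < e" using k(4) \<open>e > 0\<close> by linarith
    moreover have "(LINT y|lborel. \<bar>g (z + y) - g y\<bar>) \<ge> 0" by simp
    ultimately show "dist (LINT y|lborel. \<bar>g (z + y) - g y\<bar>) 0 < e" by simp
  qed
qed

lemma correlation_continuous_bounded:
  fixes F G :: "'a::euclidean_space \<Rightarrow> real"
  assumes F: "integrable lborel F" and [measurable]: "G \<in> borel_measurable borel" and G: "\<And>x. \<bar>G x\<bar> \<le> B"
  shows "((\<lambda>z. LINT y|lborel. G y * F (z + y)) \<longlongrightarrow> (LINT y|lborel. G y * F y)) (at 0)"
proof (rule LIM_zero_cancel, rule Lim_null_comparison)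
  have B: "B \<ge> 0" using G[of 0] by linarith
  show "((\<lambda>z. B * (LINT y|lborel. \<bar>F (z + y) - F y\<bar>)) \<longlongrightarrow> 0) (at 0)"
    using tendsto_mult_right_zero[OF L1_translation_continuous[OF F]] .
  have [measurable]: "F \<in> borel_measurable borel" using borel_measurable_integrable[OF F] by simp
  have i: "integrable lborel (\<lambda>y. F (z + y))" for z using lborel_integrable_translate F by blast
  have iG: "integrable lborel (\<lambda>y. G y * F (z + y))" "integrable lborel (\<lambda>y. G y * F y)" for z
    using integrable_bounded_mult[OF i, of G B] integrable_bounded_mult[OF F, of G B] G
    by (auto simp: mult.commute)
  have "norm ((LINT y|lborel. G y * F (z + y)) - (LINT y|lborel. G y * F y))
      \<le> B * (LINT y|lborel. \<bar>F (z + y) - F y\<bar>)" for z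
  proof -
    have "(LINT y|lborel. G y * F (z + y)) - (LINT y|lborel. G y * F y) =
        (LINT y|lborel. G y * F (z + y) - G y * F y)" using iG by simp
    also have "norm \<dots> \<le> (LINT y|lborel. norm (G y * F (z + y) - G y * F y))" by (rule integral_norm_bound)
    also have "\<dots> \<le> (LINT y|lborel. B * \<bar>F (z + y) - F y\<bar>)"
    proof (rule integral_mono)
      fix y
      have "norm (G y * F (z + y) - G y * F y) = \<bar>G y\<bar> * \<bar>F (z + y) - F y\<bar>"
        by (simp add: abs_mult flip: right_diff_distrib)
      then show "norm (G y * F (z + y) - G y * F y) \<le> B * \<bar>F (z + y) - F y\<bar>"
        using G[of y] by (simp add: mult_right_mono)
    qed (use iG i F in auto)
    finally show ?thesis by simp
  qed
  then show "\<forall>\<^sub>F z in at 0. norm ((LINT y|lborel. G y * F (z + y)) - (LINT y|lborel. G y * F y))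
      \<le> B * (LINT y|lborel. \<bar>F (z + y) - F y\<bar>)" by simp
qed

text \<open>Truncating \<open>G\<close> reduces the claim to a bounded factor. The remainder is
  small in L2, and its correlation with \<open>F\<close> is small uniformly in the shift because the
  L2 norm of \<open>F\<close> is translation invariant.\<close>

lemma correlation_continuous_L2:
  fixes F G :: "'a::euclidean_space \<Rightarrow> real"
  assumes F: "integrable lborel F" and F2: "integrable lborel (\<lambda>x. (F x)\<^sup>2)"
    and [measurable]: "G \<in> borel_measurable borel" and G2: "integrable lborel (\<lambda>x. (G x)\<^sup>2)"
  shows "((\<lambda>z. LINT y|lborel. G y * F (z + y)) \<longlongrightarrow> (LINT y|lborel. G y * F y)) (at 0)"
proof (rule tendstoI)
  fix e :: real assume e: "e > 0"
  have [measurable]: "F \<in> borel_measurable borel" using borel_measurable_integrable[OF F] by simp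
  define N where "N = (LINT x|lborel. (F x)\<^sup>2)"
  have N: "N \<ge> 0" by (simp add: N_def)
  \<comment> \<open>With this \<open>t\<close> and a remainder of squared norm below
    \<open>t * e / 8\<close>, both terms of \<open>integral_mult_le\<close> are at most
    \<open>e / 8\<close>. The remainder occurs at \<open>z\<close> and at 0, which leaves
    \<open>e / 2\<close> for the truncated part.\<close>
  define t where "t = e / (8 * (N + 1))"
  have t: "t > 0" "t * N \<le> e / 8" using e N by (auto simp: t_def divide_simps mult_left_mono)
  define D where "D m x = G x - clamp (real m) (G x)" for m x
  have [measurable]: "D m \<in> borel_measurable borel" for m unfolding D_def by measurable
  have D2: "(D m x)\<^sup>2 \<le> (G x)\<^sup>2" for m x
    using clamp_diff_le[of "real m" "G x"] by (simp add: D_def abs_le_square_iff)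
  have iD: "integrable lborel (\<lambda>x. (D m x)\<^sup>2)" for m
    by (rule Bochner_Integration.integrable_bound[OF G2]) (use D2 in auto)
  have "(\<lambda>m. LINT x|lborel. (D m x)\<^sup>2) \<longlonglongrightarrow> (LINT x|(lborel :: 'a measure). (0::real))"
  proof (rule integral_dominated_convergence[where w = "\<lambda>x. (G x)\<^sup>2"])
    show "AE x in lborel. (\<lambda>m. (D m x)\<^sup>2) \<longlonglongrightarrow> 0"
    proof (rule AE_I2)
      fix x
      have "eventually (\<lambda>m. (D m x)\<^sup>2 = 0) sequentially"
        using clamp_eventually_eq[of "G x"] by eventually_elim (simp add: D_def)
      then show "(\<lambda>m. (D m x)\<^sup>2) \<longlonglongrightarrow> 0" by (rule tendsto_eventually)
    qed
  qed (use D2 G2 in auto)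
  then have "eventually (\<lambda>m. (LINT x|lborel. (D m x)\<^sup>2) < t * e / 8) sequentially"
    using e t by (intro order_tendstoD(2)) auto
  then obtain m where m: "(LINT x|lborel. (D m x)\<^sup>2) < t * e / 8"
    by (auto simp: eventually_sequentially)
  define C where "C H z = (LINT y|lborel. H y * F (z + y))" for H z
  have it: "integrable lborel (\<lambda>y. (F (z + y))\<^sup>2)" "(LINT y|lborel. (F (z + y))\<^sup>2) = N" for z
    using lborel_integrable_translate[OF F2] lborel_integral_translate[of "\<lambda>x. (F x)\<^sup>2" z] by (auto simp: N_def)
  have CD: "\<bar>C (D m) z\<bar> < e / 4" for z
  proof -
    have "\<bar>C (D m) z\<bar> = \<bar>LINT y|lborel. F (z + y) * D m y\<bar>" by (simp add: C_def mult.commute)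
    also have "\<dots> \<le> t * (LINT y|lborel. (F (z + y))\<^sup>2) + (LINT x|lborel. (D m x)\<^sup>2) / t"
      by (rule integral_mult_le) (use it iD t in auto)
    also have "\<dots> < e / 8 + (t * e / 8) / t"
      using t m unfolding it by (intro add_le_less_mono divide_strict_right_mono) auto
    also have "\<dots> = e / 4" using t by simp
    finally show ?thesis .
  qed
  define G' where "G' x = clamp (real m) (G x)" for x
  have [measurable]: "G' \<in> borel_measurable borel" unfolding G'_def by measurable
  have G'le: "\<bar>G' x\<bar> \<le> real m" for x unfolding G'_def by (intro clamp_abs_le) auto
  have split: "C G z = C (D m) z + C G' z" for z
  proof -
    have i: "integrable lborel (\<lambda>y. F (z + y))" using lborel_integrable_translate F by blast
    have "integrable lborel (\<lambda>y. D m y * F (z + y))"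
      by (rule integrable_square_mult) (use it iD in auto)
    moreover have "integrable lborel (\<lambda>y. G' y * F (z + y))"
      using integrable_bounded_mult[OF i, of G' "real m"] G'le by (simp add: mult.commute)
    ultimately show ?thesis unfolding C_def
      by (subst Bochner_Integration.integral_add[symmetric]) (auto simp: D_def G'_def algebra_simps)
  qed
  have "((\<lambda>z. C G' z) \<longlongrightarrow> C G' 0) (at 0)"
    using correlation_continuous_bounded[OF F _ G'le] by (simp add: C_def)
  then have "eventually (\<lambda>z. dist (C G' z) (C G' 0) < e / 2) (at 0)" using e by (intro tendstoD) auto
  then have "eventually (\<lambda>z. dist (C G z) (C G 0) < e) (at 0)"
  proof eventually_elim
    case (elim z)
    then show ?case using CD[of z] CD[of 0] unfolding split dist_real_def by linarith
  qed
  then show "eventually (\<lambda>z. dist (LINT y|lborel. G y * F (z + y)) (LINT y|lborel. G y * F y) < e) (at 0)"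
    by (simp add: C_def)
qed

subsection \<open>Orthogonality of weak gradients\<close>

text \<open>All sides are the double integral of \<open>G y * F x * k (x - y)\<close>. The
  substitution \<open>x = z + y\<close> turns it into an average of correlations of \<open>G\<close>
  and \<open>F\<close> against the kernel, and boundedness of \<open>k\<close> gives the absolute
  integrability for Fubini.\<close>

lemma kernel_Fubini:
  fixes F G k :: "'a::euclidean_space \<Rightarrow> real"
  assumes F: "integrable lborel F" and G: "integrable lborel G"
    and [measurable]: "k \<in> borel_measurable borel" and k: "\<And>z. \<bar>k z\<bar> \<le> B"
  shows "(LINT x|lborel. F x * (LINT y|lborel. G y * k (x - y))) =
      (LINT y|lborel. G y * (LINT x|lborel. F x * k (x - y)))"
    and "(LINT y|lborel. G y * (LINT x|lborel. F x * k (x - y))) =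
      (LINT z|lborel. k z * (LINT y|lborel. G y * F (z + y)))"
    and "integrable lborel (\<lambda>z. k z * (LINT y|lborel. G y * F (z + y)))"
proof -
  have [measurable]: "F \<in> borel_measurable borel" "G \<in> borel_measurable borel"
    using borel_measurable_integrable[OF F] borel_measurable_integrable[OF G] by auto
  have B: "B \<ge> 0" using k[of 0] by linarith
  have fin: "integrable lborel (\<lambda>y. \<bar>G y\<bar> * (LINT x|lborel. \<bar>H y x\<bar>))"
    if H: "\<And>y. integrable lborel (H y)" "\<And>y. (LINT x|lborel. \<bar>H y x\<bar>) \<le> C"
      and [measurable]: "(\<lambda>(y, x). H y x) \<in> borel_measurable (lborel \<Otimes>\<^sub>M lborel)" for H :: "'a \<Rightarrow> 'a \<Rightarrow> real" and C
  proof (rule integrable_bounded_mult[where B = C])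
    show "integrable lborel (\<lambda>y. \<bar>G y\<bar>)" using G by simp
    have "(\<lambda>y. LINT x|lborel. \<bar>H y x\<bar>) \<in> borel_measurable lborel"
      by (rule lborel.borel_measurable_lebesgue_integral) measurable
    then show "(\<lambda>y. LINT x|lborel. \<bar>H y x\<bar>) \<in> borel_measurable borel" by simp
    show "\<bar>LINT x|lborel. \<bar>H y x\<bar>\<bar> \<le> C" for y using H(2)[of y] by simp
  qed
  have int1: "integrable lborel (\<lambda>x. F x * k (x - y))" for y
    using F k by (intro integrable_bounded_mult[where B = B]) auto
  have int2: "integrable lborel (\<lambda>z. k z * F (z + y))" for y
  proof -
    have "integrable lborel (\<lambda>z. F (z + y))"
      using lborel_integrable_translate[OF F, of y] by (simp add: add.commute)
    from integrable_bounded_mult[OF this, of k B] k show ?thesis by (simp add: mult.commute)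
  qed
  have trans: "(LINT x|lborel. F x * k (x - y)) = (LINT z|lborel. k z * F (z + y))" for y
    using lborel_integral_translate[of "\<lambda>x. F x * k (x - y)" y]
    by (simp add: mult.commute add.commute)
  have abs_int: "(LINT x|lborel. \<bar>F x * k (x - y)\<bar>) \<le> B * (LINT x|lborel. \<bar>F x\<bar>)" for y
  proof -
    have "(LINT x|lborel. \<bar>F x * k (x - y)\<bar>) \<le> (LINT x|lborel. B * \<bar>F x\<bar>)"
    proof (rule integral_mono)
      show "integrable lborel (\<lambda>x. \<bar>F x * k (x - y)\<bar>)" using int1 by (rule integrable_abs)
      show "integrable lborel (\<lambda>x. B * \<bar>F x\<bar>)" using F by simp
      show "\<bar>F x * k (x - y)\<bar> \<le> B * \<bar>F x\<bar>" for x
        unfolding abs_mult mult.commute[of "\<bar>F x\<bar>"] by (intro mult_right_mono k) simp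
    qed
    then show ?thesis by simp
  qed
  have abs_int2: "(LINT z|lborel. \<bar>k z * F (z + y)\<bar>) \<le> B * (LINT x|lborel. \<bar>F x\<bar>)" for y
  proof -
    have "(LINT z|lborel. \<bar>k z * F (z + y)\<bar>) = (LINT x|lborel. \<bar>F x * k (x - y)\<bar>)"
      using lborel_integral_translate[of "\<lambda>x. \<bar>F x * k (x - y)\<bar>" y]
      by (simp add: mult.commute add.commute)
    then show ?thesis using abs_int by simp
  qed
  have "integrable (lborel \<Otimes>\<^sub>M lborel) (\<lambda>(y, x). G y * (F x * k (x - y)))"
  proof (rule lborel_pair.Fubini_integrable)
    have "integrable lborel (\<lambda>y. \<bar>G y\<bar> * (LINT x|lborel. \<bar>F x * k (x - y)\<bar>))"
      by (rule fin[OF int1 abs_int]) measurable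
    then show "integrable lborel (\<lambda>y. LINT x|lborel. norm (case (y, x) of (y, x) \<Rightarrow> G y * (F x * k (x - y))))"
      by (simp add: abs_mult)
    show "AE y in lborel. integrable lborel (\<lambda>x. case (y, x) of (y, x) \<Rightarrow> G y * (F x * k (x - y)))"
      using int1 by auto
  qed measurable
  from lborel_pair.Fubini_integral[OF this]
  show "(LINT x|lborel. F x * (LINT y|lborel. G y * k (x - y))) =
      (LINT y|lborel. G y * (LINT x|lborel. F x * k (x - y)))"
    by (simp add: mult.left_commute flip: integral_mult_right_zero)
  have *: "integrable (lborel \<Otimes>\<^sub>M lborel) (\<lambda>(y, z). G y * (k z * F (z + y)))"
  proof (rule lborel_pair.Fubini_integrable)
    have "integrable lborel (\<lambda>y. \<bar>G y\<bar> * (LINT z|lborel. \<bar>k z * F (z + y)\<bar>))"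
      by (rule fin[OF int2 abs_int2]) measurable
    then show "integrable lborel (\<lambda>y. LINT z|lborel. norm (case (y, z) of (y, z) \<Rightarrow> G y * (k z * F (z + y))))"
      by (simp add: abs_mult)
    show "AE y in lborel. integrable lborel (\<lambda>z. case (y, z) of (y, z) \<Rightarrow> G y * (k z * F (z + y)))"
      using int2 by auto
  qed measurable
  have **: "(LINT y|lborel. G y * (k z * F (z + y))) = k z * (LINT y|lborel. G y * F (z + y))" for z
    by (simp add: mult.left_commute flip: integral_mult_right_zero)
  show "(LINT y|lborel. G y * (LINT x|lborel. F x * k (x - y))) =
      (LINT z|lborel. k z * (LINT y|lborel. G y * F (z + y)))"
    using lborel_pair.Fubini_integral[OF *] unfolding ** trans by simp
  show "integrable lborel (\<lambda>z. k z * (LINT y|lborel. G y * F (z + y)))"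
    using lborel_pair.integrable_snd[OF *] unfolding ** .
qed

section \<open>Averages against bump functions\<close>

lemma bump_bounded: obtains B where "\<And>z. \<bar>bump a e z\<bar> \<le> B"
proof -
  have "bump a e = bump a \<bar>e\<bar>" by (auto simp: bump_def)
  then have "bump a e \<in> test_functions UNIV" using bump_test_function[of a "\<bar>e\<bar>" UNIV] by simp
  then show ?thesis using test_functions_bounded that by metis
qed

lemma bump_measurable [measurable]: "bump a e \<in> borel_measurable borel"
  using smooth_bump smooth_borel_measurable by blast

lemma bump_integrable: "integrable lborel (bump a e)"
proof -
  have "bump a e = bump a \<bar>e\<bar>" by (auto simp: bump_def)
  then have "bump a e \<in> test_functions UNIV" using bump_test_function[of a "\<bar>e\<bar>" UNIV] by simp
  then show ?thesis using test_functions_integrable by blast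
qed

lemma integral_bump_pos:
  assumes "e > 0" shows "(LINT z|lborel. bump (a::real^'n::finite) e z) > 0"
proof -
  have "(LINT z|lborel. bump a e z) \<noteq> 0"
  proof
    assume "(LINT z|lborel. bump a e z) = 0"
    then have "AE z in lborel. bump a e z = 0"
      using integral_nonneg_eq_0_iff_AE[OF bump_integrable] by (auto simp: bump_nonneg)
    then have "AE z in lborel. z \<notin> ball a e"
    proof eventually_elim
      case (elim z)
      then show ?case using bump_pos[of z a e] by (auto simp: dist_norm norm_minus_commute)
    qed
    then have "ball a e \<in> null_sets lborel" by (subst AE_iff_null_sets) auto
    then have "emeasure lborel (ball a e) = 0" by auto
    then have "emeasure lebesgue (ball a e) = 0" by simp
    then have "negligible (ball a e)" by (simp add: negligible_iff_emeasure0)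
    then show False using assms open_not_negligible[of "ball a e"] by auto
  qed
  moreover have "(LINT z|lborel. bump a e z) \<ge> 0" by (simp add: bump_nonneg)
  ultimately show ?thesis by linarith
qed

text \<open>If \<open>l\<close> were nonzero, \<open>sgn l * C z\<close> would be at least
  \<open>\<bar>l\<bar> / 2\<close> near the origin, and a nonnegative kernel concentrated there
  could not average it to 0.\<close>

lemma eq_0_of_bump_integrals:
  fixes C :: "real^'n::finite \<Rightarrow> real"
  assumes lim: "(C \<longlongrightarrow> l) (at 0)" and e0: "e0 > 0"
    and int: "\<And>e. 0 < e \<Longrightarrow> e < e0 \<Longrightarrow> integrable lborel (\<lambda>z. bump 0 e z * C z)"
    and zero: "\<And>e. 0 < e \<Longrightarrow> e < e0 \<Longrightarrow> (LINT z|lborel. bump 0 e z * C z) = 0"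
  shows "l = 0"
proof (rule ccontr)
  assume l: "l \<noteq> 0"
  then have "eventually (\<lambda>z. dist (C z) l < \<bar>l\<bar> / 2) (at 0)" using lim by (intro tendstoD) auto
  then obtain d where d: "d > 0" "\<And>z. z \<noteq> 0 \<Longrightarrow> norm z < d \<Longrightarrow> dist (C z) l < \<bar>l\<bar> / 2"
    by (auto simp: eventually_at)
  define e where "e = min d e0 / 2"
  have e: "0 < e" "e < e0" "e < d" using d e0 by (auto simp: e_def)
  have "(LINT z|lborel. bump (0::real^'n) e z * (\<bar>l\<bar> / 2)) \<le> (LINT z|lborel. sgn l * (bump 0 e z * C z))"
  proof (rule integral_mono_AE)
    show "integrable lborel (\<lambda>z. bump (0::real^'n) e z * (\<bar>l\<bar> / 2))"
      using bump_integrable by (rule integrable_mult_left)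
    \<comment> \<open>The limit at 0 says nothing about the value \<open>C 0\<close>; the origin is
      a null set.\<close>
    have "AE z::real^'n in lborel. z \<noteq> 0" by (rule AE_lborel_singleton)
    then show "AE z in lborel. bump 0 e z * (\<bar>l\<bar> / 2) \<le> sgn l * (bump 0 e z * C z)"
    proof eventually_elim
      case (elim z)
      show ?case
      proof (cases "norm z < d")
        case True
        then have "dist (C z) l < \<bar>l\<bar> / 2" using d elim by blast
        then have "\<bar>l\<bar> / 2 \<le> sgn l * C z" using l by (auto simp: dist_real_def sgn_if abs_if split: if_splits)
        then have "bump 0 e z * (\<bar>l\<bar> / 2) \<le> bump 0 e z * (sgn l * C z)"
          by (intro mult_left_mono) (auto simp: bump_nonneg)
        then show ?thesis by (simp add: mult.left_commute)
      next
        case False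
        then have "bump 0 e z = 0" using e by (intro bump_eq_0) auto
        then show ?thesis by simp
      qed
    qed
  qed (use bump_integrable int e in auto)
  also have "\<dots> = 0" using zero e by simp
  finally have "(LINT z|lborel. bump (0::real^'n) e z) * (\<bar>l\<bar> / 2) \<le> 0" by simp
  then show False using integral_bump_pos[OF e(1), of "0::real^'n"] l by (simp add: mult_le_0_iff)
qed

text \<open>Instead of mollifying \<open>\<psi>\<close>, both derivatives are moved onto the kernel of a double integral,
  which concentrates on the diagonal.\<close>

lemma weak_gradient_orthogonal:
  fixes b \<psi> Bi Bj Gi Gj :: "real^'n::finite \<Rightarrow> real"
  assumes int: "integrable lborel b" "integrable lborel \<psi>"
      "integrable lborel Bi" "integrable lborel Bj" "integrable lborel Gi" "integrable lborel Gj"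
    and sq: "integrable lborel (\<lambda>x. (Bi x)\<^sup>2)" "integrable lborel (\<lambda>x. (Bj x)\<^sup>2)"
      "integrable lborel (\<lambda>x. (Gi x)\<^sup>2)" "integrable lborel (\<lambda>x. (Gj x)\<^sup>2)"
    and K: "compact K" "K \<subseteq> \<Omega>" "open \<Omega>" "\<And>y. \<psi> y \<noteq> 0 \<Longrightarrow> y \<in> K"
    and bi: "\<And>\<zeta>. \<zeta> \<in> test_functions \<Omega> \<Longrightarrow> (LINT x|lborel. b x * partial_deriv i \<zeta> x) = - (LINT x|lborel. Bi x * \<zeta> x)"
    and bj: "\<And>\<zeta>. \<zeta> \<in> test_functions \<Omega> \<Longrightarrow> (LINT x|lborel. b x * partial_deriv j \<zeta> x) = - (LINT x|lborel. Bj x * \<zeta> x)"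
    and gi: "\<And>\<zeta>. smooth \<zeta> \<Longrightarrow> (LINT x|lborel. \<psi> x * partial_deriv i \<zeta> x) = - (LINT x|lborel. Gi x * \<zeta> x)"
    and gj: "\<And>\<zeta>. smooth \<zeta> \<Longrightarrow> (LINT x|lborel. \<psi> x * partial_deriv j \<zeta> x) = - (LINT x|lborel. Gj x * \<zeta> x)"
  shows "(LINT x|lborel. Gi x * Bj x) = (LINT x|lborel. Gj x * Bi x)"
proof -
  have meas: "b \<in> borel_measurable borel" "\<psi> \<in> borel_measurable borel"
    "Bi \<in> borel_measurable borel" "Bj \<in> borel_measurable borel"
    "Gi \<in> borel_measurable borel" "Gj \<in> borel_measurable borel"
    using int[THEN borel_measurable_integrable] by auto
  \<comment> \<open>A margin around \<open>K\<close> inside which \<open>bump y e\<close> is a test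
    function in \<open>\<Omega>\<close> for every \<open>y \<in> K\<close>.\<close>
  obtain e0 where e0: "e0 > 0" "\<And>y. y \<in> K \<Longrightarrow> cball y e0 \<subseteq> \<Omega>"
  proof -
    obtain e where "e > 0" "(\<Union>x\<in>K. cball x e) \<subseteq> \<Omega>"
      using compact_subset_open_imp_cball_epsilon_subset[OF K(1,3,2)] .
    then show ?thesis using that[of e] by blast
  qed
  \<comment> \<open>On the right, k and l occur only in a mixed derivative of a smooth kernel, so
    exchanging them changes nothing. Hence the two correlations to be compared have the same average
    against every small bump.\<close>
  have key: "(LINT z|lborel. bump 0 e z * (LINT y|lborel. G y * B (z + y))) =
      - (LINT y|lborel. \<psi> y * (LINT x|lborel. b x * partial_deriv l (partial_deriv k (bump y e)) x))"
    if e: "0 < e" "e < e0"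
      and G: "\<And>\<zeta>. smooth \<zeta> \<Longrightarrow> (LINT x|lborel. \<psi> x * partial_deriv k \<zeta> x) = - (LINT x|lborel. G x * \<zeta> x)"
      and B: "\<And>\<zeta>. \<zeta> \<in> test_functions \<Omega> \<Longrightarrow> (LINT x|lborel. b x * partial_deriv l \<zeta> x) = - (LINT x|lborel. B x * \<zeta> x)"
      and iGB: "integrable lborel G" "integrable lborel B"
    for G B k l e
  proof -
    have test: "bump y e \<in> test_functions \<Omega>" if "y \<in> K" for y
      using e0(2)[OF that] e by (intro bump_test_function) (auto intro: order_trans[OF subset_cball])
    define k1 where "k1 = partial_deriv k (bump (0::real^'n) e)"
    \<comment> \<open>The kernel depends on \<open>x - y\<close>: differentiating it in the other
      variable changes the sign, which compensates that of the first integration by parts.\<close>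
    have k1: "partial_deriv k (bump y e) x = k1 (x - y)" "partial_deriv k (bump x e) y = - k1 (x - y)" for x y
      by (simp_all add: k1_def partial_deriv_bump norm_minus_commute[of y x] algebra_simps)
    have "bump (0::real^'n) e \<in> test_functions UNIV" using e by (intro bump_test_function) auto
    then have k1_test: "k1 \<in> test_functions UNIV" unfolding k1_def by (rule test_functions_partial_deriv)
    obtain M where M: "\<And>z. \<bar>k1 z\<bar> \<le> M" using test_functions_bounded[OF k1_test] by blast
    obtain M' where M': "\<And>z. \<bar>bump (0::real^'n) e z\<bar> \<le> M'" using bump_bounded[of "0::real^'n" e] by blast
    have b0: "bump 0 e (x - y) = bump x e y" for x y :: "real^'n"
      by (simp add: bump_def norm_minus_commute)
    have k1m: "k1 \<in> borel_measurable borel" using k1_test by measurable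
    have "(LINT z|lborel. bump 0 e z * (LINT y|lborel. G y * B (z + y))) =
        (LINT x|lborel. B x * (LINT y|lborel. G y * bump 0 e (x - y)))"
      using kernel_Fubini(1,2)[OF iGB(2,1) bump_measurable M'] by simp
    \<comment> \<open>This derivative leaves \<open>G\<close> for every \<open>x\<close>, even if
      the bump around \<open>x\<close> sticks out of \<open>\<Omega>\<close>, because the rule for
      \<open>\<psi>\<close> accepts all smooth functions.\<close>
    also have "\<dots> = (LINT x|lborel. B x * (LINT y|lborel. \<psi> y * k1 (x - y)))"
    proof (rule Bochner_Integration.integral_cong[OF refl])
      fix x
      have "(LINT y|lborel. G y * bump 0 e (x - y)) = - (LINT y|lborel. \<psi> y * partial_deriv k (bump x e) y)"
        unfolding b0 using G[OF smooth_bump, of x e] by simp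
      then show "B x * (LINT y|lborel. G y * bump 0 e (x - y)) = B x * (LINT y|lborel. \<psi> y * k1 (x - y))"
        unfolding k1(2) by simp
    qed
    also have "\<dots> = (LINT y|lborel. \<psi> y * (LINT x|lborel. B x * k1 (x - y)))"
      by (rule kernel_Fubini(1)[OF iGB(2) int(2) k1m M])
    also have "\<dots> = (LINT y|lborel. - (\<psi> y * (LINT x|lborel. b x * partial_deriv l (partial_deriv k (bump y e)) x)))"
    proof (rule Bochner_Integration.integral_cong[OF refl])
      fix y
      show "\<psi> y * (LINT x|lborel. B x * k1 (x - y)) =
        - (\<psi> y * (LINT x|lborel. b x * partial_deriv l (partial_deriv k (bump y e)) x))"
      proof (cases "\<psi> y = 0")
        \<comment> \<open>The rule for \<open>b\<close> accepts only test functions in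
          \<open>\<Omega>\<close>. The centre \<open>y\<close> lies in \<open>K\<close> since
          \<open>\<psi> y\<close> is nonzero, so the margin applies.\<close>
        case False
        then show ?thesis using B[OF test_functions_partial_deriv[OF test[OF K(4)[OF False]], of k]]
          unfolding k1(1) by simp
      qed simp
    qed
    finally show ?thesis by simp
  qed
  define C where "C z = (LINT y|lborel. Gi y * Bj (z + y)) - (LINT y|lborel. Gj y * Bi (z + y))" for z
  have lim: "(C \<longlongrightarrow> (LINT y|lborel. Gi y * Bj y) - (LINT y|lborel. Gj y * Bi y)) (at 0)"
    unfolding C_def using int sq meas by (intro tendsto_diff correlation_continuous_L2) auto
  have fin: "integrable lborel (\<lambda>z. bump 0 e z * C z) \<and> (LINT z|lborel. bump 0 e z * C z) = 0"
    if e: "0 < e" "e < e0" for e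
  proof -
    obtain M' where M': "\<And>z. \<bar>bump (0::real^'n) e z\<bar> \<le> M'" using bump_bounded[of "0::real^'n" e] by blast
    note i1 = kernel_Fubini(3)[OF int(4,5) bump_measurable M'] kernel_Fubini(3)[OF int(3,6) bump_measurable M']
    have "(LINT z|lborel. bump 0 e z * C z) = (LINT z|lborel. bump 0 e z * (LINT y|lborel. Gi y * Bj (z + y)))
        - (LINT z|lborel. bump 0 e z * (LINT y|lborel. Gj y * Bi (z + y)))"
      unfolding C_def right_diff_distrib using i1 by (rule Bochner_Integration.integral_diff)
    also have "\<dots> = 0"
      using key[where k = i and l = j, OF e gi bj int(5,4)] key[where k = j and l = i, OF e gj bi int(6,3)]
      unfolding partial_deriv_commute[OF smooth_bump, of j i] by linarith
    finally show ?thesis using i1 unfolding C_def right_diff_distrib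
      by (auto intro: Bochner_Integration.integrable_diff)
  qed
  have "(LINT y|lborel. Gi y * Bj y) - (LINT y|lborel. Gj y * Bi y) = 0"
    by (rule eq_0_of_bump_integrals[OF lim e0(1)]) (use fin in blast)+
  then show ?thesis by simp
qed

subsection \<open>Weak derivatives\<close>

text \<open>Shifts and product measures are treated with \<open>lborel\<close>, hence with Borel
  functions on the whole space; extension by zero makes the integrals over \<open>S\<close> and over
  the space agree.\<close>

lemma borel_representative:
  fixes v :: "'a::euclidean_space \<Rightarrow> real"
  assumes v: "v \<in> borel_measurable (lebesgue_on S)" and S: "S \<in> sets borel"
  obtains w where "w \<in> borel_measurable borel" "\<And>x. x \<notin> S \<Longrightarrow> w x = 0" "AE x in lebesgue_on S. v x = w x"
proof -
  have "(\<lambda>x. if x \<in> S then v x else 0) \<in> borel_measurable lebesgue"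
    using v S by (intro borel_measurable_if_I) auto
  then obtain g where g: "g \<in> borel_measurable lborel" "AE x in lborel. (if x \<in> S then v x else 0) = g x"
    using completion_ex_borel_measurable_real by blast
  show ?thesis
  proof (rule that[of "\<lambda>x. indicator S x * g x"])
    show "(\<lambda>x. indicator S x * g x) \<in> borel_measurable borel" using g S by measurable
    have "AE x in lebesgue. (if x \<in> S then v x else 0) = g x" using g(2) by (rule AE_completion)
    then have "AE x in lebesgue. x \<in> S \<longrightarrow> v x = indicator S x * g x" by eventually_elim auto
    then show "AE x in lebesgue_on S. v x = indicator S x * g x"
      using S by (subst AE_restrict_space_iff) auto
  qed simp
qed

lemma AE_lebesgue_on_iff:
  assumes "S \<in> sets borel"
  shows "(AE x in lebesgue_on S. P x) \<longleftrightarrow> (AE x in lborel. x \<in> S \<longrightarrow> P x)"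
  using assms by (subst AE_restrict_space_iff) (auto simp: AE_completion_iff)

lemma lebesgue_on_borel:
  fixes w :: "'a::euclidean_space \<Rightarrow> real"
  assumes w [measurable]: "w \<in> borel_measurable borel" and S [measurable]: "S \<in> sets borel" and 0: "\<And>x. x \<notin> S \<Longrightarrow> w x = 0"
  shows "integral\<^sup>L (lebesgue_on S) w = integral\<^sup>L lborel w"
    and "integrable (lebesgue_on S) w \<longleftrightarrow> integrable lborel w"
proof -
  have *: "(\<lambda>x. indicat_real S x * w x) = w" using 0 by (auto simp: indicator_def fun_eq_iff)
  show "integral\<^sup>L (lebesgue_on S) w = integral\<^sup>L lborel w"
    using S by (subst integral_restrict_space) (auto simp: * integral_completion)
  show "integrable (lebesgue_on S) w \<longleftrightarrow> integrable lborel w"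
    using S by (subst integrable_restrict_space) (auto simp: * integrable_completion)
qed

lemma integral_lebesgue_on_subset:
  fixes v :: "'a::euclidean_space \<Rightarrow> real"
  assumes "S \<in> sets borel" "T \<in> sets borel" "S \<subseteq> T" "\<And>x. x \<in> T \<Longrightarrow> x \<notin> S \<Longrightarrow> v x = 0"
  shows "integral\<^sup>L (lebesgue_on T) v = integral\<^sup>L (lebesgue_on S) v"
    and "integrable (lebesgue_on T) v \<longleftrightarrow> integrable (lebesgue_on S) v"
proof -
  have *: "(\<lambda>x. indicat_real T x * v x) = (\<lambda>x. indicat_real S x * v x)"
    using assms by (auto simp: indicator_def fun_eq_iff)
  show "integral\<^sup>L (lebesgue_on T) v = integral\<^sup>L (lebesgue_on S) v"
    using assms by (simp add: integral_restrict_space *)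
  show "integrable (lebesgue_on T) v \<longleftrightarrow> integrable (lebesgue_on S) v"
    using assms by (simp add: integrable_restrict_space *)
qed

lemma measurable_lebesgue_on_borel:
  "f \<in> borel_measurable borel \<Longrightarrow> f \<in> borel_measurable (lebesgue_on S)"
  by (intro measurable_restrict_space1 measurable_completion) simp

lemma locally_integrable_mult_test:
  assumes v: "locally_integrable \<Omega> v" and "open \<Omega>" and \<zeta>: "\<zeta> \<in> test_functions \<Omega>"
  shows "integrable (lebesgue_on \<Omega>) (\<lambda>x. v x * \<zeta> x)"
proof -
  let ?K = "closure {x. \<zeta> x \<noteq> 0}"
  note K = test_functionsD[OF \<zeta>]
  have v: "integrable (lebesgue_on ?K) v" using v K by (simp add: locally_integrable_def)
  obtain B where B: "\<And>x. \<bar>\<zeta> x\<bar> \<le> B" using test_functions_bounded[OF \<zeta>] by blast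
  have "\<zeta> \<in> borel_measurable borel" using \<zeta> by measurable
  then have m: "\<zeta> \<in> borel_measurable (lebesgue_on ?K)" by (rule measurable_lebesgue_on_borel)
  have "integrable (lebesgue_on ?K) (\<lambda>x. v x * \<zeta> x)"
  proof (rule Bochner_Integration.integrable_bound)
    show "integrable (lebesgue_on ?K) (\<lambda>x. B * v x)" using v by simp
    show "(\<lambda>x. v x * \<zeta> x) \<in> borel_measurable (lebesgue_on ?K)"
      using v m by (intro borel_measurable_times) auto
    show "AE x in lebesgue_on ?K. norm (v x * \<zeta> x) \<le> norm (B * v x)"
    proof (rule AE_I2)
      fix x
      have "\<bar>v x\<bar> * \<bar>\<zeta> x\<bar> \<le> \<bar>v x\<bar> * \<bar>B\<bar>" using B[of x] by (intro mult_left_mono) auto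
      then show "norm (v x * \<zeta> x) \<le> norm (B * v x)" by (simp add: abs_mult mult.commute)
    qed
  qed
  moreover have "v x * \<zeta> x = 0" if "x \<notin> ?K" for x using that support_memI[of \<zeta> x] by auto
  ultimately show ?thesis
    using integral_lebesgue_on_subset(2)[of ?K \<Omega> "\<lambda>x. v x * \<zeta> x"] K assms(2) by auto
qed

text \<open>The fundamental lemma of the calculus of variations. On a compact set, the correlation
  of \<open>g\<close> with its own sign has vanishing averages against small bumps, since these are
  built from integrals of \<open>g\<close> against test functions. Continuity of the correlation at
  0 then gives a vanishing integral of \<open>\<bar>g\<bar>\<close>.\<close>

lemma AE_eq_0_of_test_integrals:
  fixes g :: "real^'n::finite \<Rightarrow> real"
  assumes g: "locally_integrable \<Omega> g" and \<Omega>: "open \<Omega>"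
    and zero: "\<And>\<zeta>. \<zeta> \<in> test_functions \<Omega> \<Longrightarrow> (LINT x|lebesgue_on \<Omega>. g x * \<zeta> x) = 0"
  shows "AE x in lebesgue_on \<Omega>. g x = 0"
proof -
  obtain C where C: "\<And>n. compact (C n)" "\<And>n. C n \<subseteq> \<Omega>" "\<And>n. C n \<subseteq> interior (C (Suc n))" "\<Union>(range C) = \<Omega>"
    using open_Union_compact_subsets[OF \<Omega>] by metis
  have "AE x in lborel. x \<in> C n \<longrightarrow> g x = 0" for n
  proof -
    \<comment> \<open>\<open>?K'\<close> leaves room for the supports of bumps centred in
      \<open>?K\<close>.\<close>
    let ?K = "C n" and ?K' = "C (Suc n)"
    have Kb [measurable]: "?K \<in> sets borel" "?K' \<in> sets borel" using C(1) by (simp_all add: compact_imp_closed borel_closed)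
    have gK: "integrable (lebesgue_on ?K') g" using g C by (simp add: locally_integrable_def)
    then have "g \<in> borel_measurable (lebesgue_on ?K')" by auto
    then obtain h where h [measurable]: "h \<in> borel_measurable borel" and h0: "\<And>x. x \<notin> ?K' \<Longrightarrow> h x = 0"
      and hg: "AE x in lebesgue_on ?K'. g x = h x"
      using borel_representative[OF _ Kb(2)] by metis
    have "integrable (lebesgue_on ?K') h"
      using gK hg measurable_lebesgue_on_borel[OF h] by (subst integrable_cong_AE[where g = g]) auto
    then have hi: "integrable lborel h" using lebesgue_on_borel(2)[OF h Kb(2) h0] by simp
    have pair: "(LINT x|lborel. h x * \<zeta> x) = 0" if \<zeta>: "\<zeta> \<in> test_functions (interior ?K')" for \<zeta>
    proof -
      have \<zeta>': "\<zeta> \<in> test_functions \<Omega>"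
        using \<zeta> test_functions_mono[of "interior ?K'" \<Omega>] C(2)[of "Suc n"] interior_subset by blast
      have [measurable]: "\<zeta> \<in> borel_measurable borel" using \<zeta> by measurable
      have "(LINT x|lborel. h x * \<zeta> x) = (LINT x|lebesgue_on ?K'. h x * \<zeta> x)"
        by (rule lebesgue_on_borel(1)[symmetric]) (auto simp: h0)
      also have "\<dots> = (LINT x|lebesgue_on ?K'. g x * \<zeta> x)"
      proof (rule integral_cong_AE)
        have "\<zeta> \<in> borel_measurable (lebesgue_on ?K')" "h \<in> borel_measurable (lebesgue_on ?K')"
          by (rule measurable_lebesgue_on_borel, measurable)+
        then show "(\<lambda>x. h x * \<zeta> x) \<in> borel_measurable (lebesgue_on ?K')"
          "(\<lambda>x. g x * \<zeta> x) \<in> borel_measurable (lebesgue_on ?K')"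
          using borel_measurable_integrable[OF gK] by (auto intro: borel_measurable_times)
        show "AE x in lebesgue_on ?K'. h x * \<zeta> x = g x * \<zeta> x"
          using hg by eventually_elim simp
      qed
      also have "\<dots> = (LINT x|lebesgue_on \<Omega>. g x * \<zeta> x)"
      proof (rule integral_lebesgue_on_subset(1)[symmetric])
        show "g x * \<zeta> x = 0" if "x \<notin> ?K'" for x
          using that support_memI[of \<zeta> x] test_functionsD(3)[OF \<zeta>] interior_subset by auto
      qed (use \<Omega> C in auto)
      also have "\<dots> = 0" using zero[OF \<zeta>'] .
      finally show ?thesis .
    qed
    define s where "s y = indicator ?K y * sgn (h y)" for y
    have sm [measurable]: "s \<in> borel_measurable borel" unfolding s_def by measurable
    have sle: "\<bar>s y\<bar> \<le> 1" for y by (auto simp: s_def indicator_def sgn_if)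
    have si: "integrable lborel s"
    proof -
      have "integrable lborel (indicator ?K :: _ \<Rightarrow> real)"
        using emeasure_compact_finite[OF C(1)[of n]] by (intro integrable_real_indicator) auto
      from integrable_bounded_mult[OF this, of "\<lambda>y. sgn (h y)" 1] show ?thesis
        unfolding s_def by (auto simp: sgn_if)
    qed
    obtain e0 where e0: "e0 > 0" "(\<Union>x\<in>?K. cball x e0) \<subseteq> interior ?K'"
      using compact_subset_open_imp_cball_epsilon_subset[OF C(1) open_interior C(3)[of n]] .
    have "((\<lambda>z. LINT y|lborel. s y * h (z + y)) \<longlongrightarrow> (LINT y|lborel. s y * h y)) (at 0)"
      by (rule correlation_continuous_bounded[OF hi sm sle])
    moreover have "integrable lborel (\<lambda>z. bump 0 e z * (LINT y|lborel. s y * h (z + y))) \<and>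
        (LINT z|lborel. bump 0 e z * (LINT y|lborel. s y * h (z + y))) = 0" if e: "0 < e" "e < e0" for e
    proof -
      obtain M where M: "\<And>z. \<bar>bump (0::real^'n) e z\<bar> \<le> M" using bump_bounded[of "0::real^'n" e] by blast
      have b0: "bump 0 e (x - y) = bump y e x" for x y :: "real^'n" by (simp add: bump_def)
      have "s y * (LINT x|lborel. h x * bump 0 e (x - y)) = 0" for y
      proof (cases "y \<in> ?K")
        case True
        then have "cball y e \<subseteq> interior ?K'" using e0(2) e subset_cball[of e e0 y] by (auto simp: subset_eq)
        then have "bump y e \<in> test_functions (interior ?K')" using e by (intro bump_test_function) auto
        then show ?thesis unfolding b0 by (simp add: pair)
      qed (simp add: s_def)
      then have "(LINT y|lborel. s y * (LINT x|lborel. h x * bump 0 e (x - y))) = 0"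
        by (simp only: integral_zero)
      then show ?thesis
        using kernel_Fubini(2,3)[OF hi si bump_measurable M] by simp
    qed
    ultimately have "(LINT y|lborel. s y * h y) = 0"
      using eq_0_of_bump_integrals[OF _ e0(1)] by blast
    moreover have sh: "s y * h y = indicator ?K y * \<bar>h y\<bar>" for y
      by (auto simp: s_def indicator_def abs_sgn mult.commute)
    moreover have "integrable lborel (\<lambda>y. indicator ?K y * \<bar>h y\<bar>)"
      unfolding sh[symmetric] using integrable_bounded_mult[OF hi sm sle] by (simp add: mult.commute)
    ultimately have "AE y in lborel. indicator ?K y * \<bar>h y\<bar> = 0"
      by (subst integral_nonneg_eq_0_iff_AE[symmetric]) auto
    moreover have "AE x in lborel. x \<in> ?K' \<longrightarrow> g x = h x"
      using hg by (simp add: AE_lebesgue_on_iff[OF Kb(2)])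
    ultimately show ?thesis
    proof eventually_elim
      case (elim x)
      then show ?case using C(3)[of n] interior_subset by (auto simp: indicator_def)
    qed
  qed
  then have "AE x in lborel. \<forall>n. x \<in> C n \<longrightarrow> g x = 0" by (subst AE_all_countable) blast
  then have "AE x in lborel. x \<in> \<Omega> \<longrightarrow> g x = 0"
    by eventually_elim (use C(4) in blast)
  then show ?thesis using \<Omega> by (simp add: AE_lebesgue_on_iff)
qed

text \<open>Admitting two index lists that act alike on test functions covers both uniqueness and,
  through the symmetry of second derivatives of test functions, the symmetry of weak
  Hessians.\<close>

lemma has_weak_deriv_unique:
  fixes v w :: "real^'n::finite \<Rightarrow> real"
  assumes "open \<Omega>" and v: "has_weak_deriv \<Omega> \<alpha> u v" and w: "has_weak_deriv \<Omega> \<beta> u w"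
    and \<alpha>\<beta>: "length \<alpha> = length \<beta>"
      "\<And>\<zeta>. \<zeta> \<in> test_functions \<Omega> \<Longrightarrow> partial_derivs \<alpha> \<zeta> = partial_derivs \<beta> \<zeta>"
  shows "AE x in lebesgue_on \<Omega>. v x = w x"
proof -
  have lv: "locally_integrable \<Omega> v" "locally_integrable \<Omega> w" using v w by (auto simp: has_weak_deriv_def)
  have "AE x in lebesgue_on \<Omega>. v x - w x = 0"
  proof (rule AE_eq_0_of_test_integrals[OF _ assms(1)])
    show "locally_integrable \<Omega> (\<lambda>x. v x - w x)" using lv by (auto simp: locally_integrable_def)
    fix \<zeta> assume \<zeta>: "\<zeta> \<in> test_functions \<Omega>"
    have "(LINT x|lebesgue_on \<Omega>. v x * \<zeta> x) = (LINT x|lebesgue_on \<Omega>. w x * \<zeta> x)"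
      using v w \<zeta> \<alpha>\<beta> unfolding has_weak_deriv_def by fastforce
    then show "(LINT x|lebesgue_on \<Omega>. (v x - w x) * \<zeta> x) = 0"
      using lv[THEN locally_integrable_mult_test, OF assms(1) \<zeta>] by (simp add: left_diff_distrib)
  qed
  then show ?thesis by simp
qed

section \<open>Selected representatives of weak derivatives\<close>

lemma has_weak_deriv_weak_deriv:
  "has_weak_deriv \<Omega> \<alpha> u v \<Longrightarrow> has_weak_deriv \<Omega> \<alpha> u (weak_deriv \<Omega> \<alpha> u)"
  unfolding weak_deriv_def by (rule someI[of "has_weak_deriv \<Omega> \<alpha> u" v])

lemma AE_weak_deriv_eq:
  assumes "open \<Omega>" "has_weak_deriv \<Omega> \<alpha> u v"
  shows "AE x in lebesgue_on \<Omega>. weak_deriv \<Omega> \<alpha> u x = v x"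
  by (rule has_weak_deriv_unique[OF assms(1) has_weak_deriv_weak_deriv[OF assms(2)] assms(2)]) auto

text \<open>Local integrability gives measurability on compact subsets; a countable exhaustion glues
  these together. Membership of a selected weak derivative in \<open>Lp_space\<close> requires
  it.\<close>

lemma locally_integrable_measurable:
  assumes "open \<Omega>" "locally_integrable \<Omega> v"
  shows "v \<in> borel_measurable (lebesgue_on \<Omega>)"
proof -
  obtain C where C: "\<And>n. compact (C n)" "\<And>n. C n \<subseteq> \<Omega>"
    "\<And>n. C n \<subseteq> interior (C (Suc n))" "\<Union>(range C) = \<Omega>"
    using open_Union_compact_subsets[OF assms(1)] by metis
  have Cb: "C n \<in> sets lebesgue" for n using C(1) by (simp add: lmeasurable_compact fmeasurableD)
  have "(\<lambda>x. if x \<in> \<Omega> then v x else 0) \<in> borel_measurable lebesgue"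
  proof (rule measurable_piecewise_restrict[of "insert (- \<Omega>) (range C)"])
    show "countable (insert (- \<Omega>) (range C))" by simp
    show "X \<inter> space lebesgue \<in> sets lebesgue" if "X \<in> insert (- \<Omega>) (range C)" for X
      using that Cb assms(1) by auto
    show "space lebesgue \<subseteq> \<Union> (insert (- \<Omega>) (range C))" using C(4) by auto
    show "(\<lambda>x. if x \<in> \<Omega> then v x else 0) \<in> borel_measurable (restrict_space lebesgue X)"
      if X: "X \<in> insert (- \<Omega>) (range C)" for X
    proof (cases "X = - \<Omega>")
      case True
      have "(\<lambda>x. 0) \<in> borel_measurable (restrict_space lebesgue X)" by simp
      then show ?thesis
        by (rule measurable_cong[THEN iffD2, rotated]) (auto simp: True space_restrict_space)
    next
      case False
      then obtain n where n: "X = C n" using X by auto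
      have "v \<in> borel_measurable (lebesgue_on (C n))"
        using assms(2) C by (auto simp: locally_integrable_def)
      then show ?thesis unfolding n
        by (rule measurable_cong[THEN iffD2, rotated]) (use C(2) in \<open>auto simp: space_restrict_space\<close>)
    qed
  qed
  then show ?thesis by (rule borel_measurable_if_D)
qed

lemma Lp_space_cong_AE:
  assumes "v \<in> Lp_space p \<Omega>" "w \<in> borel_measurable (lebesgue_on \<Omega>)" "AE x in lebesgue_on \<Omega>. w x = v x"
  shows "w \<in> Lp_space p \<Omega>"
proof -
  have [measurable]: "v \<in> borel_measurable (lebesgue_on \<Omega>)" "w \<in> borel_measurable (lebesgue_on \<Omega>)"
    using assms by (auto simp: Lp_space_def)
  have "esssup (lebesgue_on \<Omega>) (\<lambda>x. ereal \<bar>w x\<bar>) = esssup (lebesgue_on \<Omega>) (\<lambda>x. ereal \<bar>v x\<bar>)"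
    by (rule esssup_AE_cong) (use assms(3) in auto)
  moreover have "integrable (lebesgue_on \<Omega>) (\<lambda>x. \<bar>w x\<bar> powr real_of_ereal p) =
      integrable (lebesgue_on \<Omega>) (\<lambda>x. \<bar>v x\<bar> powr real_of_ereal p)"
    by (rule integrable_cong_AE) (use assms(3) in auto)
  ultimately show ?thesis using assms by (auto simp: Lp_space_def)
qed

text \<open>The choice in \<open>weak_deriv\<close> may differ from the derivative that the Sobolev
  condition furnishes, but only on a null set, so integrability carries over.\<close>

lemma sobolev_space_weak_deriv:
  assumes "open \<Omega>" "u \<in> sobolev_space k p \<Omega>" "length \<alpha> \<le> k"
  shows "has_weak_deriv \<Omega> \<alpha> u (weak_deriv \<Omega> \<alpha> u)" "weak_deriv \<Omega> \<alpha> u \<in> Lp_space p \<Omega>"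
proof -
  obtain v where v: "v \<in> Lp_space p \<Omega>" "has_weak_deriv \<Omega> \<alpha> u v"
    using assms by (auto simp: sobolev_space_def)
  show *: "has_weak_deriv \<Omega> \<alpha> u (weak_deriv \<Omega> \<alpha> u)" using v has_weak_deriv_weak_deriv by blast
  then have "locally_integrable \<Omega> (weak_deriv \<Omega> \<alpha> u)" by (simp add: has_weak_deriv_def)
  from Lp_space_cong_AE[OF v(1) locally_integrable_measurable[OF assms(1) this] AE_weak_deriv_eq[OF assms(1) v(2)]]
  show "weak_deriv \<Omega> \<alpha> u \<in> Lp_space p \<Omega>" .
qed

lemma weak_hessian_symmetric:
  fixes u :: "real^'n::finite \<Rightarrow> real"
  assumes "open \<Omega>" "u \<in> sobolev_space 2 p \<Omega>"
  shows "AE x in lebesgue_on \<Omega>. weak_deriv \<Omega> [i, j] u x = weak_deriv \<Omega> [j, i] u x"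
proof (rule has_weak_deriv_unique[OF assms(1)])
  show "has_weak_deriv \<Omega> [i, j] u (weak_deriv \<Omega> [i, j] u)" "has_weak_deriv \<Omega> [j, i] u (weak_deriv \<Omega> [j, i] u)"
    using assms by (auto intro!: sobolev_space_weak_deriv)
  show "partial_derivs [i, j] \<zeta> = partial_derivs [j, i] \<zeta>" if "\<zeta> \<in> test_functions \<Omega>" for \<zeta>
    using partial_deriv_commute[OF test_functionsD(1)[OF that], of i j] by simp
qed simp

lemma Lp_space_2_iff: "v \<in> Lp_space (ereal 2) \<Omega> \<longleftrightarrow>
    v \<in> borel_measurable (lebesgue_on \<Omega>) \<and> integrable (lebesgue_on \<Omega>) (\<lambda>x. (v x)\<^sup>2)"
  by (auto simp: Lp_space_def)

lemma Lp_space_infinity_imp_2: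
  fixes v :: "real^'n::finite \<Rightarrow> real"
  assumes "open \<Omega>" "bounded \<Omega>" "v \<in> Lp_space \<infinity> \<Omega>"
  shows "v \<in> Lp_space 2 \<Omega>"
proof -
  have m [measurable]: "v \<in> borel_measurable (lebesgue_on \<Omega>)" and fin: "esssup (lebesgue_on \<Omega>) (\<lambda>x. ereal \<bar>v x\<bar>) < \<infinity>"
    using assms by (auto simp: Lp_space_def)
  define B where "B = max 0 (real_of_ereal (esssup (lebesgue_on \<Omega>) (\<lambda>x. ereal \<bar>v x\<bar>)))"
  have "AE x in lebesgue_on \<Omega>. ereal \<bar>v x\<bar> \<le> esssup (lebesgue_on \<Omega>) (\<lambda>x. ereal \<bar>v x\<bar>)"
    by (rule esssup_AE)
  then have B: "AE x in lebesgue_on \<Omega>. \<bar>v x\<bar> \<le> B"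
  proof eventually_elim
    case (elim x)
    then show ?case using fin unfolding B_def
      by (cases "esssup (lebesgue_on \<Omega>) (\<lambda>x. ereal \<bar>v x\<bar>)") auto
  qed
  have "integrable (lebesgue_on \<Omega>) (\<lambda>x. (v x)\<^sup>2)"
  proof (rule Bochner_Integration.integrable_bound)
    have "emeasure (lebesgue_on \<Omega>) (space (lebesgue_on \<Omega>)) < \<infinity>"
      using assms emeasure_bounded_finite[OF assms(2)]
      by (simp add: space_restrict_space emeasure_restrict_space less_top)
    then have "finite_measure (lebesgue_on \<Omega>)" by (intro finite_measureI) simp
    then show "integrable (lebesgue_on \<Omega>) (\<lambda>x. B\<^sup>2)"
      by (rule finite_measure.integrable_const)
    show "AE x in lebesgue_on \<Omega>. norm ((v x)\<^sup>2) \<le> norm (B\<^sup>2)"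
      using B by eventually_elim (simp add: abs_le_square_iff[symmetric])
  qed measurable
  then show ?thesis using m by (simp add: Lp_space_2_iff)
qed

lemma sobolev_space_infinity_subset_2:
  fixes \<Omega> :: "(real^'n::finite) set"
  assumes "open \<Omega>" "bounded \<Omega>"
  shows "sobolev_space k \<infinity> \<Omega> \<subseteq> sobolev_space k 2 \<Omega>"
  using Lp_space_infinity_imp_2[OF assms] by (fastforce simp: sobolev_space_def)

subsection \<open>Concave weights on a convex set\<close>

definition exp_sum :: "(real^'n::finite) set \<Rightarrow> (real^'n \<Rightarrow> real) \<Rightarrow> real \<Rightarrow> real^'n \<Rightarrow> real" where
  "exp_sum E h \<epsilon> x = (\<Sum>e\<in>E. exp ((e \<bullet> x - h e) / \<epsilon>))"

text \<open>A smooth lower approximation of the minimum of the affine functions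
  \<open>h e - e \<bullet> x\<close>, with error at most \<open>\<epsilon> * ln (card E)\<close>. As
  minus a log-sum-exp it is concave. Later \<open>h\<close> is the support function of
  \<open>\<Omega>\<close>.\<close>

definition soft_min :: "(real^'n::finite) set \<Rightarrow> (real^'n \<Rightarrow> real) \<Rightarrow> real \<Rightarrow> real^'n \<Rightarrow> real" where
  "soft_min E h \<epsilon> x = - \<epsilon> * ln (exp_sum E h \<epsilon> x)"

lemma smooth_exp_affine: "smooth (\<lambda>x. c * exp ((e \<bullet> x - d) / \<epsilon>))"
proof -
  have "smooth (\<lambda>x. c * exp ((1 / \<epsilon>) * (e \<bullet> x) - d / \<epsilon>))"
    by (intro smooth_cmult smooth_exp smooth_diff) auto
  then show ?thesis by (simp add: diff_divide_distrib)
qed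

text \<open>Arbitrary coefficients allow the rule to be applied again to its own result.\<close>

lemma partial_deriv_exp_affine_sum:
  assumes "finite E"
  shows "partial_deriv i (\<lambda>x. \<Sum>e\<in>E. c e * exp ((e \<bullet> x - h e) / \<epsilon>)) =
    (\<lambda>x. \<Sum>e\<in>E. (c e * e $ i / \<epsilon>) * exp ((e \<bullet> x - h e) / \<epsilon>))"
proof
  fix x
  have "((\<lambda>x. \<Sum>e\<in>E. c e * exp ((e \<bullet> x - h e) / \<epsilon>)) has_derivative
      (\<lambda>v. \<Sum>e\<in>E. c e * (exp ((e \<bullet> x - h e) / \<epsilon>) * ((e \<bullet> v) / \<epsilon>)))) (at x)"
    by (intro has_derivative_sum) (auto intro!: derivative_eq_intros simp: divide_inverse algebra_simps)
  from partial_deriv_eqI[OF this, of i]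
  show "partial_deriv i (\<lambda>x. \<Sum>e\<in>E. c e * exp ((e \<bullet> x - h e) / \<epsilon>)) x =
      (\<Sum>e\<in>E. (c e * e $ i / \<epsilon>) * exp ((e \<bullet> x - h e) / \<epsilon>))"
    by (simp add: inner_axis mult_ac)
qed

context
  fixes E :: "(real^'n::finite) set" and h :: "real^'n \<Rightarrow> real" and \<epsilon> :: real
  assumes E: "finite E" "E \<noteq> {}" "\<And>e. e \<in> E \<Longrightarrow> norm e = 1" and \<epsilon>: "\<epsilon> > 0"
begin

lemma exp_sum_pos: "exp_sum E h \<epsilon> x > 0"
  unfolding exp_sum_def using E by (intro sum_pos) auto

lemma smooth_exp_sum: "smooth (exp_sum E h \<epsilon>)"
proof -
  have "exp_sum E h \<epsilon> = (\<lambda>x. \<Sum>e\<in>E. 1 * exp ((e \<bullet> x - h e) / \<epsilon>))" by (auto simp: exp_sum_def)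
  then show ?thesis by (simp only:) (intro smooth_sum smooth_exp_affine)
qed

lemma smooth_soft_min: "smooth (soft_min E h \<epsilon>)"
proof -
  have "smooth (\<lambda>x. - \<epsilon> * ln (exp_sum E h \<epsilon> x))"
    by (intro smooth_cmult smooth_ln smooth_exp_sum exp_sum_pos)
  then show ?thesis by (simp add: soft_min_def[abs_def])
qed

lemma partial_deriv_exp_sum:
  "partial_deriv i (exp_sum E h \<epsilon>) = (\<lambda>x. \<Sum>e\<in>E. (e $ i / \<epsilon>) * exp ((e \<bullet> x - h e) / \<epsilon>))"
  using partial_deriv_exp_affine_sum[OF E(1), of i "\<lambda>e. 1" h \<epsilon>] by (simp add: exp_sum_def[abs_def])

lemma partial_deriv2_exp_sum:
  "partial_deriv j (partial_deriv i (exp_sum E h \<epsilon>)) =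
    (\<lambda>x. \<Sum>e\<in>E. (e $ i * e $ j / (\<epsilon> * \<epsilon>)) * exp ((e \<bullet> x - h e) / \<epsilon>))"
  unfolding partial_deriv_exp_sum
  using partial_deriv_exp_affine_sum[OF E(1), of j "\<lambda>e. e $ i / \<epsilon>" h \<epsilon>] by (simp add: mult.commute)

lemma partial_deriv_soft_min:
  "partial_deriv i (soft_min E h \<epsilon>) x = - \<epsilon> * partial_deriv i (exp_sum E h \<epsilon>) x / exp_sum E h \<epsilon> x"
proof -
  have "((\<lambda>t. - \<epsilon> * ln t) has_real_derivative - \<epsilon> / exp_sum E h \<epsilon> x) (at (exp_sum E h \<epsilon> x))"
    using exp_sum_pos by (auto intro!: derivative_eq_intros)
  from partial_deriv_compose[OF smooth_differentiable[OF smooth_exp_sum] this, of i]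
  show ?thesis by (simp add: soft_min_def[abs_def])
qed

text \<open>The gradient is minus a convex combination of the unit vectors in \<open>E\<close>,
  whatever \<open>\<epsilon>\<close> and \<open>E\<close> are.\<close>

lemma partial_deriv_soft_min_le: "\<bar>partial_deriv i (soft_min E h \<epsilon>) x\<bar> \<le> 1"
proof -
  have "\<bar>\<epsilon> * partial_deriv i (exp_sum E h \<epsilon>) x\<bar> = \<bar>\<Sum>e\<in>E. e $ i * exp ((e \<bullet> x - h e) / \<epsilon>)\<bar>"
    unfolding partial_deriv_exp_sum using \<epsilon> by (simp add: sum_distrib_left)
  also have "\<dots> \<le> (\<Sum>e\<in>E. \<bar>e $ i * exp ((e \<bullet> x - h e) / \<epsilon>)\<bar>)" by (rule sum_abs)
  also have "\<dots> \<le> exp_sum E h \<epsilon> x"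
    unfolding exp_sum_def
  proof (rule sum_mono)
    fix e assume "e \<in> E"
    then have "\<bar>e $ i\<bar> \<le> 1" using component_le_norm_cart[of e i] E(3)[of e] by simp
    then show "\<bar>e $ i * exp ((e \<bullet> x - h e) / \<epsilon>)\<bar> \<le> exp ((e \<bullet> x - h e) / \<epsilon>)"
      by (simp add: abs_mult mult_left_le_one_le)
  qed
  finally show ?thesis
    unfolding partial_deriv_soft_min using exp_sum_pos[of x] by (simp add: abs_mult)
qed

text \<open>The quadratic form is \<open>- \<epsilon>\<close> times the variance of the numbers
  \<open>a \<bullet> e / \<epsilon>\<close> under the normalized weights
  \<open>exp ((e \<bullet> x - h e) / \<epsilon>)\<close>, so the sign is Cauchy-Schwarz.\<close>

lemma soft_min_concave:
  "(\<Sum>i\<in>UNIV. \<Sum>j\<in>UNIV. a $ i * a $ j * partial_deriv j (partial_deriv i (soft_min E h \<epsilon>)) x) \<le> 0"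
proof -
  define S where "S = exp_sum E h \<epsilon> x"
  define w where "w e = exp ((e \<bullet> x - h e) / \<epsilon>)" for e
  define S1 where "S1 i = partial_deriv i (exp_sum E h \<epsilon>) x" for i
  define S2 where "S2 i j = partial_deriv j (partial_deriv i (exp_sum E h \<epsilon>)) x" for i j
  have S: "S > 0" unfolding S_def by (rule exp_sum_pos)
  have w: "w e > 0" for e by (simp add: w_def)
  have D: "partial_deriv j (partial_deriv i (soft_min E h \<epsilon>)) x = (- \<epsilon> / S\<^sup>2) * (S2 i j * S - S1 i * S1 j)" for i j
  proof -
    \<comment> \<open>Differentiating this product replaces the quotient rule for the
      gradient.\<close>
    have "(\<lambda>x. exp_sum E h \<epsilon> x * partial_deriv i (soft_min E h \<epsilon>) x) = (\<lambda>x. - \<epsilon> * partial_deriv i (exp_sum E h \<epsilon>) x)"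
    proof
      fix x show "exp_sum E h \<epsilon> x * partial_deriv i (soft_min E h \<epsilon>) x = - \<epsilon> * partial_deriv i (exp_sum E h \<epsilon>) x"
        unfolding partial_deriv_soft_min using exp_sum_pos[of x] by simp
    qed
    then have "partial_deriv j (\<lambda>x. exp_sum E h \<epsilon> x * partial_deriv i (soft_min E h \<epsilon>) x) x =
        partial_deriv j (\<lambda>x. - \<epsilon> * partial_deriv i (exp_sum E h \<epsilon>) x) x" by simp
    moreover have "partial_deriv j (\<lambda>x. exp_sum E h \<epsilon> x * partial_deriv i (soft_min E h \<epsilon>) x) x =
        S1 j * partial_deriv i (soft_min E h \<epsilon>) x + S * partial_deriv j (partial_deriv i (soft_min E h \<epsilon>)) x"
      unfolding S1_def S_def
      by (intro partial_deriv_mult smooth_differentiable smooth_partial_deriv smooth_exp_sum smooth_soft_min)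
    moreover have "partial_deriv j (\<lambda>x. - \<epsilon> * partial_deriv i (exp_sum E h \<epsilon>) x) x = - \<epsilon> * S2 i j"
      unfolding S2_def
      by (subst partial_deriv_mult)
        (auto simp: partial_deriv_const intro: smooth_differentiable smooth_partial_deriv smooth_exp_sum)
    ultimately have "S1 j * (- \<epsilon> * S1 i / S) + S * partial_deriv j (partial_deriv i (soft_min E h \<epsilon>)) x = - \<epsilon> * S2 i j"
      by (simp add: partial_deriv_soft_min S1_def S_def)
    then show ?thesis using S by (simp add: field_simps power2_eq_square)
  qed
  have A1: "(\<Sum>i\<in>UNIV. a $ i * S1 i) = (\<Sum>e\<in>E. (a \<bullet> e / \<epsilon>) * w e)"
  proof -
    have "(\<Sum>i\<in>UNIV. a $ i * S1 i) = (\<Sum>i\<in>UNIV. \<Sum>e\<in>E. a $ i * e $ i / \<epsilon> * w e)"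
      unfolding S1_def partial_deriv_exp_sum w_def by (simp add: sum_distrib_left mult_ac)
    also have "\<dots> = (\<Sum>e\<in>E. \<Sum>i\<in>UNIV. a $ i * e $ i / \<epsilon> * w e)" by (rule sum.swap)
    also have "\<dots> = (\<Sum>e\<in>E. (a \<bullet> e / \<epsilon>) * w e)"
      by (simp add: inner_vec_def sum_divide_distrib sum_distrib_right)
    finally show ?thesis .
  qed
  have A2: "(\<Sum>i\<in>UNIV. \<Sum>j\<in>UNIV. a $ i * a $ j * S2 i j) = (\<Sum>e\<in>E. (a \<bullet> e / \<epsilon>)\<^sup>2 * w e)"
  proof -
    have "(\<Sum>i\<in>UNIV. \<Sum>j\<in>UNIV. a $ i * a $ j * S2 i j) =
        (\<Sum>i\<in>UNIV. \<Sum>j\<in>UNIV. \<Sum>e\<in>E. (a $ i * e $ i / \<epsilon>) * (a $ j * e $ j / \<epsilon>) * w e)"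
      unfolding S2_def partial_deriv2_exp_sum w_def by (simp add: sum_distrib_left mult_ac)
    also have "\<dots> = (\<Sum>i\<in>UNIV. \<Sum>e\<in>E. \<Sum>j\<in>UNIV. (a $ i * e $ i / \<epsilon>) * (a $ j * e $ j / \<epsilon>) * w e)"
      by (intro sum.cong[OF refl] sum.swap)
    also have "\<dots> = (\<Sum>e\<in>E. \<Sum>i\<in>UNIV. \<Sum>j\<in>UNIV. (a $ i * e $ i / \<epsilon>) * (a $ j * e $ j / \<epsilon>) * w e)"
      by (rule sum.swap)
    also have "\<dots> = (\<Sum>e\<in>E. (a \<bullet> e / \<epsilon>)\<^sup>2 * w e)"
    proof (rule sum.cong[OF refl])
      fix e
      have "a \<bullet> e / \<epsilon> = (\<Sum>i\<in>UNIV. a $ i * e $ i / \<epsilon>)" by (simp add: inner_vec_def sum_divide_distrib)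
      then show "(\<Sum>i\<in>UNIV. \<Sum>j\<in>UNIV. (a $ i * e $ i / \<epsilon>) * (a $ j * e $ j / \<epsilon>) * w e) = (a \<bullet> e / \<epsilon>)\<^sup>2 * w e"
        by (simp only: power2_eq_square sum_product) (simp only: sum_distrib_right)
    qed
    finally show ?thesis .
  qed
  have "(\<Sum>e\<in>E. ((a \<bullet> e / \<epsilon>) * sqrt (w e)) * sqrt (w e))\<^sup>2
      \<le> (\<Sum>e\<in>E. ((a \<bullet> e / \<epsilon>) * sqrt (w e))\<^sup>2) * (\<Sum>e\<in>E. (sqrt (w e))\<^sup>2)"
    by (rule Cauchy_Schwarz_ineq_sum)
  moreover have "sqrt (w e) * sqrt (w e) = w e" "(sqrt (w e))\<^sup>2 = w e" for e using w[of e] by simp_all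
  ultimately have CS: "(\<Sum>e\<in>E. (a \<bullet> e / \<epsilon>) * w e)\<^sup>2 \<le> (\<Sum>e\<in>E. (a \<bullet> e / \<epsilon>)\<^sup>2 * w e) * S"
    by (simp only: mult.assoc power_mult_distrib) (simp add: S_def exp_sum_def w_def)
  have "(\<Sum>i\<in>UNIV. \<Sum>j\<in>UNIV. a $ i * a $ j * partial_deriv j (partial_deriv i (soft_min E h \<epsilon>)) x) =
      (\<Sum>i\<in>UNIV. \<Sum>j\<in>UNIV. (- \<epsilon> / S\<^sup>2) * (a $ i * a $ j * S2 i j * S - (a $ i * S1 i) * (a $ j * S1 j)))"
    unfolding D by (intro sum.cong refl) (simp only: right_diff_distrib mult_ac)
  also have "\<dots> = (- \<epsilon> / S\<^sup>2) * ((\<Sum>i\<in>UNIV. \<Sum>j\<in>UNIV. a $ i * a $ j * S2 i j) * S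
      - (\<Sum>i\<in>UNIV. a $ i * S1 i)\<^sup>2)"
  proof -
    have "(\<Sum>i\<in>UNIV. a $ i * S1 i)\<^sup>2 = (\<Sum>i\<in>UNIV. \<Sum>j\<in>UNIV. (a $ i * S1 i) * (a $ j * S1 j))"
      by (simp only: power2_eq_square sum_product)
    then show ?thesis by (simp only: sum_subtractf flip: sum_distrib_left sum_distrib_right)
  qed
  also have "\<dots> \<le> 0"
    unfolding A1 A2 using CS S \<epsilon> by (intro mult_nonpos_nonneg) auto
  finally show ?thesis .
qed

lemma soft_min_le: "e \<in> E \<Longrightarrow> soft_min E h \<epsilon> x \<le> h e - e \<bullet> x"
proof -
  assume e: "e \<in> E"
  have "exp ((e \<bullet> x - h e) / \<epsilon>) \<le> exp_sum E h \<epsilon> x"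
    unfolding exp_sum_def using E e by (intro member_le_sum) auto
  then have "(e \<bullet> x - h e) / \<epsilon> \<le> ln (exp_sum E h \<epsilon> x)"
    using exp_sum_pos ln_ge_iff by blast
  then show ?thesis using \<epsilon> by (simp add: soft_min_def field_simps)
qed

lemma soft_min_ge:
  assumes "\<And>e. e \<in> E \<Longrightarrow> m \<le> h e - e \<bullet> x"
  shows "soft_min E h \<epsilon> x \<ge> m - \<epsilon> * ln (card E)"
proof -
  have c: "real (card E) > 0" using E by (simp add: card_gt_0_iff)
  have "exp_sum E h \<epsilon> x \<le> (\<Sum>e\<in>E. exp (- m / \<epsilon>))"
    unfolding exp_sum_def using assms \<epsilon> by (intro sum_mono) (force simp: divide_simps)
  then have "exp_sum E h \<epsilon> x \<le> card E * exp (- m / \<epsilon>)" by simp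
  then have "ln (exp_sum E h \<epsilon> x) \<le> ln (card E * exp (- m / \<epsilon>))"
    using exp_sum_pos c by (subst ln_le_cancel_iff) auto
  also have "\<dots> = ln (card E) - m / \<epsilon>" using c by (simp add: ln_mult)
  finally have "\<epsilon> * ln (exp_sum E h \<epsilon> x) \<le> \<epsilon> * (ln (card E) - m / \<epsilon>)" using \<epsilon> by (intro mult_left_mono) auto
  then show ?thesis using \<epsilon> by (simp add: soft_min_def algebra_simps)
qed

end

text \<open>By compactness of the unit sphere, supporting half-spaces in finitely many directions
  describe \<open>\<Omega>\<close> up to a small error, since neighbouring directions have similar
  support functions. Shrinking every half-space by \<open>\<delta>\<close> absorbs the
  error.\<close>

lemma finite_supporting_halfspaces:
  fixes \<Omega> :: "(real^'n::finite) set"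
  assumes \<Omega>: "open \<Omega>" "\<Omega> \<noteq> {}" "bounded \<Omega>" "convex \<Omega>" and \<delta>: "\<delta> > 0"
  defines "h \<equiv> \<lambda>e. SUP y\<in>\<Omega>. e \<bullet> y"
  obtains E where "finite E" "E \<noteq> {}" "\<And>e. e \<in> E \<Longrightarrow> norm e = 1"
    "compact {x. \<forall>e\<in>E. \<delta> \<le> h e - e \<bullet> x}" "{x. \<forall>e\<in>E. \<delta> \<le> h e - e \<bullet> x} \<subseteq> \<Omega>"
proof -
  obtain R where R: "R \<ge> 1" "\<And>y. y \<in> \<Omega> \<Longrightarrow> norm y \<le> R"
  proof -
    obtain B where "\<And>y. y \<in> \<Omega> \<Longrightarrow> norm y \<le> B" using \<Omega>(3) by (auto simp: bounded_iff)
    then show ?thesis using that[of "max 1 B"] by (metis max.cobounded1 max.coboundedI2)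
  qed
  have bdd: "bdd_above ((\<lambda>y. e \<bullet> y) ` \<Omega>)" for e :: "real^'n"
  proof (rule bdd_aboveI2)
    fix y assume "y \<in> \<Omega>"
    then show "e \<bullet> y \<le> norm e * R"
      using norm_cauchy_schwarz[of e y] R by (meson mult_left_mono norm_ge_zero order_trans)
  qed
  have hR: "h e \<le> R" if "norm e = 1" for e
    unfolding h_def using \<Omega>(2) norm_cauchy_schwarz[of e] R that by (intro cSUP_least) (auto intro: order_trans)
  \<comment> \<open>\<open>\<tau> \<le> 1/2\<close> confines the shrunk polytope to norm at most
    \<open>2 * R\<close>. Replacing a unit vector by its neighbour in \<open>E\<close> then costs
    \<open>\<tau> * R\<close> on \<open>\<Omega>\<close> and \<open>\<tau> * (2 * R)\<close> on the
    polytope, together less than \<open>\<delta>\<close>.\<close>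
  define \<tau> where "\<tau> = min (1/2) (\<delta> / (4 * R))"
  have \<tau>: "\<tau> > 0" "\<tau> \<le> 1/2" "\<tau> * (3 * R) < \<delta>"
  proof -
    show "\<tau> > 0" "\<tau> \<le> 1/2" using \<delta> R by (auto simp: \<tau>_def)
    have "\<tau> * (3 * R) \<le> \<delta> / (4 * R) * (3 * R)" using R by (intro mult_right_mono) (auto simp: \<tau>_def)
    also have "\<dots> < \<delta>" using R \<delta> by (simp add: field_simps)
    finally show "\<tau> * (3 * R) < \<delta>" .
  qed
  obtain E where E: "finite E" "E \<subseteq> sphere 0 1" "sphere (0::real^'n) 1 \<subseteq> (\<Union>e\<in>E. ball e \<tau>)"
    using seq_compact_imp_totally_bounded[OF compact_imp_seq_compact[OF compact_sphere[of "0::real^'n" 1]],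
      rule_format, OF \<tau>(1)] by (elim exE conjE)
  have net: "\<exists>e\<in>E. norm (e - a) < \<tau>" if "norm a = 1" for a
  proof -
    have "a \<in> (\<Union>e\<in>E. ball e \<tau>)" by (rule subsetD[OF E(3)]) (simp add: that)
    then obtain e where "e \<in> E" "dist e a < \<tau>" by auto
    then show ?thesis unfolding dist_norm by blast
  qed
  have norm1: "norm e = 1" if "e \<in> E" for e using E(2) that by auto
  let ?K = "{x. \<forall>e\<in>E. \<delta> \<le> h e - e \<bullet> x}"
  have bd: "norm x \<le> 2 * R" if x: "x \<in> ?K" for x
  proof (rule ccontr)
    assume "\<not> norm x \<le> 2 * R"
    then have nx: "norm x > 2 * R" "norm x > 0" using R by auto
    define a where "a = x /\<^sub>R norm x"
    have a: "norm a = 1" "a \<bullet> x = norm x" using nx by (auto simp: a_def dot_square_norm power2_eq_square)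
    obtain e where e: "e \<in> E" "norm (e - a) < \<tau>" using net[OF a(1)] by blast
    have "(a - e) \<bullet> x \<le> norm (a - e) * norm x" by (rule norm_cauchy_schwarz)
    also have "\<dots> \<le> 1/2 * norm x" using e \<tau> by (intro mult_right_mono) (auto simp: norm_minus_commute)
    finally have "e \<bullet> x \<ge> norm x / 2" using a by (simp add: inner_diff_left)
    moreover have "\<delta> \<le> h e - e \<bullet> x" using x e by blast
    ultimately show False using hR[OF norm1[OF e(1)]] nx \<delta> by linarith
  qed
  have "?K \<subseteq> \<Omega>"
  proof
    fix x assume x: "x \<in> ?K"
    show "x \<in> \<Omega>"
    proof (rule ccontr)
      assume "x \<notin> \<Omega>"
      \<comment> \<open>The normal of a hyperplane separating \<open>x\<close> from
        \<open>\<Omega>\<close>, replaced by its neighbour in \<open>E\<close>, leaves less than the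
        required gap \<open>\<delta>\<close> at \<open>x\<close>.\<close>
      then obtain b c where b: "b \<noteq> 0" "\<And>y. y \<in> \<Omega> \<Longrightarrow> b \<bullet> y \<le> c" "c \<le> b \<bullet> x"
        using separating_hyperplane_sets[of \<Omega> "{x}"] \<Omega> by auto
      define a where "a = b /\<^sub>R norm b"
      have a: "norm a = 1" "\<And>y. y \<in> \<Omega> \<Longrightarrow> a \<bullet> y \<le> a \<bullet> x"
        using b by (force simp: a_def intro!: mult_left_mono)+
      obtain e where e: "e \<in> E" "norm (e - a) < \<tau>" using net[OF a(1)] by blast
      have "h e \<le> a \<bullet> x + \<tau> * R" unfolding h_def
      proof (rule cSUP_least[OF \<Omega>(2)])
        fix y assume y: "y \<in> \<Omega>"
        have "(e - a) \<bullet> y \<le> norm (e - a) * norm y" by (rule norm_cauchy_schwarz)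
        also have "\<dots> \<le> \<tau> * R" using e R(2)[OF y] \<tau> by (intro mult_mono) auto
        finally show "e \<bullet> y \<le> a \<bullet> x + \<tau> * R" using a(2)[OF y] by (simp add: inner_diff_left)
      qed
      moreover have "(a - e) \<bullet> x \<le> \<tau> * (2 * R)"
      proof -
        have "(a - e) \<bullet> x \<le> norm (a - e) * norm x" by (rule norm_cauchy_schwarz)
        also have "\<dots> \<le> \<tau> * (2 * R)" using e bd[OF x] \<tau> by (intro mult_mono) (auto simp: norm_minus_commute)
        finally show ?thesis .
      qed
      moreover have "\<delta> \<le> h e - e \<bullet> x" using x e by blast
      ultimately show False using \<tau>(3) by (simp add: inner_diff_left)
    qed
  qed
  moreover have "compact ?K"
  proof -
    have "closed (\<Inter>e\<in>E. {x. \<delta> \<le> h e - e \<bullet> x})"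
      by (intro closed_INT ballI closed_Collect_le continuous_intros)
    moreover have "(\<Inter>e\<in>E. {x. \<delta> \<le> h e - e \<bullet> x}) = ?K" by auto
    ultimately have "closed ?K" by simp
    moreover have "bounded ?K" using bd by (auto simp: bounded_iff)
    ultimately show ?thesis by (simp add: compact_eq_bounded_closed)
  qed
  moreover have "E \<noteq> {}" using net[of "axis undefined 1"] by (auto simp: norm_axis_1)
  ultimately show ?thesis using that E(1) norm1 by blast
qed

text \<open>The sum is \<open>(1 + 1 / y) * exp (- 1 / y)\<close>, the slope of the truncation in
  \<open>concave_weights\<close>; the upper bound is \<open>1 + t \<le> exp t\<close>.\<close>

lemma flat_sum_bounds:
  assumes "y > 0"
  shows "exp (- 1 / y) \<le> flat 0 y + flat 1 y" "flat 0 y + flat 1 y \<le> 1"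
proof -
  have eq: "flat 0 y + flat 1 y = exp (- (1 / y)) * (1 + 1 / y)" using assms by (simp add: flat_def algebra_simps)
  show "exp (- 1 / y) \<le> flat 0 y + flat 1 y" unfolding eq using assms by (simp add: algebra_simps)
  have "exp (- (1 / y)) * (1 + 1 / y) \<le> exp (- (1 / y)) * exp (1 / y)"
    by (intro mult_left_mono exp_ge_add_one_self) auto
  then show "flat 0 y + flat 1 y \<le> 1" unfolding eq by (simp add: exp_minus)
qed

text \<open>The weights: \<open>\<phi> n\<close> is a smooth concave approximation of the distance to the boundary, and
  \<open>\<eta> n\<close> is obtained from it by a smooth truncation at height \<open>1 / (n + 1)\<close>.\<close>

lemma concave_weights:
  fixes \<Omega> :: "(real^'n::finite) set"
  assumes \<Omega>: "open \<Omega>" "\<Omega> \<noteq> {}" "bounded \<Omega>" "convex \<Omega>"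
  obtains \<phi> \<eta> \<theta> :: "nat \<Rightarrow> real^'n \<Rightarrow> real"
  where "\<And>n. smooth (\<phi> n)" "\<And>n i x. \<bar>partial_deriv i (\<phi> n) x\<bar> \<le> 1"
    "\<And>n a x. (\<Sum>i\<in>UNIV. \<Sum>j\<in>UNIV. a $ i * a $ j * partial_deriv j (partial_deriv i (\<phi> n)) x) \<le> 0"
    "\<And>n. \<eta> n \<in> test_functions \<Omega>" "\<And>n x. \<eta> n x \<ge> 0"
    "\<And>n. \<theta> n \<in> borel_measurable borel" "\<And>n x. 0 \<le> \<theta> n x" "\<And>n x. \<theta> n x \<le> 1"
    "\<And>n i x. partial_deriv i (\<eta> n) x = \<theta> n x * partial_deriv i (\<phi> n) x"
    "\<And>x. x \<in> \<Omega> \<Longrightarrow> (\<lambda>n. \<theta> n x) \<longlonglongrightarrow> 1"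
    "\<And>x. x \<in> \<Omega> \<Longrightarrow> \<exists>c>0. \<forall>\<^sub>F n in sequentially. \<eta> n x \<ge> c"
proof -
  define h where "h e = (SUP y\<in>\<Omega>. e \<bullet> y)" for e
  define \<delta> where "\<delta> n = 1 / real (Suc n)" for n
  have \<delta>: "\<delta> n > 0" for n by (simp add: \<delta>_def)
  have \<delta>0: "\<delta> \<longlonglongrightarrow> 0" unfolding \<delta>_def by (rule LIMSEQ_Suc[OF lim_1_over_n])
  define P where "P n E \<longleftrightarrow> finite E \<and> E \<noteq> {} \<and> (\<forall>e\<in>E. norm e = 1) \<and>
      compact {x. \<forall>e\<in>E. \<delta> n \<le> h e - e \<bullet> x} \<and> {x. \<forall>e\<in>E. \<delta> n \<le> h e - e \<bullet> x} \<subseteq> \<Omega>" for n E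
  have "\<exists>E. P n E" for n
  proof -
    obtain E where "finite E" "E \<noteq> {}" "\<And>e. e \<in> E \<Longrightarrow> norm e = 1"
      "compact {x. \<forall>e\<in>E. \<delta> n \<le> (SUP y\<in>\<Omega>. e \<bullet> y) - e \<bullet> x}"
      "{x. \<forall>e\<in>E. \<delta> n \<le> (SUP y\<in>\<Omega>. e \<bullet> y) - e \<bullet> x} \<subseteq> \<Omega>"
      by (rule finite_supporting_halfspaces[OF \<Omega> \<delta>[of n]]) blast
    then have "P n E" unfolding P_def h_def by simp
    then show ?thesis ..
  qed
  then obtain E where "\<And>n. P n (E n)" by metis
  then have E: "\<And>n. finite (E n)" "\<And>n. E n \<noteq> {}" "\<And>n e. e \<in> E n \<Longrightarrow> norm e = 1"
    and K: "\<And>n. compact {x. \<forall>e\<in>E n. \<delta> n \<le> h e - e \<bullet> x}" "\<And>n. {x. \<forall>e\<in>E n. \<delta> n \<le> h e - e \<bullet> x} \<subseteq> \<Omega>"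
    unfolding P_def by simp_all
  have card: "ln (real (card (E n))) \<ge> 0" for n
    using E(1,2)[of n] by (simp add: Suc_leI card_gt_0_iff)
  \<comment> \<open>Keeps the error of the soft minimum below \<open>\<delta> n\<close>. The added 1
    avoids division by zero, as the logarithm is 0 for a single direction.\<close>
  define \<epsilon> where "\<epsilon> n = \<delta> n / (ln (real (card (E n))) + 1)" for n
  have \<epsilon>: "\<epsilon> n > 0" "\<epsilon> n * ln (real (card (E n))) \<le> \<delta> n" for n
    using \<delta>[of n] card[of n] by (auto simp: \<epsilon>_def divide_simps mult_left_mono)
  define \<phi> where "\<phi> n = soft_min (E n) h (\<epsilon> n)" for n
  note sm = E \<epsilon>(1)
  define y where "y n x = (\<phi> n x - \<delta> n) / \<delta> n" for n x
  \<comment> \<open>For \<open>s = \<phi> n x - \<delta> n > 0\<close> this is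
    \<open>s * exp (- \<delta> n / s)\<close>, continued smoothly by 0. Its slope in
    \<open>s\<close> is \<open>\<theta>\<close>: it stays in [0,1] and tends to 1 when
    \<open>s / \<delta> n\<close> grows. The profile is convex, so \<open>\<eta>\<close> does not
    inherit the concavity of \<open>\<phi>\<close>.\<close>
  define \<eta> where "\<eta> n x = (\<phi> n x - \<delta> n) * flat 0 (y n x)" for n x
  define \<theta> where "\<theta> n x = flat 0 (y n x) + flat 1 (y n x)" for n x
  have s\<phi>: "smooth (\<phi> n)" for n unfolding \<phi>_def by (rule smooth_soft_min[OF sm])
  have sy: "smooth (y n)" for n
  proof -
    have "smooth (\<lambda>x. (1 / \<delta> n) * (\<phi> n x - \<delta> n))" by (intro smooth_cmult smooth_diff s\<phi>) auto
    then show ?thesis by (simp add: y_def[abs_def])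
  qed
  have s\<eta>: "smooth (\<eta> n)" for n
    unfolding \<eta>_def by (intro smooth_mult smooth_diff s\<phi> smooth_flat sy) auto
  have d\<eta>: "partial_deriv i (\<eta> n) x = \<theta> n x * partial_deriv i (\<phi> n) x" for n i x
  proof -
    define B where "B s = s * flat 0 (s / \<delta> n)" for s
    have "(flat 0 has_real_derivative flat 2 (s / \<delta> n)) (at (s / \<delta> n))" for s
      using flat_deriv[of 0 "s / \<delta> n"] by (simp add: numeral_2_eq_2)
    then have "(B has_real_derivative flat 0 (s / \<delta> n) + s * (flat 2 (s / \<delta> n) * (1 / \<delta> n))) (at s)" for s
    proof -
      have "((\<lambda>s. flat 0 (s / \<delta> n)) has_real_derivative flat 2 (s / \<delta> n) * (1 / \<delta> n)) (at s)"
        by (rule DERIV_chain2[where f = "flat 0" and g = "\<lambda>s. s / \<delta> n" and x = s, OF \<open>(flat 0 has_real_derivative flat 2 (s / \<delta> n)) (at (s / \<delta> n))\<close>])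
          (use \<delta>[of n] in \<open>auto intro!: derivative_eq_intros\<close>)
      from DERIV_mult[OF DERIV_ident this] show ?thesis by (simp add: B_def[abs_def] mult.commute)
    qed
    \<comment> \<open>Multiplying \<open>flat 2\<close> by its argument lowers the index by
      one.\<close>
    moreover have "s * (flat 2 (s / \<delta> n) * (1 / \<delta> n)) = flat 1 (s / \<delta> n)" for s
      using \<delta>[of n] by (auto simp: flat_def power2_eq_square zero_less_divide_iff)
    ultimately have dB: "(B has_real_derivative flat 0 (s / \<delta> n) + flat 1 (s / \<delta> n)) (at s)" for s by simp
    have s: "smooth (\<lambda>x. \<phi> n x - \<delta> n)" by (intro smooth_diff s\<phi>) auto
    have d: "partial_deriv i (\<lambda>x. \<phi> n x - \<delta> n) x = partial_deriv i (\<phi> n) x"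
      using partial_deriv_add[OF smooth_differentiable[OF s\<phi>[of n]] smooth_differentiable[OF smooth_const], of i "- \<delta> n" x]
      by (simp add: partial_deriv_const)
    show ?thesis
      using partial_deriv_compose[OF smooth_differentiable[OF s] dB, of i x]
      unfolding d by (simp add: B_def \<eta>_def[abs_def] \<theta>_def y_def)
  qed
  \<comment> \<open>A ball of radius \<open>r\<close> around \<open>x\<close> inside
    \<open>\<Omega>\<close> puts every affine function at least at height \<open>r\<close>, hence
    \<open>\<phi> n x\<close> at least at \<open>r - \<delta> n\<close>; the constant is
    \<open>r / 2\<close>.\<close>
  have low: "\<exists>k>0. \<forall>\<^sub>F n in sequentially. \<phi> n x - \<delta> n \<ge> k \<and> \<delta> n \<le> k" if x: "x \<in> \<Omega>" for x
  proof -
    obtain r where r: "r > 0" "cball x r \<subseteq> \<Omega>" using \<Omega>(1) x open_contains_cball by blast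
    have he: "h e - e \<bullet> x \<ge> r" if "norm e = 1" for e
    proof -
      have "x + r *\<^sub>R e \<in> \<Omega>" using r that by (auto simp: subset_eq dist_norm)
      moreover have "bdd_above ((\<lambda>y. e \<bullet> y) ` \<Omega>)"
        using bounded_linear_image[OF \<Omega>(3) bounded_linear_inner_right[of e]] by (rule bounded_imp_bdd_above)
      ultimately have "e \<bullet> (x + r *\<^sub>R e) \<le> h e" unfolding h_def by (rule cSUP_upper)
      then show ?thesis using that by (simp add: inner_add_right dot_square_norm)
    qed
    have \<phi>: "\<phi> n x \<ge> r - \<delta> n" for n
    proof -
      have "r - \<epsilon> n * ln (card (E n)) \<le> \<phi> n x"
        unfolding \<phi>_def by (rule soft_min_ge[OF sm]) (use he E(3) in auto)
      then show ?thesis using \<epsilon>(2)[of n] by linarith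
    qed
    have "eventually (\<lambda>n. \<delta> n < r / 4) sequentially" using \<delta>0 r by (intro order_tendstoD(2)) auto
    then have "\<forall>\<^sub>F n in sequentially. \<phi> n x - \<delta> n \<ge> r / 2 \<and> \<delta> n \<le> r / 2"
    proof eventually_elim
      case (elim n)
      then show ?case using \<phi>[of n] r by linarith
    qed
    then show ?thesis using r by (intro exI[of _ "r / 2"]) auto
  qed
  show ?thesis
  proof (rule that[of \<phi> \<eta> \<theta>])
    show "smooth (\<phi> n)" for n by fact
    show "\<bar>partial_deriv i (\<phi> n) x\<bar> \<le> 1" for n i x unfolding \<phi>_def by (rule partial_deriv_soft_min_le[OF sm])
    show "(\<Sum>i\<in>UNIV. \<Sum>j\<in>UNIV. a $ i * a $ j * partial_deriv j (partial_deriv i (\<phi> n)) x) \<le> 0" for n a x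
      unfolding \<phi>_def by (rule soft_min_concave[OF sm])
    show "\<eta> n \<in> test_functions \<Omega>" for n
    proof (rule test_functionsI[OF s\<eta> K])
      fix x assume "\<eta> n x \<noteq> 0"
      then have "y n x > 0" using flat_eq_0[of "y n x" 0] by (force simp: \<eta>_def)
      then have gt: "\<phi> n x > \<delta> n" using \<delta>[of n] by (simp add: y_def zero_less_divide_iff)
      have "\<delta> n \<le> h e - e \<bullet> x" if "e \<in> E n" for e
      proof -
        have "\<phi> n x \<le> h e - e \<bullet> x" unfolding \<phi>_def by (rule soft_min_le[OF sm that])
        then show ?thesis using gt by simp
      qed
      then show "x \<in> {x. \<forall>e\<in>E n. \<delta> n \<le> h e - e \<bullet> x}" by blast
    qed
    show "\<eta> n x \<ge> 0" for n x
    proof (cases "y n x > 0")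
      case True
      then show ?thesis using \<delta>[of n] by (simp add: \<eta>_def flat_nonneg y_def zero_less_divide_iff)
    qed (simp add: \<eta>_def flat_eq_0)
    have "smooth (\<theta> n)" for n unfolding \<theta>_def by (intro smooth_add smooth_flat sy)
    then show "\<theta> n \<in> borel_measurable borel" for n by (rule smooth_borel_measurable)
    show "0 \<le> \<theta> n x" for n x by (simp add: \<theta>_def flat_nonneg)
    show \<theta>1: "\<theta> n x \<le> 1" for n x
      using flat_sum_bounds(2)[of "y n x"] by (cases "y n x > 0") (auto simp: \<theta>_def flat_eq_0)
    show "partial_deriv i (\<eta> n) x = \<theta> n x * partial_deriv i (\<phi> n) x" for n i x by fact
    show "(\<lambda>n. \<theta> n x) \<longlonglongrightarrow> 1" if x: "x \<in> \<Omega>" for x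
    proof -
      obtain k where k: "k > 0" "\<forall>\<^sub>F n in sequentially. \<phi> n x - \<delta> n \<ge> k \<and> \<delta> n \<le> k"
        using low[OF x] by blast
      have "(\<lambda>n. exp (- (\<delta> n / k))) \<longlonglongrightarrow> exp (- (0 / k))" by (intro tendsto_intros \<delta>0) (use k in auto)
      then have l: "(\<lambda>n. exp (- (\<delta> n / k))) \<longlonglongrightarrow> 1" by simp
      have "\<forall>\<^sub>F n in sequentially. exp (- (\<delta> n / k)) \<le> \<theta> n x"
        using k(2)
      proof eventually_elim
        case (elim n)
        then have y: "y n x > 0" using k \<delta>[of n] by (auto simp: y_def)
        have "1 / y n x \<le> \<delta> n / k" using elim k \<delta>[of n] by (auto simp: y_def intro!: divide_left_mono mult_pos_pos)
        then have "exp (- (\<delta> n / k)) \<le> exp (- 1 / y n x)" by simp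
        also have "\<dots> \<le> \<theta> n x" unfolding \<theta>_def by (rule flat_sum_bounds(1)[OF y])
        finally show ?case .
      qed
      then show ?thesis using \<theta>1 by (intro tendsto_sandwich[OF _ _ l tendsto_const]) auto
    qed
    show "\<exists>c>0. \<forall>\<^sub>F n in sequentially. \<eta> n x \<ge> c" if x: "x \<in> \<Omega>" for x
    proof -
      obtain k where k: "k > 0" "\<forall>\<^sub>F n in sequentially. \<phi> n x - \<delta> n \<ge> k \<and> \<delta> n \<le> k"
        using low[OF x] by blast
      have "\<forall>\<^sub>F n in sequentially. \<eta> n x \<ge> k * exp (- 1)"
        using k(2)
      proof eventually_elim
        case (elim n)
        then have y: "y n x \<ge> 1" using k \<delta>[of n] by (auto simp: y_def)
        then have "exp (- 1) \<le> flat 0 (y n x)" by (simp add: flat_def)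
        then show ?case unfolding \<eta>_def using elim k by (intro mult_mono) auto
      qed
      then show ?thesis using k by (intro exI[of _ "k * exp (- 1)"]) auto
    qed
  qed
qed

subsection \<open>Square integrable functions\<close>

text \<open>Borel representatives extended by 0: every integral is then over \<open>lborel\<close>,
  where the shift arguments apply.\<close>

definition L2_on :: "(real^'n::finite) set \<Rightarrow> (real^'n \<Rightarrow> real) set" where
  "L2_on \<Omega> = {f \<in> borel_measurable borel. (\<forall>x. x \<notin> \<Omega> \<longrightarrow> f x = 0) \<and> integrable lborel (\<lambda>x. (f x)\<^sup>2)}"

lemma L2_onD:
  assumes "f \<in> L2_on \<Omega>"
  shows "f \<in> borel_measurable borel" "x \<notin> \<Omega> \<Longrightarrow> f x = 0" "integrable lborel (\<lambda>x. (f x)\<^sup>2)"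
  using assms by (auto simp: L2_on_def)

lemma L2_on_mult_integrable: "f \<in> L2_on \<Omega> \<Longrightarrow> g \<in> L2_on \<Omega> \<Longrightarrow> integrable lborel (\<lambda>x. f x * g x)"
  by (rule integrable_square_mult) (simp_all add: L2_on_def)

lemma L2_on_add: "f \<in> L2_on \<Omega> \<Longrightarrow> g \<in> L2_on \<Omega> \<Longrightarrow> (\<lambda>x. f x + g x) \<in> L2_on \<Omega>"
  using L2_on_mult_integrable[of f \<Omega> g]
  by (auto simp: L2_on_def power2_sum mult.assoc)

lemma L2_on_uminus: "f \<in> L2_on \<Omega> \<Longrightarrow> (\<lambda>x. - f x) \<in> L2_on \<Omega>"
  by (auto simp: L2_on_def)

lemma L2_on_diff: "f \<in> L2_on \<Omega> \<Longrightarrow> g \<in> L2_on \<Omega> \<Longrightarrow> (\<lambda>x. f x - g x) \<in> L2_on \<Omega>"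
  using L2_on_add[of f \<Omega> "\<lambda>x. - g x"] L2_on_uminus by auto

lemma L2_on_bounded_mult:
  assumes f: "f \<in> L2_on \<Omega>" and [measurable]: "g \<in> borel_measurable borel" and g: "\<And>x. x \<in> \<Omega> \<Longrightarrow> \<bar>g x\<bar> \<le> B"
  shows "(\<lambda>x. f x * g x) \<in> L2_on \<Omega>"
proof -
  have [measurable]: "f \<in> borel_measurable borel" using L2_onD[OF f] by blast
  have "integrable lborel (\<lambda>x. (f x * g x)\<^sup>2)"
  proof (rule Bochner_Integration.integrable_bound)
    show "integrable lborel (\<lambda>x. B\<^sup>2 * (f x)\<^sup>2)" using L2_onD(3)[OF f] by simp
    show "AE x in lborel. norm ((f x * g x)\<^sup>2) \<le> norm (B\<^sup>2 * (f x)\<^sup>2)"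
    proof (rule AE_I2)
      fix x
      show "norm ((f x * g x)\<^sup>2) \<le> norm (B\<^sup>2 * (f x)\<^sup>2)"
      proof (cases "x \<in> \<Omega>")
        case True
        then have "(g x)\<^sup>2 \<le> B\<^sup>2" using g[of x] by (metis abs_ge_zero power2_abs power_mono)
        then have "(f x)\<^sup>2 * (g x)\<^sup>2 \<le> (f x)\<^sup>2 * B\<^sup>2" by (intro mult_left_mono) auto
        then show ?thesis by (simp add: power_mult_distrib mult.commute)
      qed (simp add: L2_onD(2)[OF f])
    qed
  qed measurable
  then show ?thesis using L2_onD(2)[OF f] by (auto simp: L2_on_def)
qed

lemma smooth_bounded_on:
  assumes "smooth g" "bounded \<Omega>" obtains B where "\<And>x. x \<in> \<Omega> \<Longrightarrow> \<bar>g x\<bar> \<le> B"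
proof -
  have "compact (g ` closure \<Omega>)"
    using assms by (intro compact_continuous_image smooth_continuous_on) (simp_all add: compact_eq_bounded_closed bounded_closure)
  then obtain B where B: "\<And>y. y \<in> g ` closure \<Omega> \<Longrightarrow> norm y \<le> B"
    using compact_imp_bounded bounded_iff by metis
  have "\<bar>g x\<bar> \<le> B" if "x \<in> \<Omega>" for x
    using B[of "g x"] closure_subset[of \<Omega>] that by auto
  then show ?thesis using that by blast
qed

lemma L2_on_mult_smooth:
  assumes "f \<in> L2_on \<Omega>" "smooth g" "bounded \<Omega>"
  shows "(\<lambda>x. f x * g x) \<in> L2_on \<Omega>"
proof -
  obtain B where "\<And>x. x \<in> \<Omega> \<Longrightarrow> \<bar>g x\<bar> \<le> B" using smooth_bounded_on[OF assms(2,3)] by blast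
  then show ?thesis using L2_on_bounded_mult[OF assms(1)] assms(2) smooth_borel_measurable by blast
qed

lemma L2_on_integrable:
  assumes f: "f \<in> L2_on \<Omega>" and \<Omega>: "bounded \<Omega>"
  shows "integrable lborel f"
proof -
  obtain R where "\<And>x. x \<in> \<Omega> \<Longrightarrow> norm x \<le> R" using \<Omega> by (auto simp: bounded_iff)
  then have R: "\<Omega> \<subseteq> cball 0 R" by auto
  have [measurable]: "f \<in> borel_measurable borel" using L2_onD[OF f] by blast
  show ?thesis
  proof (rule Bochner_Integration.integrable_bound)
    have "integrable lborel (indicat_real (cball (0::real^'a) R))"
      by (intro integrable_real_indicator) (use emeasure_lborel_cball_finite[of "0::real^'a" R] in auto)
    then show "integrable lborel (\<lambda>x. indicat_real (cball 0 R) x + (f x)\<^sup>2)" using L2_onD(3)[OF f] by simp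
    show "AE x in lborel. norm (f x) \<le> norm (indicat_real (cball 0 R) x + (f x)\<^sup>2)"
    proof (rule AE_I2)
      fix x
      show "norm (f x) \<le> norm (indicat_real (cball 0 R) x + (f x)\<^sup>2)"
      proof (cases "x \<in> \<Omega>")
        case True
        have "2 * \<bar>f x\<bar> \<le> 1 + (f x)\<^sup>2" using sum_squares_bound[of 1 "\<bar>f x\<bar>"] by simp
        then show ?thesis using True R by (auto simp: indicator_def)
      qed (simp add: L2_onD(2)[OF f])
    qed
  qed measurable
qed

lemma test_functions_L2_on:
  assumes "\<phi> \<in> test_functions \<Omega>"
  shows "\<phi> \<in> L2_on \<Omega>"
proof -
  obtain B where B: "\<And>x. \<bar>\<phi> x\<bar> \<le> B" using test_functions_bounded[OF assms] by blast
  have "\<phi> \<in> borel_measurable borel" using assms by measurable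
  moreover have "integrable lborel (\<lambda>x. (\<phi> x)\<^sup>2)"
    unfolding power2_eq_square
    using integrable_bounded_mult[OF test_functions_integrable[OF assms] calculation B] .
  moreover have "\<phi> x = 0" if "x \<notin> \<Omega>" for x
    using support_memI[of \<phi> x] test_functionsD(3)[OF assms] that by auto
  ultimately show ?thesis by (auto simp: L2_on_def)
qed

lemma tendsto_integral_mult_L2:
  fixes f g :: "real^'n::finite \<Rightarrow> real"
  assumes f: "f \<in> L2_on \<Omega>" and g: "g \<in> L2_on \<Omega>" and fn: "\<And>n. F n \<in> L2_on \<Omega>"
    and lim: "(\<lambda>n. LINT x|lborel. (f x - F n x)\<^sup>2) \<longlonglongrightarrow> 0"
  shows "(\<lambda>n. LINT x|lborel. F n x * g x) \<longlonglongrightarrow> (LINT x|lborel. f x * g x)"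
proof (rule tendstoI)
  fix e :: real assume e: "e > 0"
  define N where "N = (LINT x|lborel. (g x)\<^sup>2)"
  have N: "N \<ge> 0" by (simp add: N_def)
  define t where "t = e / (2 * (N + 1))"
  have t: "t > 0" "t * N < e"
    using e N by (auto simp: t_def divide_simps mult_left_mono intro: add_pos_nonneg)
  \<comment> \<open>Makes the bound \<open>t * N + d / t\<close> equal to \<open>e\<close>.\<close>
  define d where "d = (e - t * N) * t"
  have "d > 0" using t by (simp add: d_def)
  then have "eventually (\<lambda>n. (LINT x|lborel. (f x - F n x)\<^sup>2) < d) sequentially"
    using lim by (intro order_tendstoD(2)) auto
  then show "eventually (\<lambda>n. dist (LINT x|lborel. F n x * g x) (LINT x|lborel. f x * g x) < e) sequentially"
  proof eventually_elim
    case (elim n)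
    have i: "integrable lborel (\<lambda>x. F n x * g x)" "integrable lborel (\<lambda>x. f x * g x)"
      using f g fn L2_on_mult_integrable by blast+
    have D: "(\<lambda>x. f x - F n x) \<in> L2_on \<Omega>" using f fn by (rule L2_on_diff)
    have "\<bar>(LINT x|lborel. f x * g x) - (LINT x|lborel. F n x * g x)\<bar> = \<bar>LINT x|lborel. g x * (f x - F n x)\<bar>"
      using i by (subst Bochner_Integration.integral_diff[symmetric]) (auto simp: algebra_simps)
    also have "\<dots> \<le> t * N + (LINT x|lborel. (f x - F n x)\<^sup>2) / t"
      unfolding N_def by (rule integral_mult_le) (use g D t in \<open>simp_all add: L2_on_def\<close>)
    also have "\<dots> < t * N + d / t" using elim t by (intro add_strict_left_mono divide_strict_right_mono)
    also have "\<dots> = e" using t by (simp add: d_def)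
    finally show ?case by (simp add: dist_real_def abs_minus_commute)
  qed
qed

lemma tendsto_integral_square_L2:
  fixes f :: "real^'n::finite \<Rightarrow> real"
  assumes f: "f \<in> L2_on \<Omega>" and fn: "\<And>n. F n \<in> L2_on \<Omega>"
    and lim: "(\<lambda>n. LINT x|lborel. (f x - F n x)\<^sup>2) \<longlonglongrightarrow> 0"
  shows "(\<lambda>n. LINT x|lborel. (F n x)\<^sup>2) \<longlonglongrightarrow> (LINT x|lborel. (f x)\<^sup>2)"
proof -
  have "(LINT x|lborel. (F n x)\<^sup>2) = (LINT x|lborel. (f x - F n x)\<^sup>2) + (2 * (LINT x|lborel. F n x * f x) - (LINT x|lborel. (f x)\<^sup>2))" for n
  proof -
    have i: "integrable lborel (\<lambda>x. F n x * f x)" "integrable lborel (\<lambda>x. (f x)\<^sup>2)"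
      "integrable lborel (\<lambda>x. (f x - F n x)\<^sup>2)"
      using f fn[of n] L2_on_mult_integrable L2_onD(3)[OF f] L2_onD(3)[OF L2_on_diff[OF f fn]] by blast+
    have "(LINT x|lborel. (F n x)\<^sup>2) = (LINT x|lborel. (f x - F n x)\<^sup>2 + (2 * (F n x * f x) - (f x)\<^sup>2))"
      by (intro Bochner_Integration.integral_cong) (auto simp: power2_eq_square algebra_simps)
    then show ?thesis using i by simp
  qed
  moreover have "(\<lambda>n. (LINT x|lborel. (f x - F n x)\<^sup>2) + (2 * (LINT x|lborel. F n x * f x) - (LINT x|lborel. (f x)\<^sup>2)))
      \<longlonglongrightarrow> 0 + (2 * (LINT x|lborel. f x * f x) - (LINT x|lborel. (f x)\<^sup>2))"
    by (intro tendsto_intros lim tendsto_integral_mult_L2[OF f f fn lim])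
  ultimately show ?thesis by (simp add: power2_eq_square)
qed

lemma test_functions_integral_by_parts:
  assumes "smooth f" "\<phi> \<in> test_functions \<Omega>"
  shows "(LINT x|lborel. f x * partial_deriv i \<phi> x) = - (LINT x|lborel. partial_deriv i f x * \<phi> x)"
proof -
  have p: "(\<lambda>x. f x * \<phi> x) \<in> test_functions \<Omega>" using assms by (rule test_functions_mult)
  then have "(\<lambda>x. f x * \<phi> x) \<in> test_functions UNIV" using test_functions_mono[of \<Omega> UNIV] by auto
  then have "(LINT x|lborel. partial_deriv i (\<lambda>x. f x * \<phi> x) x) = 0" by (rule integral_partial_deriv_eq_0)
  moreover have "partial_deriv i (\<lambda>x. f x * \<phi> x) = (\<lambda>x. partial_deriv i f x * \<phi> x + f x * partial_deriv i \<phi> x)"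
    using assms test_functionsD(1) by (auto intro!: partial_deriv_mult smooth_differentiable)
  moreover have "integrable lborel (\<lambda>x. partial_deriv i f x * \<phi> x)" "integrable lborel (\<lambda>x. f x * partial_deriv i \<phi> x)"
    using test_functions_mult[OF smooth_partial_deriv[OF assms(1)] assms(2)]
      test_functions_mult[OF assms(1) test_functions_partial_deriv[OF assms(2)]] test_functions_integrable by blast+
  ultimately show ?thesis by simp
qed

text \<open>The coordinate \<open>p\<close> has derivative 1, so integration by parts gives the
  integral of \<open>(\<phi> x)\<^sup>2\<close> as -2 times that of
  \<open>p x * \<phi> x * partial_deriv i \<phi> x\<close>. With
  \<open>\<bar>p x\<bar> \<le> R\<close> on \<open>\<Omega>\<close> and the parameter
  \<open>1 / (4 * R\<^sup>2)\<close>, half of the left side is absorbed and the constant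
  \<open>16 * R\<^sup>2\<close> remains.\<close>

lemma poincare_test_functions:
  fixes \<Omega> :: "(real^'n::finite) set"
  assumes "bounded \<Omega>"
  obtains C where "\<And>\<phi>. \<phi> \<in> test_functions \<Omega> \<Longrightarrow>
    (LINT x|lborel. (\<phi> x)\<^sup>2) \<le> C * (LINT x|lborel. (partial_deriv i \<phi> x)\<^sup>2)"
proof -
  obtain R where R: "R > 0" "\<And>x. x \<in> \<Omega> \<Longrightarrow> norm x \<le> R" using assms bounded_pos by metis
  define p where "p x = axis i 1 \<bullet> x" for x :: "real^'n"
  have p: "smooth p" "partial_deriv i p x = 1" for x
    unfolding p_def using partial_deriv_inner[of i "axis i 1 :: real^'n"] by (simp_all add: axis_def)
  have "(LINT x|lborel. (\<phi> x)\<^sup>2) \<le> (16 * R\<^sup>2) * (LINT x|lborel. (partial_deriv i \<phi> x)\<^sup>2)"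
    if \<phi>: "\<phi> \<in> test_functions \<Omega>" for \<phi>
  proof -
    note s = test_functionsD(1)[OF \<phi>]
    have L: "\<phi> \<in> L2_on \<Omega>" "partial_deriv i \<phi> \<in> L2_on \<Omega>"
      using \<phi> test_functions_L2_on test_functions_partial_deriv by blast+
    have pL: "(\<lambda>x. \<phi> x * p x) \<in> L2_on \<Omega>" by (rule L2_on_mult_smooth[OF L(1) p(1) assms])
    have d: "partial_deriv i (\<lambda>x. p x * \<phi> x) x = \<phi> x + p x * partial_deriv i \<phi> x" for x
      using partial_deriv_mult[OF smooth_differentiable[OF p(1)] smooth_differentiable[OF s], of i x] p(2) by simp
    have "(LINT x|lborel. (p x * \<phi> x) * partial_deriv i \<phi> x) = - (LINT x|lborel. (\<phi> x + p x * partial_deriv i \<phi> x) * \<phi> x)"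
      using test_functions_integral_by_parts[OF smooth_mult[OF p(1) s] \<phi>, of i] unfolding d .
    also have "\<dots> = - ((LINT x|lborel. (\<phi> x)\<^sup>2) + (LINT x|lborel. (p x * \<phi> x) * partial_deriv i \<phi> x))"
      using L2_onD(3)[OF L(1)] L2_on_mult_integrable[OF pL L(2)]
      by (subst Bochner_Integration.integral_add[symmetric]) (auto simp: algebra_simps power2_eq_square)
    finally have eq: "(LINT x|lborel. (\<phi> x)\<^sup>2) = - 2 * (LINT x|lborel. (p x * \<phi> x) * partial_deriv i \<phi> x)" by simp
    have "\<bar>LINT x|lborel. (p x * \<phi> x) * partial_deriv i \<phi> x\<bar>
        \<le> 1 / (4 * R\<^sup>2) * (LINT x|lborel. (p x * \<phi> x)\<^sup>2) + (LINT x|lborel. (partial_deriv i \<phi> x)\<^sup>2) / (1 / (4 * R\<^sup>2))"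
      by (rule integral_mult_le) (use pL L R in \<open>simp_all add: L2_on_def mult.commute\<close>)
    moreover have "(LINT x|lborel. (p x * \<phi> x)\<^sup>2) \<le> (LINT x|lborel. R\<^sup>2 * (\<phi> x)\<^sup>2)"
    proof (rule integral_mono)
      show "integrable lborel (\<lambda>x. (p x * \<phi> x)\<^sup>2)" using L2_onD(3)[OF pL] by (simp add: mult.commute)
      show "integrable lborel (\<lambda>x. R\<^sup>2 * (\<phi> x)\<^sup>2)" using L2_onD(3)[OF L(1)] by simp
      fix x
      show "(p x * \<phi> x)\<^sup>2 \<le> R\<^sup>2 * (\<phi> x)\<^sup>2"
      proof (cases "x \<in> \<Omega>")
        case True
        have "\<bar>p x\<bar> \<le> norm x" unfolding p_def inner_axis' using component_le_norm_cart[of x i] by simp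
        then have "\<bar>p x\<bar> \<le> R" using R True by (meson order_trans)
        then have "(p x)\<^sup>2 \<le> R\<^sup>2" by (metis abs_ge_zero power2_abs power_mono)
        then show ?thesis by (simp add: power_mult_distrib mult_right_mono)
      qed (simp add: L2_onD(2)[OF L(1)])
    qed
    then have "1 / (4 * R\<^sup>2) * (LINT x|lborel. (p x * \<phi> x)\<^sup>2) \<le> 1 / (4 * R\<^sup>2) * (R\<^sup>2 * (LINT x|lborel. (\<phi> x)\<^sup>2))"
      by (intro mult_left_mono) auto
    moreover have "1 / (4 * R\<^sup>2) * (R\<^sup>2 * (LINT x|lborel. (\<phi> x)\<^sup>2)) = (LINT x|lborel. (\<phi> x)\<^sup>2) / 4"
      using R by simp
    moreover have "(LINT x|lborel. (partial_deriv i \<phi> x)\<^sup>2) / (1 / (4 * R\<^sup>2)) = 4 * R\<^sup>2 * (LINT x|lborel. (partial_deriv i \<phi> x)\<^sup>2)"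
      by simp
    ultimately show ?thesis using eq by linarith
  qed
  then show ?thesis using that by blast
qed

subsection \<open>Functions with vanishing trace and indefinite Hessian\<close>

text \<open>\<open>p\<close> and \<open>M\<close> stand for the gradient and the Hessian of a function in
  \<open>H\<^sup>2(\<Omega>) \<inter> H\<^sup>1\<^sub>0(\<Omega>)\<close>, and the test functions \<open>\<psi> n\<close> approximate that function in \<open>H\<^sup>1\<^sub>0(\<Omega>)\<close>.\<close>

locale H2_H10_planar =
  fixes \<Omega> :: "(real^2) set" and p :: "2 \<Rightarrow> real^2 \<Rightarrow> real" and M :: "2 \<Rightarrow> 2 \<Rightarrow> real^2 \<Rightarrow> real"
    and \<psi> :: "nat \<Rightarrow> real^2 \<Rightarrow> real"
  assumes \<Omega>: "open \<Omega>" "\<Omega> \<noteq> {}" "bounded \<Omega>" "convex \<Omega>"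
    and gradL: "p i \<in> L2_on \<Omega>" and hessL: "M i j \<in> L2_on \<Omega>" and M_sym: "M i j = M j i"
    and by_parts: "\<zeta> \<in> test_functions \<Omega> \<Longrightarrow>
      (LINT x|lborel. p i x * partial_deriv j \<zeta> x) = - (LINT x|lborel. M i j x * \<zeta> x)"
    and \<psi>: "\<psi> n \<in> test_functions \<Omega>"
    and \<psi>_lim: "(\<lambda>n. LINT x|lborel. (p i x - partial_deriv i (\<psi> n) x)\<^sup>2) \<longlonglongrightarrow> 0"
begin

text \<open>The Jacobian determinant of the pair with components \<open>\<eta> * p k\<close> and
  \<open>p l\<close> integrates to 0 because the first component has compact support in
  \<open>\<Omega>\<close>; its weak gradient comes from the product rule.\<close>

lemma det_by_parts:
  assumes \<eta>: "\<eta> \<in> test_functions \<Omega>"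
  shows "(LINT x|lborel. (partial_deriv 1 \<eta> x * p k x + \<eta> x * M k 1 x) * M l 2 x) =
    (LINT x|lborel. (partial_deriv 2 \<eta> x * p k x + \<eta> x * M k 2 x) * M l 1 x)"
proof -
  note s\<eta> = test_functionsD(1)[OF \<eta>]
  let ?G = "\<lambda>j x. partial_deriv j \<eta> x * p k x + \<eta> x * M k j x"
  have GL: "?G j \<in> L2_on \<Omega>" for j
  proof (rule L2_on_add)
    show "(\<lambda>x. partial_deriv j \<eta> x * p k x) \<in> L2_on \<Omega>"
      using L2_on_mult_smooth[OF gradL smooth_partial_deriv[OF s\<eta>] \<Omega>(3), of k j] by (simp only: mult.commute)
    show "(\<lambda>x. \<eta> x * M k j x) \<in> L2_on \<Omega>"
      using L2_on_mult_smooth[OF hessL s\<eta> \<Omega>(3), of k j] by (simp only: mult.commute)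
  qed
  have \<psi>L: "(\<lambda>x. p k x * \<eta> x) \<in> L2_on \<Omega>" by (rule L2_on_mult_smooth[OF gradL s\<eta> \<Omega>(3)])
  \<comment> \<open>The factor \<open>\<eta>\<close> turns an arbitrary smooth
    \<open>\<zeta>\<close> into a test function, so \<open>\<zeta>\<close> itself may be
    unrestricted, as \<open>weak_gradient_orthogonal\<close> demands.\<close>
  have grad: "(LINT x|lborel. (p k x * \<eta> x) * partial_deriv j \<zeta> x) = - (LINT x|lborel. ?G j x * \<zeta> x)"
    if \<zeta>: "smooth \<zeta>" for j \<zeta>
  proof -
    have t: "(\<lambda>x. \<zeta> x * \<eta> x) \<in> test_functions \<Omega>" by (rule test_functions_mult[OF \<zeta> \<eta>])
    have d: "partial_deriv j (\<lambda>x. \<zeta> x * \<eta> x) x = partial_deriv j \<zeta> x * \<eta> x + \<zeta> x * partial_deriv j \<eta> x" for x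
      by (intro partial_deriv_mult smooth_differentiable \<zeta> s\<eta>)
    have L1: "(\<lambda>x. partial_deriv j \<zeta> x * \<eta> x) \<in> L2_on \<Omega>" "(\<lambda>x. \<zeta> x * partial_deriv j \<eta> x) \<in> L2_on \<Omega>"
      "(\<lambda>x. \<zeta> x * \<eta> x) \<in> L2_on \<Omega>"
      using test_functions_mult[OF smooth_partial_deriv[OF \<zeta>] \<eta>]
        test_functions_mult[OF \<zeta> test_functions_partial_deriv[OF \<eta>]] t test_functions_L2_on by blast+
    have i: "integrable lborel (\<lambda>x. p k x * (partial_deriv j \<zeta> x * \<eta> x))"
      "integrable lborel (\<lambda>x. p k x * (\<zeta> x * partial_deriv j \<eta> x))"
      "integrable lborel (\<lambda>x. M k j x * (\<zeta> x * \<eta> x))"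
      using L1 gradL hessL L2_on_mult_integrable by blast+
    have "(LINT x|lborel. p k x * (partial_deriv j \<zeta> x * \<eta> x)) + (LINT x|lborel. p k x * (\<zeta> x * partial_deriv j \<eta> x))
        = - (LINT x|lborel. M k j x * (\<zeta> x * \<eta> x))"
      using by_parts[OF t, of k j] i unfolding d distrib_left by simp
    moreover have "(LINT x|lborel. ?G j x * \<zeta> x) =
        (LINT x|lborel. p k x * (\<zeta> x * partial_deriv j \<eta> x) + M k j x * (\<zeta> x * \<eta> x))"
      by (intro Bochner_Integration.integral_cong) (auto simp: algebra_simps)
    moreover have "(LINT x|lborel. (p k x * \<eta> x) * partial_deriv j \<zeta> x) = (LINT x|lborel. p k x * (partial_deriv j \<zeta> x * \<eta> x))"
      by (intro Bochner_Integration.integral_cong) (auto simp: algebra_simps)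
    ultimately show ?thesis using i by simp
  qed
  show ?thesis
  proof (rule weak_gradient_orthogonal[where b = "p l" and \<psi> = "\<lambda>x. p k x * \<eta> x" and \<Omega> = \<Omega>
        and Bi = "M l 1" and Bj = "M l 2" and i = 1 and j = 2 and K = "closure {x. \<eta> x \<noteq> 0}"])
    show "compact (closure {x. \<eta> x \<noteq> 0})" "closure {x. \<eta> x \<noteq> 0} \<subseteq> \<Omega>" using test_functionsD[OF \<eta>] by auto
    show "y \<in> closure {x. \<eta> x \<noteq> 0}" if "p k y * \<eta> y \<noteq> 0" for y using that by (auto intro: support_memI)
    show "integrable lborel (p l)" "integrable lborel (\<lambda>x. p k x * \<eta> x)" "integrable lborel (M l 1)"
      "integrable lborel (M l 2)" "integrable lborel (?G 1)" "integrable lborel (?G 2)"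
      using L2_on_integrable \<Omega>(3) gradL hessL \<psi>L GL by blast+
    show "integrable lborel (\<lambda>x. (M l 1 x)\<^sup>2)" "integrable lborel (\<lambda>x. (M l 2 x)\<^sup>2)"
      "integrable lborel (\<lambda>x. (?G 1 x)\<^sup>2)" "integrable lborel (\<lambda>x. (?G 2 x)\<^sup>2)"
      using L2_onD(3)[OF hessL] L2_onD(3)[OF GL] by blast+
  qed (use \<Omega> by_parts grad in auto)
qed

text \<open>Minus the inner product of \<open>(g1, g2)\<close> with the cofactor matrix of
  \<open>M\<close> applied to \<open>p\<close>. The cofactor matrix of a Hessian has divergence free
  rows, so the divergence of this vector field, cofactor matrix times gradient, is twice the
  determinant.\<close>

definition flux :: "(real^2 \<Rightarrow> real) \<Rightarrow> (real^2 \<Rightarrow> real) \<Rightarrow> real^2 \<Rightarrow> real" where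
  "flux g1 g2 x = p 2 x * M 1 2 x * g1 x - p 2 x * M 1 1 x * g2 x
    - p 1 x * M 2 2 x * g1 x + p 1 x * M 1 2 x * g2 x"

lemma product_integrable: "integrable lborel (\<lambda>x. p k x * M i j x)"
  using gradL hessL by (rule L2_on_mult_integrable)

text \<open>The instance of \<open>det_by_parts\<close> with \<open>k = 1\<close>,
  \<open>l = 2\<close> expresses the weighted determinant by the flux terms containing
  \<open>p 1\<close>, the one with \<open>k = 2\<close>, \<open>l = 1\<close> by those containing
  \<open>p 2\<close>; the two are added.\<close>

lemma integral_det_eq_flux:
  assumes \<eta>: "\<eta> \<in> test_functions \<Omega>"
  shows "2 * (LINT x|lborel. \<eta> x * (M 1 1 x * M 2 2 x - (M 1 2 x)\<^sup>2)) =
    (LINT x|lborel. flux (partial_deriv 1 \<eta>) (partial_deriv 2 \<eta>) x)"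
proof -
  obtain B where B: "\<And>x. \<bar>\<eta> x\<bar> \<le> B" using test_functions_bounded[OF \<eta>] by blast
  obtain B1 where B1: "\<And>x. \<bar>partial_deriv 1 \<eta> x\<bar> \<le> B1"
    using test_functions_bounded[OF test_functions_partial_deriv[OF \<eta>]] by blast
  obtain B2 where B2: "\<And>x. \<bar>partial_deriv 2 \<eta> x\<bar> \<le> B2"
    using test_functions_bounded[OF test_functions_partial_deriv[OF \<eta>]] by blast
  have [measurable]: "\<eta> \<in> borel_measurable borel" "partial_deriv i \<eta> \<in> borel_measurable borel" for i
    using \<eta> test_functions_partial_deriv[OF \<eta>] by measurable
  have iM: "integrable lborel (\<lambda>x. M i j x * M k l x * \<eta> x)" for i j k l
    by (rule integrable_bounded_mult[OF L2_on_mult_integrable[OF hessL hessL] _ B]) measurable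
  have i1: "integrable lborel (\<lambda>x. p k x * M i j x * partial_deriv 1 \<eta> x)" for i j k
    by (rule integrable_bounded_mult[OF product_integrable _ B1]) measurable
  have i2: "integrable lborel (\<lambda>x. p k x * M i j x * partial_deriv 2 \<eta> x)" for i j k
    by (rule integrable_bounded_mult[OF product_integrable _ B2]) measurable
  let ?I = "\<lambda>f. LINT x|lborel. f x"
  have split: "?I (\<lambda>x. (partial_deriv 1 \<eta> x * p k x + \<eta> x * M k 1 x) * M l 2 x) =
      ?I (\<lambda>x. p k x * M l 2 x * partial_deriv 1 \<eta> x) + ?I (\<lambda>x. M k 1 x * M l 2 x * \<eta> x)"
    "?I (\<lambda>x. (partial_deriv 2 \<eta> x * p k x + \<eta> x * M k 2 x) * M l 1 x) =
      ?I (\<lambda>x. p k x * M l 1 x * partial_deriv 2 \<eta> x) + ?I (\<lambda>x. M k 2 x * M l 1 x * \<eta> x)" for k l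
    using iM i1 i2 by (subst Bochner_Integration.integral_add[symmetric]; simp add: algebra_simps)+
  have e1: "?I (\<lambda>x. p 1 x * M 2 2 x * partial_deriv 1 \<eta> x) + ?I (\<lambda>x. M 1 1 x * M 2 2 x * \<eta> x)
      = ?I (\<lambda>x. p 1 x * M 1 2 x * partial_deriv 2 \<eta> x) + ?I (\<lambda>x. M 1 2 x * M 1 2 x * \<eta> x)"
    using det_by_parts[OF \<eta>, of 1 2] unfolding split unfolding M_sym[of 2 1] .
  have e2: "?I (\<lambda>x. p 2 x * M 1 2 x * partial_deriv 1 \<eta> x) + ?I (\<lambda>x. M 1 2 x * M 1 2 x * \<eta> x)
      = ?I (\<lambda>x. p 2 x * M 1 1 x * partial_deriv 2 \<eta> x) + ?I (\<lambda>x. M 1 1 x * M 2 2 x * \<eta> x)"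
    using det_by_parts[OF \<eta>, of 2 1] unfolding split unfolding M_sym[of 2 1] by (simp only: mult.commute[of "M 2 2 x" for x])
  have "?I (\<lambda>x. \<eta> x * (M 1 1 x * M 2 2 x - (M 1 2 x)\<^sup>2)) =
      ?I (\<lambda>x. M 1 1 x * M 2 2 x * \<eta> x - M 1 2 x * M 1 2 x * \<eta> x)"
    by (intro Bochner_Integration.integral_cong) (auto simp: algebra_simps power2_eq_square)
  also have "\<dots> = ?I (\<lambda>x. M 1 1 x * M 2 2 x * \<eta> x) - ?I (\<lambda>x. M 1 2 x * M 1 2 x * \<eta> x)"
    using iM by (intro Bochner_Integration.integral_diff)
  finally have D: "?I (\<lambda>x. \<eta> x * (M 1 1 x * M 2 2 x - (M 1 2 x)\<^sup>2)) = \<dots>" .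
  have "?I (flux (partial_deriv 1 \<eta>) (partial_deriv 2 \<eta>)) =
      ?I (\<lambda>x. p 2 x * M 1 2 x * partial_deriv 1 \<eta> x) - ?I (\<lambda>x. p 2 x * M 1 1 x * partial_deriv 2 \<eta> x)
      - ?I (\<lambda>x. p 1 x * M 2 2 x * partial_deriv 1 \<eta> x) + ?I (\<lambda>x. p 1 x * M 1 2 x * partial_deriv 2 \<eta> x)"
    unfolding flux_def using i1 i2 by simp
  then show ?thesis using D e1 e2 by linarith
qed

text \<open>The integral of \<open>flux (\<partial>\<^sub>1 \<phi>) (\<partial>\<^sub>2 \<phi>)\<close> and that of the Hessian of \<open>\<phi>\<close> applied to
  the rotated gradient \<open>q = (- p\<^sub>2, p\<^sub>1)\<close> add up to the integral of \<open>q \<bullet> \<nabla>(q \<bullet> \<nabla>\<phi>)\<close>, which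
  vanishes because \<open>q\<close> is the limit of divergence free fields with compact support.\<close>

lemma flux_concave_nonneg:
  assumes \<phi>: "smooth \<phi>"
    and concave: "\<And>a x. (\<Sum>i\<in>UNIV. \<Sum>j\<in>UNIV. a $ i * a $ j * partial_deriv j (partial_deriv i \<phi>) x) \<le> 0"
  shows "(LINT x|lborel. flux (partial_deriv 1 \<phi>) (partial_deriv 2 \<phi>) x) \<ge> 0"
proof -
  let ?d = "\<lambda>i. partial_deriv i \<phi>" and ?dd = "\<lambda>i j. partial_deriv j (partial_deriv i \<phi>)"
  note s1 = smooth_partial_deriv[OF \<phi>] and s2 = smooth_partial_deriv[OF smooth_partial_deriv[OF \<phi>]]
  \<comment> \<open>\<open>r\<close> is the derivative of \<open>\<phi>\<close> in the direction of
    the rotated gradient, and \<open>R i\<close> is its weak i-th derivative.\<close>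
  define r where "r x = p 1 x * ?d 2 x - p 2 x * ?d 1 x" for x
  define R where "R i x = (M 1 i x * ?d 2 x + p 1 x * ?dd 2 i x) - (M 2 i x * ?d 1 x + p 2 x * ?dd 1 i x)" for i x
  have Ls: "(\<lambda>x. p k x * ?d i x) \<in> L2_on \<Omega>" "(\<lambda>x. M k l x * ?d i x) \<in> L2_on \<Omega>" "(\<lambda>x. p k x * ?dd i j x) \<in> L2_on \<Omega>" for i j k l
    using L2_on_mult_smooth[OF gradL s1 \<Omega>(3)] L2_on_mult_smooth[OF hessL s1 \<Omega>(3)] L2_on_mult_smooth[OF gradL s2 \<Omega>(3)] by blast+
  have rL: "r \<in> L2_on \<Omega>" unfolding r_def by (intro L2_on_diff Ls)
  have RL: "R i \<in> L2_on \<Omega>" for i unfolding R_def by (intro L2_on_diff L2_on_add Ls)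
  have rR: "(LINT x|lborel. r x * partial_deriv i \<zeta> x) = - (LINT x|lborel. R i x * \<zeta> x)"
    if \<zeta>: "\<zeta> \<in> test_functions \<Omega>" for i \<zeta>
  proof -
    note L\<zeta> = test_functions_L2_on[OF \<zeta>] test_functions_L2_on[OF test_functions_partial_deriv[OF \<zeta>]]
    have part: "(LINT x|lborel. (p k x * ?d l x) * partial_deriv i \<zeta> x) =
        - (LINT x|lborel. (M k i x * ?d l x + p k x * ?dd l i x) * \<zeta> x)" for k l
    proof -
      have t: "(\<lambda>x. ?d l x * \<zeta> x) \<in> test_functions \<Omega>" by (rule test_functions_mult[OF s1 \<zeta>])
      have d: "partial_deriv i (\<lambda>x. ?d l x * \<zeta> x) x = ?dd l i x * \<zeta> x + ?d l x * partial_deriv i \<zeta> x" for x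
        by (intro partial_deriv_mult smooth_differentiable s1 test_functionsD(1)[OF \<zeta>])
      have i: "integrable lborel (\<lambda>x. (p k x * ?d l x) * partial_deriv i \<zeta> x)"
        "integrable lborel (\<lambda>x. (M k i x * ?d l x) * \<zeta> x)" "integrable lborel (\<lambda>x. (p k x * ?dd l i x) * \<zeta> x)"
        using Ls L\<zeta> L2_on_mult_integrable by blast+
      have "(LINT x|lborel. (p k x * ?dd l i x) * \<zeta> x) + (LINT x|lborel. (p k x * ?d l x) * partial_deriv i \<zeta> x)
          = - (LINT x|lborel. (M k i x * ?d l x) * \<zeta> x)"
        using by_parts[OF t, of k i] i(1,3) unfolding d distrib_left by (simp add: mult.assoc)
      then show ?thesis unfolding distrib_right using i by simp
    qed
    have i: "integrable lborel (\<lambda>x. (p k x * ?d l x) * partial_deriv i \<zeta> x)"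
      "integrable lborel (\<lambda>x. (M k i x * ?d l x + p k x * ?dd l i x) * \<zeta> x)" for k l
      using Ls L2_on_add[OF Ls(2,3)] L\<zeta> L2_on_mult_integrable by blast+
    show ?thesis unfolding r_def R_def left_diff_distrib using i part[of 1 2] part[of 2 1] by simp
  qed
  \<comment> \<open>\<open>rR\<close> with first derivatives of \<open>\<psi> n\<close> as test
    functions. The mixed derivatives of \<open>\<psi> n\<close> commute, which says that its rotated
    gradient is divergence free.\<close>
  have zero: "(LINT x|lborel. partial_deriv 1 (\<psi> n) x * R 2 x) = (LINT x|lborel. partial_deriv 2 (\<psi> n) x * R 1 x)" for n
    using rR[OF test_functions_partial_deriv[OF \<psi>[of n], of 1], of 2] rR[OF test_functions_partial_deriv[OF \<psi>[of n], of 2], of 1]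
    unfolding partial_deriv_commute[OF test_functionsD(1)[OF \<psi>[of n]], of 2 1] by (simp add: mult.commute)
  have d\<psi>: "partial_deriv i (\<psi> n) \<in> L2_on \<Omega>" for i n
    using test_functions_L2_on[OF test_functions_partial_deriv[OF \<psi>]] .
  \<comment> \<open>\<open>R\<close> already contains the limit \<open>p\<close> and its
    derivatives; only the outer factor is approximated, and L2 convergence of first derivatives is
    enough for that.\<close>
  have "(\<lambda>n. LINT x|lborel. partial_deriv 1 (\<psi> n) x * R 2 x) \<longlonglongrightarrow> (LINT x|lborel. p 1 x * R 2 x)"
    by (rule tendsto_integral_mult_L2[OF gradL RL d\<psi> \<psi>_lim])
  moreover have "(\<lambda>n. LINT x|lborel. partial_deriv 2 (\<psi> n) x * R 1 x) \<longlonglongrightarrow> (LINT x|lborel. p 2 x * R 1 x)"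
    by (rule tendsto_integral_mult_L2[OF gradL RL d\<psi> \<psi>_lim])
  ultimately have eq: "(LINT x|lborel. p 1 x * R 2 x) = (LINT x|lborel. p 2 x * R 1 x)"
    unfolding zero using LIMSEQ_unique by blast
  have ipR: "integrable lborel (\<lambda>x. p 1 x * R 2 x)" "integrable lborel (\<lambda>x. p 2 x * R 1 x)"
    using gradL RL L2_on_mult_integrable by blast+
  \<comment> \<open>The two sides differ by the Hessian form of \<open>\<phi>\<close> at the rotated
    gradient \<open>a\<close>, which is nonpositive by concavity.\<close>
  have fl: "flux (?d 1) (?d 2) x \<ge> p 1 x * R 2 x - p 2 x * R 1 x" for x
  proof -
    define a :: "real^2" where "a = vector [- p 2 x, p 1 x]"
    have a: "a $ 1 = - p 2 x" "a $ 2 = p 1 x" by (simp_all add: a_def)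
    have "a $ 1 * a $ 1 * ?dd 1 1 x + a $ 1 * a $ 2 * ?dd 1 2 x + (a $ 2 * a $ 1 * ?dd 2 1 x + a $ 2 * a $ 2 * ?dd 2 2 x) \<le> 0"
      using concave[of a x] by (simp add: sum_2)
    then have "p 2 x * p 2 x * ?dd 1 1 x - p 2 x * p 1 x * ?dd 1 2 x - p 1 x * p 2 x * ?dd 2 1 x + p 1 x * p 1 x * ?dd 2 2 x \<le> 0"
      unfolding a by (simp add: algebra_simps)
    moreover have "M 2 1 = M 1 2" by (rule M_sym)
    ultimately show ?thesis unfolding flux_def R_def by (simp add: algebra_simps)
  qed
  have [measurable]: "?d i \<in> borel_measurable borel" for i using s1 smooth_borel_measurable by blast
  have ifl: "integrable lborel (flux (?d 1) (?d 2))"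
    unfolding flux_def mult.assoc using L2_on_mult_integrable[OF gradL Ls(2)] by simp
  have "0 = (LINT x|lborel. p 1 x * R 2 x - p 2 x * R 1 x)" using eq ipR by simp
  also have "\<dots> \<le> (LINT x|lborel. flux (?d 1) (?d 2) x)"
    by (rule integral_mono) (use ifl ipR fl in auto)
  finally show ?thesis .
qed

text \<open>\<open>\<eta> n\<close> turns the determinant bound into a bound of the weighted
  integral of the squared Hessian by a flux integral. After the nonnegative flux of
  \<open>\<phi> n\<close> is added, only a multiple of \<open>1 - \<theta> n\<close> remains. This
  tends to 0, whereas \<open>\<eta> n\<close> stays bounded below at each point of
  \<open>\<Omega>\<close>.\<close>

lemma hessian_AE_eq_0:
  assumes c: "c > 0"
    and det: "AE x in lborel. M 1 1 x * M 2 2 x - (M 1 2 x)\<^sup>2 \<le> - c * ((M 1 1 x)\<^sup>2 + (M 1 2 x)\<^sup>2 + (M 2 2 x)\<^sup>2)"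
  shows "AE x in lborel. M 1 1 x = 0 \<and> M 1 2 x = 0 \<and> M 2 2 x = 0"
proof -
  obtain \<phi> \<eta> \<theta> :: "nat \<Rightarrow> real^2 \<Rightarrow> real"
    where \<phi>: "\<And>n. smooth (\<phi> n)" "\<And>n i x. \<bar>partial_deriv i (\<phi> n) x\<bar> \<le> 1"
      "\<And>n a x. (\<Sum>i\<in>UNIV. \<Sum>j\<in>UNIV. a $ i * a $ j * partial_deriv j (partial_deriv i (\<phi> n)) x) \<le> 0"
    and \<eta>: "\<And>n. \<eta> n \<in> test_functions \<Omega>" "\<And>n x. \<eta> n x \<ge> 0"
    and \<theta>: "\<And>n. \<theta> n \<in> borel_measurable borel" "\<And>n x. 0 \<le> \<theta> n x" "\<And>n x. \<theta> n x \<le> 1"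
    and \<eta>\<theta>: "\<And>n i x. partial_deriv i (\<eta> n) x = \<theta> n x * partial_deriv i (\<phi> n) x"
    and lim: "\<And>x. x \<in> \<Omega> \<Longrightarrow> (\<lambda>n. \<theta> n x) \<longlonglongrightarrow> 1"
      "\<And>x. x \<in> \<Omega> \<Longrightarrow> \<exists>c>0. \<forall>\<^sub>F n in sequentially. \<eta> n x \<ge> c"
    by (rule concave_weights[OF \<Omega>], rule that; assumption)
  have mM [measurable]: "M i j \<in> borel_measurable borel" "p i \<in> borel_measurable borel" for i j
    using L2_onD(1)[OF hessL] L2_onD(1)[OF gradL] by blast+
  have [measurable]: "\<theta> n \<in> borel_measurable borel" "\<eta> n \<in> borel_measurable borel"
    "partial_deriv i (\<phi> n) \<in> borel_measurable borel" for n i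
    using \<theta>(1) \<eta>(1) smooth_borel_measurable[OF smooth_partial_deriv[OF \<phi>(1)]] by measurable
  define S where "S x = (M 1 1 x)\<^sup>2 + (M 1 2 x)\<^sup>2 + (M 2 2 x)\<^sup>2" for x
  have S0: "S x \<ge> 0" for x by (simp add: S_def)
  have S_int: "integrable lborel S" unfolding S_def using L2_onD(3)[OF hessL] by simp
  have [measurable]: "S \<in> borel_measurable borel" unfolding S_def by measurable
  \<comment> \<open>One integrable bound for the fluxes of all \<open>\<phi> n\<close>, thanks to
    their uniform gradient bound.\<close>
  define P where "P x = \<bar>p 2 x * M 1 2 x\<bar> + \<bar>p 2 x * M 1 1 x\<bar> + \<bar>p 1 x * M 2 2 x\<bar> + \<bar>p 1 x * M 1 2 x\<bar>" for x
  have P_int: "integrable lborel P" unfolding P_def using product_integrable by simp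
  have [measurable]: "P \<in> borel_measurable borel" unfolding P_def by measurable
  define Q where "Q n = flux (partial_deriv 1 (\<phi> n)) (partial_deriv 2 (\<phi> n))" for n
  have QP: "\<bar>Q n x\<bar> \<le> P x" for n x
  proof -
    have b: "\<bar>a * partial_deriv i (\<phi> n) x\<bar> \<le> \<bar>a\<bar>" for a i
      unfolding abs_mult using \<phi>(2)[of i n x] by (simp add: mult_left_le)
    show ?thesis unfolding Q_def flux_def P_def
      using b[of "p 2 x * M 1 2 x" 1] b[of "p 2 x * M 1 1 x" 2] b[of "p 1 x * M 2 2 x" 1] b[of "p 1 x * M 1 2 x" 2]
      by linarith
  qed
  have [measurable]: "Q n \<in> borel_measurable borel" for n unfolding Q_def flux_def by measurable
  have Q_int: "integrable lborel (Q n)" for n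
  proof (rule Bochner_Integration.integrable_bound[OF P_int])
    have "norm (Q n x) \<le> norm (P x)" for x using QP[of n x] by (simp add: P_def)
    then show "AE x in lborel. norm (Q n x) \<le> norm (P x)" by simp
  qed measurable
  have \<theta>P_int: "integrable lborel (\<lambda>x. (1 - \<theta> n x) * P x)" for n
    using integrable_bounded_mult[OF P_int, of "\<lambda>x. 1 - \<theta> n x" 1] \<theta> by (simp add: mult.commute)
  have \<theta>Q_int: "integrable lborel (\<lambda>x. \<theta> n x * Q n x)" for n
    using integrable_bounded_mult[OF Q_int, of "\<theta> n" 1] \<theta> by (simp add: mult.commute)
  have \<eta>S_int: "integrable lborel (\<lambda>x. \<eta> n x * S x)" for n
  proof -
    obtain B where "\<And>x. \<bar>\<eta> n x\<bar> \<le> B" using test_functions_bounded[OF \<eta>(1)] by blast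
    then show ?thesis using integrable_bounded_mult[OF S_int, of "\<eta> n" B] by (simp add: mult.commute)
  qed
  have key: "2 * c * (LINT x|lborel. \<eta> n x * S x) \<le> (LINT x|lborel. (1 - \<theta> n x) * P x)" for n
  proof -
    let ?det = "\<lambda>x. \<eta> n x * (M 1 1 x * M 2 2 x - (M 1 2 x)\<^sup>2)"
    have flux_eq: "flux (partial_deriv 1 (\<eta> n)) (partial_deriv 2 (\<eta> n)) x = \<theta> n x * Q n x" for x
      unfolding flux_def Q_def \<eta>\<theta> by (simp add: algebra_simps)
    have "integrable lborel (\<lambda>x. M 1 1 x * M 2 2 x - (M 1 2 x)\<^sup>2)"
      using L2_on_mult_integrable[OF hessL hessL] L2_onD(3)[OF hessL] by simp
    moreover obtain B where "\<And>x. \<bar>\<eta> n x\<bar> \<le> B" using test_functions_bounded[OF \<eta>(1)] by blast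
    ultimately have det_int: "integrable lborel ?det"
      using integrable_bounded_mult[of "\<lambda>x. M 1 1 x * M 2 2 x - (M 1 2 x)\<^sup>2" "\<eta> n" B]
      by (simp add: mult.commute)
    have "2 * c * (LINT x|lborel. \<eta> n x * S x) = (LINT x|lborel. 2 * (c * (\<eta> n x * S x)))" by simp
    also have "\<dots> \<le> (LINT x|lborel. - 2 * ?det x)"
    proof (rule integral_mono_AE)
      show "AE x in lborel. 2 * (c * (\<eta> n x * S x)) \<le> - 2 * ?det x"
        using det
      proof eventually_elim
        case (elim x)
        then have "\<eta> n x * (M 1 1 x * M 2 2 x - (M 1 2 x)\<^sup>2) \<le> \<eta> n x * (- c * S x)"
          unfolding S_def by (intro mult_left_mono \<eta>(2))
        then show ?case by (simp add: algebra_simps)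
      qed
    qed (use \<eta>S_int det_int in simp_all)
    also have "\<dots> = - (2 * (LINT x|lborel. ?det x))" by simp
    also have "\<dots> = - (LINT x|lborel. \<theta> n x * Q n x)"
      unfolding integral_det_eq_flux[OF \<eta>(1)] flux_eq ..
    \<comment> \<open>Concavity enters here: the full flux of \<open>\<phi> n\<close> has
      nonnegative integral.\<close>
    also have "\<dots> \<le> (LINT x|lborel. Q n x) - (LINT x|lborel. \<theta> n x * Q n x)"
      using flux_concave_nonneg[OF \<phi>(1,3), of n] by (simp add: Q_def)
    also have "\<dots> = (LINT x|lborel. Q n x - \<theta> n x * Q n x)"
      using Q_int \<theta>Q_int by simp
    also have "\<dots> \<le> (LINT x|lborel. (1 - \<theta> n x) * P x)"
    proof (rule integral_mono)
      fix x
      have "(1 - \<theta> n x) * Q n x \<le> (1 - \<theta> n x) * P x"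
        using \<theta>(3)[of n x] QP[of n x] by (intro mult_left_mono) auto
      then show "Q n x - \<theta> n x * Q n x \<le> (1 - \<theta> n x) * P x" by (simp add: algebra_simps)
    qed (use Q_int \<theta>Q_int \<theta>P_int in auto)
    finally show ?thesis .
  qed
  have P0: "P x = 0" if "x \<notin> \<Omega>" for x using L2_onD(2)[OF hessL that] by (simp add: P_def)
  have "(\<lambda>n. LINT x|lborel. (1 - \<theta> n x) * P x) \<longlonglongrightarrow> (LINT x|(lborel :: (real^2) measure). (0::real))"
  proof (rule integral_dominated_convergence[OF _ _ P_int])
    show "AE x in lborel. (\<lambda>n. (1 - \<theta> n x) * P x) \<longlonglongrightarrow> 0"
    proof (rule AE_I2)
      fix x
      show "(\<lambda>n. (1 - \<theta> n x) * P x) \<longlonglongrightarrow> 0"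
      proof (cases "x \<in> \<Omega>")
        case True
        then have "(\<lambda>n. (1 - \<theta> n x) * P x) \<longlonglongrightarrow> (1 - 1) * P x" by (intro tendsto_intros lim)
        then show ?thesis by simp
      qed (simp add: P0)
    qed
    show "AE x in lborel. norm ((1 - \<theta> n x) * P x) \<le> P x" for n
    proof (rule AE_I2)
      fix x
      have "P x \<ge> 0" by (simp add: P_def)
      then show "norm ((1 - \<theta> n x) * P x) \<le> P x"
        using \<theta>(2,3)[of n x] by (simp add: abs_mult mult_left_le_one_le)
    qed
  qed auto
  then have P_lim: "(\<lambda>n. LINT x|lborel. (1 - \<theta> n x) * P x) \<longlonglongrightarrow> 0" by simp
  \<comment> \<open>Countably many measurable sets covering \<open>\<Omega>\<close>, on each of
    which the weights are bounded below from some index on. This replaces a uniform lower bound,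
    which does not exist near the boundary.\<close>
  define E where "E k = {x. \<forall>n\<ge>k. \<eta> n x \<ge> 1 / real (Suc k)}" for k
  have [measurable]: "E k \<in> sets borel" for k unfolding E_def by measurable
  have E0: "AE x in lborel. indicator (E k) x * S x = 0" for k
  proof -
    have iE: "integrable lborel (\<lambda>x. indicat_real (E k) x * S x)"
      using integrable_bounded_mult[OF S_int, of "indicat_real (E k)" 1] by (simp add: mult.commute indicator_def)
    have "(LINT x|lborel. indicat_real (E k) x * S x) \<le> real (Suc k) / (2 * c) * (LINT x|lborel. (1 - \<theta> n x) * P x)"
      if "n \<ge> k" for n
    proof -
      have "(LINT x|lborel. indicat_real (E k) x * S x) \<le> (LINT x|lborel. real (Suc k) * (\<eta> n x * S x))"
      proof (rule integral_mono)
        fix x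
        show "indicat_real (E k) x * S x \<le> real (Suc k) * (\<eta> n x * S x)"
        proof (cases "x \<in> E k")
          case True
          then have "1 \<le> real (Suc k) * \<eta> n x" using that by (simp add: E_def field_simps)
          then have "1 * S x \<le> (real (Suc k) * \<eta> n x) * S x" by (intro mult_right_mono S0)
          then show ?thesis using True by (simp add: mult.assoc)
        qed (use \<eta>(2) S0 in simp)
      qed (use iE \<eta>S_int in auto)
      also have "\<dots> = real (Suc k) / (2 * c) * (2 * c * (LINT x|lborel. \<eta> n x * S x))" using c by simp
      also have "\<dots> \<le> real (Suc k) / (2 * c) * (LINT x|lborel. (1 - \<theta> n x) * P x)"
        using key[of n] c by (intro mult_left_mono) auto
      finally show ?thesis .
    qed
    then have "\<forall>\<^sub>F n in sequentially. (LINT x|lborel. indicat_real (E k) x * S x)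
        \<le> real (Suc k) / (2 * c) * (LINT x|lborel. (1 - \<theta> n x) * P x)"
      by (auto simp: eventually_sequentially)
    then have "(LINT x|lborel. indicat_real (E k) x * S x) \<le> 0"
      by (rule tendsto_lowerbound[OF tendsto_mult_right_zero[OF P_lim]]) simp
    moreover have "(LINT x|lborel. indicat_real (E k) x * S x) \<ge> 0" using S0 by simp
    ultimately have "(LINT x|lborel. indicat_real (E k) x * S x) = 0" by linarith
    then show ?thesis using S0 by (subst (asm) integral_nonneg_eq_0_iff_AE[OF iE]) auto
  qed
  have "\<exists>k. x \<in> E k" if "x \<in> \<Omega>" for x
  proof -
    obtain d N where d: "d > 0" "\<And>n. n \<ge> N \<Longrightarrow> \<eta> n x \<ge> d"
      using lim(2)[OF \<open>x \<in> \<Omega>\<close>] by (auto simp: eventually_sequentially)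
    obtain m where m: "1 / real (Suc m) < d" using reals_Archimedean[OF d(1)] by (auto simp: inverse_eq_divide)
    let ?k = "max m N"
    have "1 / real (Suc ?k) \<le> 1 / real (Suc m)" by (simp add: frac_le)
    then have "x \<in> E ?k" using d(2) m unfolding E_def by (force intro: order_trans)
    then show ?thesis ..
  qed
  moreover have "AE x in lborel. \<forall>k. indicator (E k) x * S x = 0"
    using E0 by (subst AE_all_countable) blast
  ultimately show ?thesis
  proof (elim eventually_mono)
    fix x assume e: "\<And>x. x \<in> \<Omega> \<Longrightarrow> \<exists>k. x \<in> E k" and 0: "\<forall>k. indicator (E k) x * S x = 0"
    show "M 1 1 x = 0 \<and> M 1 2 x = 0 \<and> M 2 2 x = 0"
    proof (cases "x \<in> \<Omega>")
      case True
      then obtain k where "x \<in> E k" using e by blast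
      then have "S x = 0" using 0[rule_format, of k] by simp
      moreover have "(M 1 1 x)\<^sup>2 \<ge> 0" "(M 1 2 x)\<^sup>2 \<ge> 0" "(M 2 2 x)\<^sup>2 \<ge> 0" by auto
      ultimately have "(M 1 1 x)\<^sup>2 = 0 \<and> (M 1 2 x)\<^sup>2 = 0 \<and> (M 2 2 x)\<^sup>2 = 0" unfolding S_def by linarith
      then show ?thesis by simp
    qed (simp add: L2_onD(2)[OF hessL])
  qed
qed

text \<open>If the second derivative vanishes, \<open>p 1\<close> is orthogonal to the first
  derivatives of all \<open>\<psi> n\<close>, hence to their limit, which is \<open>p 1\<close>
  itself. So these derivatives tend to 0, and by the Poincare inequality so does
  \<open>\<psi> n\<close>.\<close>

lemma approximants_tendsto_0:
  assumes "AE x in lborel. M 1 1 x = 0"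
  shows "(\<lambda>n. LINT x|lborel. (\<psi> n x)\<^sup>2) \<longlonglongrightarrow> 0"
proof -
  have d\<psi>: "partial_deriv 1 (\<psi> n) \<in> L2_on \<Omega>" for n
    using test_functions_L2_on[OF test_functions_partial_deriv[OF \<psi>]] .
  have "(LINT x|lborel. partial_deriv 1 (\<psi> n) x * p 1 x) = 0" for n
  proof -
    have "(LINT x|lborel. M 1 1 x * \<psi> n x) = 0"
      using assms by (intro integral_eq_zero_AE) (auto elim: eventually_mono)
    then show ?thesis using by_parts[OF \<psi>[of n], of 1 1] by (simp add: mult.commute)
  qed
  moreover have "(\<lambda>n. LINT x|lborel. partial_deriv 1 (\<psi> n) x * p 1 x) \<longlonglongrightarrow> (LINT x|lborel. p 1 x * p 1 x)"
    by (rule tendsto_integral_mult_L2[OF gradL gradL d\<psi> \<psi>_lim])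
  ultimately have "(LINT x|lborel. (p 1 x)\<^sup>2) = 0" by (simp add: LIMSEQ_const_iff power2_eq_square)
  then have lim: "(\<lambda>n. LINT x|lborel. (partial_deriv 1 (\<psi> n) x)\<^sup>2) \<longlonglongrightarrow> 0"
    using tendsto_integral_square_L2[OF gradL d\<psi> \<psi>_lim] by simp
  obtain C where C: "\<And>n. (LINT x|lborel. (\<psi> n x)\<^sup>2) \<le> C * (LINT x|lborel. (partial_deriv 1 (\<psi> n) x)\<^sup>2)"
    using poincare_test_functions[OF \<Omega>(3), of 1] \<psi> by metis
  show ?thesis
  proof (rule tendsto_sandwich[OF _ _ tendsto_const])
    show "(\<lambda>n. C * (LINT x|lborel. (partial_deriv 1 (\<psi> n) x)\<^sup>2)) \<longlonglongrightarrow> 0"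
      using tendsto_mult_right_zero[OF lim] .
  qed (use C in auto)
qed

end

subsection \<open>Matrices of order two\<close>

lemma quadratic_form_nonneg:
  fixes a d q x y :: real
  assumes "a \<ge> 0" "d \<ge> 0" "q\<^sup>2 \<le> a * d"
  shows "a * x\<^sup>2 + 2 * q * x * y + d * y\<^sup>2 \<ge> 0"
proof -
  have "(2 * q * x * y)\<^sup>2 = 4 * q\<^sup>2 * (x\<^sup>2 * y\<^sup>2)" by (simp add: power_mult_distrib)
  also have "\<dots> \<le> 4 * (a * d) * (x\<^sup>2 * y\<^sup>2)" using assms by (intro mult_right_mono) auto
  also have "\<dots> \<le> (a * x\<^sup>2 + d * y\<^sup>2)\<^sup>2"
    using sum_squares_bound[of "a * x\<^sup>2" "d * y\<^sup>2"] by (simp add: power2_sum power2_eq_square algebra_simps)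
  finally have "\<bar>2 * q * x * y\<bar> \<le> \<bar>a * x\<^sup>2 + d * y\<^sup>2\<bar>" by (simp add: abs_le_square_iff)
  moreover have "a * x\<^sup>2 + d * y\<^sup>2 \<ge> 0" using assms by simp
  ultimately show ?thesis by linarith
qed

lemma inner_matrix_2:
  fixes W M :: "real^2^2"
  shows "W \<bullet> M = W$1$1 * M$1$1 + W$1$2 * M$1$2 + W$2$1 * M$2$1 + W$2$2 * M$2$2"
  by (simp add: inner_matrix_eq_sum sum_2)

text \<open>Symmetric matrices of trace 1 in coordinates centred at half the identity: a lower bound
  on the determinant becomes a disk in the \<open>(a, b)\<close> plane.\<close>

definition ctrl :: "real \<Rightarrow> real \<Rightarrow> real^2^2" where
  "ctrl a b = vector [vector [1/2 + a, b], vector [b, 1/2 - a]]"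

lemma ctrl_nth [simp]: "ctrl a b $ 1 $ 1 = 1/2 + a" "ctrl a b $ 1 $ 2 = b"
    "ctrl a b $ 2 $ 1 = b" "ctrl a b $ 2 $ 2 = 1/2 - a"
  by (simp_all add: ctrl_def)

lemma matrix_2_eqI:
  fixes A B :: "real^2^2"
  assumes "A$1$1 = B$1$1" "A$1$2 = B$1$2" "A$2$1 = B$2$1" "A$2$2 = B$2$2"
  shows "A = B"
  using assms by (simp add: vec_eq_iff forall_2)

lemma det_ctrl: "det (ctrl a b) = 1/4 - (a\<^sup>2 + b\<^sup>2)"
  by (simp add: det_2 power2_eq_square algebra_simps)

lemma inner_ctrl:
  assumes "M$2$1 = M$1$2"
  shows "ctrl a b \<bullet> M = (M$1$1 + M$2$2) / 2 + a * (M$1$1 - M$2$2) + 2 * b * M$1$2"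
  using assms by (simp add: inner_matrix_2 algebra_simps)

lemma abs_le_of_disk:
  fixes a b \<xi> :: real
  assumes "a\<^sup>2 + b\<^sup>2 \<le> 1/4 - \<xi>" "\<xi> \<ge> 0"
  shows "\<bar>a\<bar> \<le> 1/2"
proof -
  have "b\<^sup>2 \<ge> 0" by simp
  then have "a\<^sup>2 \<le> 1/4" using assms by linarith
  also have "1/4 = (1/2 :: real)\<^sup>2" by (simp add: power2_eq_square)
  finally show ?thesis using abs_le_square_iff[of a "1/2"] by simp
qed

lemma control_set_det_eq:
  assumes "\<xi> \<ge> 0"
  shows "control_set_det \<xi> = (\<lambda>(a, b). ctrl a b) ` {(a, b). a\<^sup>2 + b\<^sup>2 \<le> 1/4 - \<xi>}"
proof (intro equalityI subsetI)
  fix W assume W: "W \<in> control_set_det \<xi>"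
  then have s: "W$2$1 = W$1$2" unfolding control_set_det_def control_set_def
    by (metis (mono_tags, lifting) mem_Collect_eq transpose_def vec_lambda_beta)
  have t: "W$2$2 = 1 - W$1$1" using W by (simp add: control_set_det_def control_set_def trace_def sum_2)
  have eq: "W = ctrl (W$1$1 - 1/2) (W$1$2)" by (rule matrix_2_eqI) (simp_all add: s t)
  have "det W \<ge> \<xi>" using W by (simp add: control_set_det_def)
  then have "(W$1$1 - 1/2)\<^sup>2 + (W$1$2)\<^sup>2 \<le> 1/4 - \<xi>"
    by (subst (asm) eq) (simp add: det_ctrl)
  then show "W \<in> (\<lambda>(a, b). ctrl a b) ` {(a, b). a\<^sup>2 + b\<^sup>2 \<le> 1/4 - \<xi>}"
    using eq by (intro image_eqI[of _ _ "(W$1$1 - 1/2, W$1$2)"]) auto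
next
  fix W assume "W \<in> (\<lambda>(a, b). ctrl a b) ` {(a, b). a\<^sup>2 + b\<^sup>2 \<le> 1/4 - \<xi>}"
  then obtain a b where W: "W = ctrl a b" and ab: "a\<^sup>2 + b\<^sup>2 \<le> 1/4 - \<xi>" by auto
  have a: "\<bar>a\<bar> \<le> 1/2" using abs_le_of_disk[OF ab assms] .
  have q: "b\<^sup>2 \<le> (1/2 + a) * (1/2 - a)" using ab assms by (simp add: power2_eq_square algebra_simps)
  have "v \<bullet> (W *v v) \<ge> 0" for v
    using quadratic_form_nonneg[OF _ _ q, of "v$1" "v$2"] a
    by (simp add: W inner_vec_def matrix_vector_mult_def sum_2 power2_eq_square algebra_simps)
  moreover have "W = transpose W" by (rule matrix_2_eqI) (simp_all add: W transpose_def)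
  moreover have "trace W = 1" by (simp add: W trace_def sum_2)
  moreover have "det W \<ge> \<xi>" using ab by (simp add: W det_ctrl)
  ultimately show "W \<in> control_set_det \<xi>" by (simp add: control_set_det_def control_set_def)
qed

text \<open>A nearly optimal control \<open>W\<close> for \<open>A\<close> is also admissible for
  \<open>B\<close>, so \<open>W \<bullet> D < e\<close>; the determinant terms cancel because
  \<open>y\<close> is the same for both. On the disk of radius \<open>sqrt (1/4 - \<xi>)\<close>,
  Cauchy-Schwarz bounds the part of \<open>W \<bullet> D\<close> that varies with \<open>a\<close>
  and \<open>b\<close>.\<close>

lemma trace_le_of_SUP:
  fixes A B :: "real^2^2"
  assumes \<xi>: "0 < \<xi>" "\<xi> \<le> 1/4" and sym: "A$2$1 = A$1$2" "B$2$1 = B$1$2" and y: "y \<ge> 0"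
    and A: "(SUP W\<in>control_set_det \<xi>. - (W \<bullet> A) + 2 * sqrt (det W) * y) = 0"
    and B: "(SUP W\<in>control_set_det \<xi>. - (W \<bullet> B) + 2 * sqrt (det W) * y) = 0"
    and D: "D = A - B"
  shows "(D$1$1 + D$2$2) / 2 \<le> sqrt (1/4 - \<xi>) * sqrt ((D$1$1 - D$2$2)\<^sup>2 + 4 * (D$1$2)\<^sup>2)"
proof (rule field_le_epsilon)
  let ?F = "\<lambda>M W. - (W \<bullet> M) + 2 * sqrt (det W) * y"
  have X: "\<exists>a b. W = ctrl a b \<and> a\<^sup>2 + b\<^sup>2 \<le> 1/4 - \<xi>" if "W \<in> control_set_det \<xi>" for W
    using that control_set_det_eq[of \<xi>] \<xi> by auto
  have ne: "control_set_det \<xi> \<noteq> {}"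
  proof -
    have "ctrl 0 0 \<in> control_set_det \<xi>" using control_set_det_eq[of \<xi>] \<xi> by force
    then show ?thesis by blast
  qed
  \<comment> \<open>The supremum is one of reals, so boundedness must be known before its value says
    anything about single controls.\<close>
  have bdd: "bdd_above (?F M ` control_set_det \<xi>)" if M: "M$2$1 = M$1$2" for M
  proof (rule bdd_aboveI2)
    fix W assume "W \<in> control_set_det \<xi>"
    then obtain a b where W: "W = ctrl a b" and ab: "a\<^sup>2 + b\<^sup>2 \<le> 1/4 - \<xi>" using X by blast
    have "a\<^sup>2 \<ge> 0" "b\<^sup>2 \<ge> 0" by auto
    have "b\<^sup>2 + a\<^sup>2 \<le> 1/4 - \<xi>" using ab by simp
    then have a: "\<bar>a\<bar> \<le> 1" "\<bar>b\<bar> \<le> 1"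
      using abs_le_of_disk[OF ab] abs_le_of_disk[of b a \<xi>] \<xi> by auto
    have "\<bar>a * (M$1$1 - M$2$2)\<bar> \<le> 1 * \<bar>M$1$1 - M$2$2\<bar>" "\<bar>b * M$1$2\<bar> \<le> 1 * \<bar>M$1$2\<bar>"
      unfolding abs_mult using a by (auto intro: mult_left_le_one_le)
    moreover have "sqrt (det W) \<le> sqrt 1" unfolding W det_ctrl
      using \<open>a\<^sup>2 \<ge> 0\<close> \<open>b\<^sup>2 \<ge> 0\<close> by (intro real_sqrt_le_mono) linarith
    then have "sqrt (det W) * y \<le> 1 * y" using y by (intro mult_right_mono) auto
    ultimately show "?F M W \<le> - (M$1$1 + M$2$2) / 2 + \<bar>M$1$1 - M$2$2\<bar> + 2 * \<bar>M$1$2\<bar> + 2 * y"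
      using inner_ctrl[OF M, of a b] abs_ge_minus_self[of "a * (M$1$1 - M$2$2)"]
        abs_ge_minus_self[of "b * M$1$2"] unfolding W by argo
  qed
  fix e :: real assume "e > 0"
  then have "- e < (SUP W\<in>control_set_det \<xi>. ?F A W)" using A by simp
  then obtain W where W: "W \<in> control_set_det \<xi>" "- e < ?F A W"
    using less_cSUP_iff[OF ne bdd[OF sym(1)]] by blast
  have "?F B W \<le> 0" using cSUP_upper[OF W(1) bdd[OF sym(2)]] B by simp
  then have "W \<bullet> D < e" using W(2) by (simp add: D inner_diff_right)
  obtain a b where Wab: "W = ctrl a b" and ab: "a\<^sup>2 + b\<^sup>2 \<le> 1/4 - \<xi>" using X[OF W(1)] by blast
  let ?T = "sqrt ((D$1$1 - D$2$2)\<^sup>2 + 4 * (D$1$2)\<^sup>2)"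
  have "- (a * (D$1$1 - D$2$2) + 2 * b * D$1$2) \<le> sqrt (a\<^sup>2 + b\<^sup>2) * ?T"
  proof -
    have "(a * (D$1$1 - D$2$2) + b * (2 * D$1$2))\<^sup>2 \<le> (a\<^sup>2 + b\<^sup>2) * ((D$1$1 - D$2$2)\<^sup>2 + (2 * D$1$2)\<^sup>2)"
      using zero_le_power2[of "a * (2 * D$1$2) - b * (D$1$1 - D$2$2)"]
      by (simp add: power2_eq_square algebra_simps)
    then have "sqrt ((a * (D$1$1 - D$2$2) + b * (2 * D$1$2))\<^sup>2) \<le> sqrt ((a\<^sup>2 + b\<^sup>2) * ((D$1$1 - D$2$2)\<^sup>2 + (2 * D$1$2)\<^sup>2))"
      by (rule real_sqrt_le_mono)
    then show ?thesis by (simp add: real_sqrt_mult power_mult_distrib mult.assoc mult.left_commute)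
  qed
  also have "\<dots> \<le> sqrt (1/4 - \<xi>) * ?T" using ab by (intro mult_right_mono) auto
  finally have "(D$1$1 + D$2$2) / 2 - sqrt (1/4 - \<xi>) * ?T \<le> W \<bullet> D"
    unfolding Wab using inner_ctrl[of D a b] sym by (simp add: D)
  then show "(D$1$1 + D$2$2) / 2 \<le> sqrt (1/4 - \<xi>) * ?T + e" using \<open>W \<bullet> D < e\<close> by linarith
qed

text \<open>The Cordes-type estimate; the point is that \<open>D\<close> is orthogonal to a uniformly positive definite matrix.\<close>

lemma det_diff_of_SUP:
  fixes A B :: "real^2^2"
  assumes \<xi>: "0 < \<xi>" "\<xi> \<le> 1/4" and sym: "A$2$1 = A$1$2" "B$2$1 = B$1$2" and y: "y \<ge> 0"
    and A: "(SUP W\<in>control_set_det \<xi>. - (W \<bullet> A) + 2 * sqrt (det W) * y) = 0"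
    and B: "(SUP W\<in>control_set_det \<xi>. - (W \<bullet> B) + 2 * sqrt (det W) * y) = 0"
    and D: "D = A - B"
  shows "D$1$1 * D$2$2 - (D$1$2)\<^sup>2 \<le> - (1 / (1 / \<xi> + 2)) * ((D$1$1)\<^sup>2 + (D$1$2)\<^sup>2 + (D$2$2)\<^sup>2)"
proof -
  let ?T2 = "(D$1$1 - D$2$2)\<^sup>2 + 4 * (D$1$2)\<^sup>2" and ?t = "D$1$1 + D$2$2"
  define e where "e = (D$1$2)\<^sup>2 - D$1$1 * D$2$2"
  have le: "?t / 2 \<le> sqrt (1/4 - \<xi>) * sqrt ?T2" by (rule trace_le_of_SUP[OF \<xi> sym y A B D])
  \<comment> \<open>Exchanging \<open>A\<close> and \<open>B\<close> yields the opposite sign, hence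
    a bound on the absolute value of the trace.\<close>
  have "- ?t / 2 \<le> sqrt (1/4 - \<xi>) * sqrt ?T2"
  proof -
    have "((- D)$1$1 + (- D)$2$2) / 2 \<le> sqrt (1/4 - \<xi>) * sqrt (((- D)$1$1 - (- D)$2$2)\<^sup>2 + 4 * ((- D)$1$2)\<^sup>2)"
      by (rule trace_le_of_SUP[OF \<xi> sym(2,1) y B A]) (simp add: D)
    moreover have "(D$2$2 - D$1$1)\<^sup>2 = (D$1$1 - D$2$2)\<^sup>2" by (rule power2_commute)
    ultimately show ?thesis by (simp add: algebra_simps)
  qed
  with le have "\<bar>?t / 2\<bar> \<le> sqrt (1/4 - \<xi>) * sqrt ?T2" by linarith
  then have "(?t / 2)\<^sup>2 \<le> (sqrt (1/4 - \<xi>) * sqrt ?T2)\<^sup>2" by (metis abs_ge_zero power2_abs power_mono)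
  also have "\<dots> = (1/4 - \<xi>) * ?T2" using \<xi> by (simp add: power_mult_distrib)
  finally have 1: "(?t / 2)\<^sup>2 \<le> (1/4 - \<xi>) * ?T2" .
  \<comment> \<open>\<open>?T2\<close> is the squared difference of the eigenvalues of
    \<open>D\<close>, and \<open>e\<close> is minus its determinant.\<close>
  have 2: "?T2 = ?t\<^sup>2 + 4 * e" by (simp add: e_def power2_eq_square algebra_simps)
  have 3: "\<xi> * ?t\<^sup>2 \<le> (1 - 4 * \<xi>) * e" using 1 unfolding 2 by (simp add: power_divide algebra_simps)
  have e0: "e \<ge> 0"
  \<comment> \<open>At \<open>\<xi> = 1/4\<close> the factor of \<open>e\<close> in the preceding
    inequality vanishes and gives no sign. There the trace of \<open>D\<close> is 0 and
    \<open>e\<close> is visibly a sum of squares.\<close>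
  proof (cases "\<xi> = 1/4")
    case True
    have "1/4 * ?t\<^sup>2 \<le> 0" using 3 unfolding True by simp
    then have "?t = 0" by simp
    then have "D$2$2 = - D$1$1" by simp
    then show ?thesis by (simp add: e_def)
  next
    case False
    have "0 \<le> \<xi> * ?t\<^sup>2" using \<xi> by simp
    with 3 have "0 \<le> (1 - 4 * \<xi>) * e" by linarith
    then show ?thesis using False \<xi> by (simp add: zero_le_mult_iff)
  qed
  have "\<xi> * ?t\<^sup>2 \<le> e" using 3 mult_right_mono[OF _ e0, of "1 - 4 * \<xi>" 1] \<xi> by simp
  then have 4: "?t\<^sup>2 \<le> e / \<xi>" using \<xi> by (simp add: field_simps)
  have "(D$1$1)\<^sup>2 + (D$1$2)\<^sup>2 + (D$2$2)\<^sup>2 \<le> ?t\<^sup>2 + 2 * e"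
    by (simp add: e_def power2_eq_square algebra_simps)
  also have "\<dots> \<le> (1 / \<xi> + 2) * e" using 4 by (simp add: algebra_simps)
  finally have "(D$1$1)\<^sup>2 + (D$1$2)\<^sup>2 + (D$2$2)\<^sup>2 \<le> (1 / \<xi> + 2) * e" .
  moreover have "1 / \<xi> + 2 > 0" using \<xi> by (simp add: add_pos_pos)
  ultimately have "((D$1$1)\<^sup>2 + (D$1$2)\<^sup>2 + (D$2$2)\<^sup>2) / (1 / \<xi> + 2) \<le> e"
    by (simp add: pos_divide_le_eq mult.commute)
  then show ?thesis by (simp add: e_def)
qed

text \<open>The arithmetic-geometric mean inequality for the trace of a product of two positive
  matrices. Writing \<open>B = A * b\<close> and \<open>D = A * (b\<^sup>2 + g)\<close>, an LDL
  factorization, turns the trace into \<open>A * (h + d * g)\<close>. Completing the square gives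
  \<open>a * d - q\<^sup>2 \<le> d * h\<close>, and the scalar inequality finishes.\<close>

lemma inner_ge_det:
  fixes a d q A B D f :: real
  assumes "a \<ge> 0" "d \<ge> 0" "q\<^sup>2 \<le> a * d" "A > 0" "D > 0" and f: "A * D - B\<^sup>2 = f" "f \<ge> 0"
  shows "2 * sqrt (a * d - q\<^sup>2) * sqrt f \<le> a * A + 2 * q * B + d * D"
proof -
  define b where "b = B / A"
  define g where "g = f / A\<^sup>2"
  define h where "h = a + 2 * q * b + d * b\<^sup>2"
  have B: "B = A * b" using assms by (simp add: b_def)
  have fg: "f = A\<^sup>2 * g" using assms by (simp add: g_def)
  have "A * D = A * (A * (b\<^sup>2 + g))"
    using f fg unfolding B by (simp add: power2_eq_square algebra_simps)
  then have Dg: "D = A * (b\<^sup>2 + g)" using assms(4) by (metis less_irrefl mult_left_cancel)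
  have g: "g \<ge> 0" using assms by (simp add: g_def)
  have h0: "h \<ge> 0" using quadratic_form_nonneg[OF assms(1-3), of 1 b] by (simp add: h_def)
  have "d * h = a * d - q\<^sup>2 + (q + d * b)\<^sup>2" by (simp add: h_def power2_eq_square algebra_simps)
  then have dh: "a * d - q\<^sup>2 \<le> d * h" by simp
  have "(2 * sqrt (a * d - q\<^sup>2) * sqrt f)\<^sup>2 = 4 * (a * d - q\<^sup>2) * f"
    using assms by (simp add: power_mult_distrib)
  also have "\<dots> \<le> 4 * (d * h) * f" using dh f by (intro mult_right_mono) auto
  also have "\<dots> = A\<^sup>2 * (4 * h * (d * g))" unfolding fg by (simp add: algebra_simps)
  also have "\<dots> \<le> A\<^sup>2 * (h + d * g)\<^sup>2"
    using sum_squares_bound[of h "d * g"] by (intro mult_left_mono) (auto simp: power2_sum algebra_simps)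
  also have "\<dots> = (a * A + 2 * q * B + d * D)\<^sup>2"
    unfolding B Dg h_def by (simp add: power2_eq_square algebra_simps)
  finally have "(2 * sqrt (a * d - q\<^sup>2) * sqrt f)\<^sup>2 \<le> (a * A + 2 * q * B + d * D)\<^sup>2" .
  moreover have "a * A + 2 * q * B + d * D = A * (h + d * g)"
    unfolding B Dg h_def by (simp add: power2_eq_square algebra_simps)
  then have "a * A + 2 * q * B + d * D \<ge> 0" using assms h0 g by simp
  ultimately show ?thesis by (rule power2_le_imp_le)
qed

text \<open>The maximizer is the cofactor matrix of \<open>M\<close> divided by its trace.\<close>

lemma SUP_eq_0_of_det:
  fixes M :: "real^2^2"
  assumes sym: "M$2$1 = M$1$2" and pos: "M$1$1 > 0" "M$2$2 > 0" and det: "det M = f" "f > 0"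
    and \<xi>: "0 < \<xi>" "\<xi> * (M$1$1 + M$2$2)\<^sup>2 \<le> f"
  shows "(SUP W\<in>control_set_det \<xi>. - (W \<bullet> M) + 2 * sqrt (det W) * sqrt f) = 0"
proof (rule cSup_eq_maximum)
  let ?t = "M$1$1 + M$2$2"
  have t: "?t > 0" using pos by simp
  have f: "f = M$1$1 * M$2$2 - (M$1$2)\<^sup>2" using det sym by (simp add: det_2 power2_eq_square)
  let ?W = "ctrl (M$2$2 / ?t - 1/2) (- M$1$2 / ?t)"
  have dW: "det ?W = f / ?t\<^sup>2"
  proof -
    have "1 - M$2$2 / ?t = M$1$1 / ?t" using t by (simp add: field_simps)
    moreover have "det (ctrl (X - 1/2) Y) = X * (1 - X) - Y\<^sup>2" for X Y
      by (simp add: det_ctrl power2_eq_square algebra_simps)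
    ultimately have "det ?W = (M$2$2 / ?t) * (M$1$1 / ?t) - (- M$1$2 / ?t)\<^sup>2" by simp
    then show ?thesis unfolding f by (simp add: power2_eq_square diff_divide_distrib mult.commute)
  qed
  \<comment> \<open>The hypothesis on \<open>\<xi>\<close> says precisely that the maximizer is
    admissible.\<close>
  have "\<xi> \<le> f / ?t\<^sup>2" using \<xi> t by (simp add: pos_le_divide_eq)
  then have "(M$2$2 / ?t - 1/2)\<^sup>2 + (- M$1$2 / ?t)\<^sup>2 \<le> 1/4 - \<xi>" using dW by (simp add: det_ctrl)
  then have W: "?W \<in> control_set_det \<xi>" using control_set_det_eq[of \<xi>] \<xi> by force
  have "?W \<bullet> M = 2 * f / ?t"
  proof -
    have "(u / 2 + (X - 1/2) * v + 2 * Y * w) * u = u * u / 2 + (X * u - u / 2) * v + 2 * (Y * u) * w"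
      for u v w X Y :: real by (simp add: algebra_simps)
    then have "(?W \<bullet> M) * ?t = ?t * ?t / 2 + (M$2$2 / ?t * ?t - ?t / 2) * (M$1$1 - M$2$2) + 2 * (- M$1$2 / ?t * ?t) * M$1$2"
      unfolding inner_ctrl[OF sym] by blast
    also have "\<dots> = ?t * ?t / 2 + (M$2$2 - ?t / 2) * (M$1$1 - M$2$2) + 2 * (- M$1$2) * M$1$2"
      using t by simp
    also have "\<dots> = 2 * f" unfolding f by (simp add: power2_eq_square field_simps)
    finally show ?thesis using t by (simp add: eq_divide_eq)
  qed
  moreover have "2 * sqrt (det ?W) * sqrt f = 2 * f / ?t"
    unfolding dW using t det by (simp add: real_sqrt_divide)
  ultimately have "- (?W \<bullet> M) + 2 * sqrt (det ?W) * sqrt f = 0" by simp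
  then show "0 \<in> (\<lambda>W. - (W \<bullet> M) + 2 * sqrt (det W) * sqrt f) ` control_set_det \<xi>"
    by (intro image_eqI[OF _ W]) simp
  fix z assume "z \<in> (\<lambda>W. - (W \<bullet> M) + 2 * sqrt (det W) * sqrt f) ` control_set_det \<xi>"
  then obtain a b where z: "z = - (ctrl a b \<bullet> M) + 2 * sqrt (det (ctrl a b)) * sqrt f"
    and ab: "a\<^sup>2 + b\<^sup>2 \<le> 1/4 - \<xi>"
    using control_set_det_eq[of \<xi>] \<xi> by auto
  have a: "\<bar>a\<bar> \<le> 1/2" using abs_le_of_disk[OF ab] \<xi> by simp
  have dd: "(1/2 + a) * (1/2 - a) - b\<^sup>2 = det (ctrl a b)" by (simp add: det_ctrl power2_eq_square algebra_simps)
  have "b\<^sup>2 \<le> (1/2 + a) * (1/2 - a)" using ab \<xi> by (simp add: power2_eq_square algebra_simps)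
  then have "2 * sqrt (det (ctrl a b)) * sqrt f \<le> (1/2 + a) * M$1$1 + 2 * b * M$1$2 + (1/2 - a) * M$2$2"
    using inner_ge_det[of "1/2 + a" "1/2 - a" b "M$1$1" "M$2$2" "M$1$2" f] a pos det f unfolding dd by simp
  then show "z \<le> 0" unfolding z inner_ctrl[OF sym] by (simp add: algebra_simps add_divide_distrib)
qed

subsection \<open>The Bellman and the Monge--Ampere problem\<close>

lemma L2_on_representative:
  fixes v :: "real^'n::finite \<Rightarrow> real"
  assumes v: "v \<in> Lp_space 2 \<Omega>" and \<Omega>: "open \<Omega>"
  obtains w where "w \<in> L2_on \<Omega>" "AE x in lebesgue_on \<Omega>. v x = w x"
proof -
  have vm: "v \<in> borel_measurable (lebesgue_on \<Omega>)" and v2: "integrable (lebesgue_on \<Omega>) (\<lambda>x. (v x)\<^sup>2)"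
    using v by (auto simp: Lp_space_2_iff)
  have \<Omega>b: "\<Omega> \<in> sets borel" using \<Omega> by auto
  obtain w where w: "w \<in> borel_measurable borel" "\<And>x. x \<notin> \<Omega> \<Longrightarrow> w x = 0" "AE x in lebesgue_on \<Omega>. v x = w x"
    using borel_representative[OF vm \<Omega>b] by metis
  have w2: "(\<lambda>x. (w x)\<^sup>2) \<in> borel_measurable borel" using w(1) by measurable
  have "integrable (lebesgue_on \<Omega>) (\<lambda>x. (w x)\<^sup>2) \<longleftrightarrow> integrable (lebesgue_on \<Omega>) (\<lambda>x. (v x)\<^sup>2)"
  proof (rule integrable_cong_AE)
    show "(\<lambda>x. (w x)\<^sup>2) \<in> borel_measurable (lebesgue_on \<Omega>)" using w2 by (rule measurable_lebesgue_on_borel)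
    show "(\<lambda>x. (v x)\<^sup>2) \<in> borel_measurable (lebesgue_on \<Omega>)" using vm by measurable
    show "AE x in lebesgue_on \<Omega>. (w x)\<^sup>2 = (v x)\<^sup>2" using w(3) by eventually_elim simp
  qed
  then have "integrable lborel (\<lambda>x. (w x)\<^sup>2)"
    using v2 lebesgue_on_borel(2)[OF w2 \<Omega>b] w(2) by simp
  then show ?thesis using that w by (auto simp: L2_on_def)
qed

lemma integral_representative:
  fixes v w h :: "real^'n::finite \<Rightarrow> real"
  assumes "w \<in> L2_on \<Omega>" "AE x in lebesgue_on \<Omega>. v x = w x" "open \<Omega>"
    "v \<in> borel_measurable (lebesgue_on \<Omega>)" "h \<in> borel_measurable borel"
  shows "(LINT x|lborel. w x * h x) = (LINT x|lebesgue_on \<Omega>. v x * h x)"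
proof -
  have wh: "(\<lambda>x. w x * h x) \<in> borel_measurable borel" using assms L2_onD(1) by measurable
  have "(LINT x|lborel. w x * h x) = (LINT x|lebesgue_on \<Omega>. w x * h x)"
    by (rule lebesgue_on_borel(1)[symmetric, OF wh]) (use assms L2_onD(2) in auto)
  also have "\<dots> = (LINT x|lebesgue_on \<Omega>. v x * h x)"
  proof (rule integral_cong_AE)
    show "(\<lambda>x. w x * h x) \<in> borel_measurable (lebesgue_on \<Omega>)" using wh by (rule measurable_lebesgue_on_borel)
    show "(\<lambda>x. v x * h x) \<in> borel_measurable (lebesgue_on \<Omega>)"
      using assms(4) measurable_lebesgue_on_borel[OF assms(5)] by (rule borel_measurable_times)
    show "AE x in lebesgue_on \<Omega>. w x * h x = v x * h x" using assms(2) by eventually_elim simp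
  qed
  finally show ?thesis .
qed

lemma Lp_space_2_diff:
  assumes "v \<in> Lp_space 2 \<Omega>" "w \<in> Lp_space 2 \<Omega>"
  shows "(\<lambda>x. v x - w x) \<in> Lp_space 2 \<Omega>"
proof -
  have [measurable]: "v \<in> borel_measurable (lebesgue_on \<Omega>)" "w \<in> borel_measurable (lebesgue_on \<Omega>)"
    and i: "integrable (lebesgue_on \<Omega>) (\<lambda>x. (v x)\<^sup>2)" "integrable (lebesgue_on \<Omega>) (\<lambda>x. (w x)\<^sup>2)"
    using assms by (auto simp: Lp_space_2_iff)
  have "integrable (lebesgue_on \<Omega>) (\<lambda>x. (v x)\<^sup>2 + (w x)\<^sup>2 - 2 * (v x * w x))"
    using i integrable_square_mult[of v "lebesgue_on \<Omega>" w] by simp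
  then show ?thesis by (simp add: Lp_space_2_iff power2_diff mult.assoc)
qed

lemma test_functions_Lp_space_2:
  assumes "\<phi> \<in> test_functions \<Omega>" "open \<Omega>"
  shows "\<phi> \<in> Lp_space 2 \<Omega>"
proof -
  note L = L2_onD[OF test_functions_L2_on[OF assms(1)]]
  have "(\<lambda>x. (\<phi> x)\<^sup>2) \<in> borel_measurable borel" using L(1) by measurable
  then have "integrable (lebesgue_on \<Omega>) (\<lambda>x. (\<phi> x)\<^sup>2)"
    using lebesgue_on_borel(2)[of "\<lambda>x. (\<phi> x)\<^sup>2" \<Omega>] L assms(2) by simp
  then show ?thesis using measurable_lebesgue_on_borel[OF L(1)] by (simp add: Lp_space_2_iff)
qed

lemma integral_square_diff_le:
  assumes a: "a \<in> Lp_space 2 \<Omega>" and b: "b \<in> Lp_space 2 \<Omega>"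
  shows "(LINT x|lebesgue_on \<Omega>. (a x - b x)\<^sup>2) \<le>
    2 * (LINT x|lebesgue_on \<Omega>. (a x)\<^sup>2) + 2 * (LINT x|lebesgue_on \<Omega>. (b x)\<^sup>2)"
proof -
  have i: "integrable (lebesgue_on \<Omega>) (\<lambda>x. (a x)\<^sup>2)" "integrable (lebesgue_on \<Omega>) (\<lambda>x. (b x)\<^sup>2)"
    "integrable (lebesgue_on \<Omega>) (\<lambda>x. (a x - b x)\<^sup>2)"
    using a b Lp_space_2_diff[OF a b] by (simp_all add: Lp_space_2_iff)
  have "(LINT x|lebesgue_on \<Omega>. (a x - b x)\<^sup>2) \<le> (LINT x|lebesgue_on \<Omega>. 2 * (a x)\<^sup>2 + 2 * (b x)\<^sup>2)"
  proof (rule integral_mono)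
    fix x
    show "(a x - b x)\<^sup>2 \<le> 2 * (a x)\<^sup>2 + 2 * (b x)\<^sup>2"
      using zero_le_power2[of "a x + b x"] unfolding power2_sum power2_diff by linarith
  qed (use i in auto)
  then show ?thesis using i by simp
qed

lemma tendsto_integral_square_diff:
  assumes a: "\<And>n. a n \<in> Lp_space 2 \<Omega>" and b: "\<And>n. b n \<in> Lp_space 2 \<Omega>"
    and lim: "(\<lambda>n. LINT x|lebesgue_on \<Omega>. (a n x)\<^sup>2) \<longlonglongrightarrow> 0" "(\<lambda>n. LINT x|lebesgue_on \<Omega>. (b n x)\<^sup>2) \<longlonglongrightarrow> 0"
  shows "(\<lambda>n. LINT x|lebesgue_on \<Omega>. (a n x - b n x)\<^sup>2) \<longlonglongrightarrow> 0"
proof (rule tendsto_sandwich[OF _ _ tendsto_const])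
  have "(\<lambda>n. 2 * (LINT x|lebesgue_on \<Omega>. (a n x)\<^sup>2) + 2 * (LINT x|lebesgue_on \<Omega>. (b n x)\<^sup>2)) \<longlonglongrightarrow> 2 * 0 + 2 * 0"
    by (intro tendsto_intros lim)
  then show "(\<lambda>n. 2 * (LINT x|lebesgue_on \<Omega>. (a n x)\<^sup>2) + 2 * (LINT x|lebesgue_on \<Omega>. (b n x)\<^sup>2)) \<longlonglongrightarrow> 0" by simp
qed (use integral_square_diff_le[OF a b] in auto)

lemma sobolev_space_locally_integrable:
  assumes "u \<in> sobolev_space k p \<Omega>" shows "locally_integrable \<Omega> u"
proof -
  have "\<exists>v\<in>Lp_space p \<Omega>. has_weak_deriv \<Omega> [] u v" using assms by (simp add: sobolev_space_def)
  then show ?thesis by (auto simp: has_weak_deriv_def)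
qed

lemma has_weak_deriv_eq:
  assumes "has_weak_deriv \<Omega> \<alpha> u v" "\<phi> \<in> test_functions \<Omega>"
  shows "(LINT x|lebesgue_on \<Omega>. u x * partial_derivs \<alpha> \<phi> x) = (-1) ^ length \<alpha> * (LINT x|lebesgue_on \<Omega>. v x * \<phi> x)"
  using assms by (simp add: has_weak_deriv_def)

text \<open>The difference \<open>v - u\<close> is that of \<open>v - g\<close> and
  \<open>u - g\<close>, both limits of test functions, so the differences of the two approximating
  sequences serve as \<open>\<psi>\<close> in the planar locale.\<close>

lemma eq_of_det_hessian_diff:
  fixes \<Omega> :: "(real^2) set"
  assumes \<Omega>: "open \<Omega>" "\<Omega> \<noteq> {}" "bounded \<Omega>" "convex \<Omega>"
    and u: "u \<in> sobolev_space 2 2 \<Omega>" and v: "v \<in> sobolev_space 2 2 \<Omega>" and g: "g \<in> sobolev_space 2 2 \<Omega>"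
    and ug: "equal_on_boundary \<Omega> u g" and vg: "equal_on_boundary \<Omega> v g" and c: "c > 0"
    and det: "AE x in lebesgue_on \<Omega>. \<forall>D. D = weak_hessian \<Omega> v x - weak_hessian \<Omega> u x \<longrightarrow>
      D$1$1 * D$2$2 - (D$1$2)\<^sup>2 \<le> - c * ((D$1$1)\<^sup>2 + (D$1$2)\<^sup>2 + (D$2$2)\<^sup>2)"
  shows "AE x in lebesgue_on \<Omega>. v x = u x"
proof -
  have \<Omega>b: "\<Omega> \<in> sets borel" using \<Omega>(1) by auto
  let ?wu = "\<lambda>x. u x - g x" and ?wv = "\<lambda>x. v x - g x"
  have H: "?wu \<in> H10_space \<Omega>" "?wv \<in> H10_space \<Omega>" using ug vg by (simp_all add: equal_on_boundary_def)
  have W1: "?wu \<in> sobolev_space 1 2 \<Omega>" "?wv \<in> sobolev_space 1 2 \<Omega>" using H by (simp_all add: H10_space_def)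
  obtain \<phi>u :: "nat \<Rightarrow> real^2 \<Rightarrow> real" where \<phi>u: "\<And>n. \<phi>u n \<in> test_functions \<Omega>"
    "(\<lambda>n. LINT x|lebesgue_on \<Omega>. (?wu x - \<phi>u n x)\<^sup>2) \<longlonglongrightarrow> 0"
    "\<And>i. (\<lambda>n. LINT x|lebesgue_on \<Omega>. (weak_deriv \<Omega> [i] ?wu x - partial_deriv i (\<phi>u n) x)\<^sup>2) \<longlonglongrightarrow> 0"
    using H(1) unfolding H10_space_def by blast
  obtain \<phi>v :: "nat \<Rightarrow> real^2 \<Rightarrow> real" where \<phi>v: "\<And>n. \<phi>v n \<in> test_functions \<Omega>"
    "(\<lambda>n. LINT x|lebesgue_on \<Omega>. (?wv x - \<phi>v n x)\<^sup>2) \<longlonglongrightarrow> 0"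
    "\<And>i. (\<lambda>n. LINT x|lebesgue_on \<Omega>. (weak_deriv \<Omega> [i] ?wv x - partial_deriv i (\<phi>v n) x)\<^sup>2) \<longlonglongrightarrow> 0"
    using H(2) unfolding H10_space_def by blast
  define \<psi> where "\<psi> n x = \<phi>v n x - \<phi>u n x" for n x
  have \<psi>: "\<psi> n \<in> test_functions \<Omega>" for n unfolding \<psi>_def by (rule test_functions_diff[OF \<phi>v(1) \<phi>u(1)])
  have \<psi>d: "partial_deriv i (\<psi> n) x = partial_deriv i (\<phi>v n) x - partial_deriv i (\<phi>u n) x" for i n x
  proof -
    have sm: "smooth (\<phi>u n)" "smooth (\<phi>v n)" using \<phi>u(1) \<phi>v(1) test_functionsD(1) by blast+
    have "partial_deriv i (\<lambda>x. \<phi>v n x + (-1) * \<phi>u n x) x = partial_deriv i (\<phi>v n) x + partial_deriv i (\<lambda>x. (-1) * \<phi>u n x) x"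
      by (intro partial_deriv_add smooth_differentiable smooth_cmult sm)
    also have "partial_deriv i (\<lambda>x. (-1) * \<phi>u n x) x = - partial_deriv i (\<phi>u n) x"
      by (subst partial_deriv_mult) (auto simp: partial_deriv_const intro: smooth_differentiable sm)
    finally show ?thesis by (simp add: \<psi>_def[abs_def])
  qed
  \<comment> \<open>The gradient is taken from \<open>v - g\<close> and \<open>u - g\<close>, since
    the approximants converge to the selected derivatives of these functions. In
    \<open>by_parts\<close> the boundary datum cancels against test functions, so the Hessian can be
    that of \<open>v\<close> and \<open>u\<close>.\<close>
  define P where "P i x = weak_deriv \<Omega> [i] ?wv x - weak_deriv \<Omega> [i] ?wu x" for i x
  define D where "D i j x = weak_deriv \<Omega> [i, j] v x - weak_deriv \<Omega> [i, j] u x" for i j x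
  have PwL: "weak_deriv \<Omega> [i] ?wv \<in> Lp_space 2 \<Omega>" "weak_deriv \<Omega> [i] ?wu \<in> Lp_space 2 \<Omega>" for i
    using sobolev_space_weak_deriv(2)[OF \<Omega>(1) W1(2), of "[i]"] sobolev_space_weak_deriv(2)[OF \<Omega>(1) W1(1), of "[i]"] by auto
  have PL: "P i \<in> Lp_space 2 \<Omega>" for i unfolding P_def by (rule Lp_space_2_diff[OF PwL])
  have DL: "D i j \<in> Lp_space 2 \<Omega>" for i j
    unfolding D_def by (intro Lp_space_2_diff sobolev_space_weak_deriv(2)[OF \<Omega>(1) v] sobolev_space_weak_deriv(2)[OF \<Omega>(1) u]) simp_all
  have Pm: "P i \<in> borel_measurable (lebesgue_on \<Omega>)" and Dm: "D i j \<in> borel_measurable (lebesgue_on \<Omega>)" for i j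
    using PL DL by (auto simp: Lp_space_2_iff)
  have "\<exists>w. w \<in> L2_on \<Omega> \<and> (AE x in lebesgue_on \<Omega>. P i x = w x)" for i
    using L2_on_representative[OF PL \<Omega>(1)] by metis
  then obtain p where p: "\<And>i. p i \<in> L2_on \<Omega>" "\<And>i. AE x in lebesgue_on \<Omega>. P i x = p i x" by metis
  have "\<exists>w. w \<in> L2_on \<Omega> \<and> (AE x in lebesgue_on \<Omega>. D i j x = w x)" for i j
    using L2_on_representative[OF DL \<Omega>(1)] by metis
  then obtain N where N: "\<And>i j. N i j \<in> L2_on \<Omega>" "\<And>i j. AE x in lebesgue_on \<Omega>. D i j x = N i j x" by metis
  \<comment> \<open>The mixed entries of the Hessian agree only almost everywhere, but the locale
    asks for equality of functions; one off-diagonal entry is copied to the other place.\<close>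
  define M :: "2 \<Rightarrow> 2 \<Rightarrow> real^2 \<Rightarrow> real" where "M i j = (if i = 2 \<and> j = 1 then N 1 2 else N i j)" for i j
  have ML2: "M i j \<in> L2_on \<Omega>" for i j using N(1) by (simp add: M_def)
  have D_sym: "AE x in lebesgue_on \<Omega>. D 2 1 x = D 1 2 x"
    using weak_hessian_symmetric[OF \<Omega>(1) v, of 2 1] weak_hessian_symmetric[OF \<Omega>(1) u, of 2 1]
    by eventually_elim (simp add: D_def)
  have DM: "AE x in lebesgue_on \<Omega>. D i j x = M i j x" for i j
  proof (cases "i = 2 \<and> j = 1")
    case True
    show ?thesis using D_sym N(2)[of 1 2] by eventually_elim (simp add: True M_def)
  next
    case False
    then show ?thesis using N(2)[of i j] by (auto simp: M_def)
  qed
  have li: "locally_integrable \<Omega> u" "locally_integrable \<Omega> v" "locally_integrable \<Omega> g"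
    using u v g sobolev_space_locally_integrable by blast+
  have by_parts: "(LINT x|lborel. p i x * partial_deriv j \<zeta> x) = - (LINT x|lborel. M i j x * \<zeta> x)"
    if \<zeta>: "\<zeta> \<in> test_functions \<Omega>" for i j \<zeta>
  proof -
    let ?I = "\<lambda>f. LINT x|lebesgue_on \<Omega>. f x"
    let ?z = "partial_deriv i (partial_deriv j \<zeta>)"
    note \<zeta>1 = test_functions_partial_deriv[OF \<zeta>, of j]
    note \<zeta>2 = test_functions_partial_deriv[OF \<zeta>1, of i]
    have \<zeta>m: "\<zeta> \<in> borel_measurable borel" "partial_deriv j \<zeta> \<in> borel_measurable borel"
      using \<zeta> \<zeta>1 test_functions_measurable by blast+
    have hw: "has_weak_deriv \<Omega> [i] ?wv (weak_deriv \<Omega> [i] ?wv)" "has_weak_deriv \<Omega> [i] ?wu (weak_deriv \<Omega> [i] ?wu)"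
      using sobolev_space_weak_deriv(1)[OF \<Omega>(1) W1(2), of "[i]"] sobolev_space_weak_deriv(1)[OF \<Omega>(1) W1(1), of "[i]"] by auto
    have hh: "has_weak_deriv \<Omega> [i, j] v (weak_deriv \<Omega> [i, j] v)" "has_weak_deriv \<Omega> [i, j] u (weak_deriv \<Omega> [i, j] u)"
      using sobolev_space_weak_deriv(1)[OF \<Omega>(1) v, of "[i, j]"] sobolev_space_weak_deriv(1)[OF \<Omega>(1) u, of "[i, j]"] by auto
    have iw: "integrable (lebesgue_on \<Omega>) (\<lambda>x. weak_deriv \<Omega> [i] ?wv x * partial_deriv j \<zeta> x)"
      "integrable (lebesgue_on \<Omega>) (\<lambda>x. weak_deriv \<Omega> [i] ?wu x * partial_deriv j \<zeta> x)"
      "integrable (lebesgue_on \<Omega>) (\<lambda>x. weak_deriv \<Omega> [i, j] v x * \<zeta> x)"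
      "integrable (lebesgue_on \<Omega>) (\<lambda>x. weak_deriv \<Omega> [i, j] u x * \<zeta> x)"
      using hw hh \<zeta> \<zeta>1 locally_integrable_mult_test[OF _ \<Omega>(1)] by (auto simp: has_weak_deriv_def)
    have iz: "integrable (lebesgue_on \<Omega>) (\<lambda>x. u x * ?z x)" "integrable (lebesgue_on \<Omega>) (\<lambda>x. v x * ?z x)"
      "integrable (lebesgue_on \<Omega>) (\<lambda>x. g x * ?z x)"
      using li[THEN locally_integrable_mult_test, OF \<Omega>(1) \<zeta>2] by auto
    have "(LINT x|lborel. p i x * partial_deriv j \<zeta> x) = ?I (\<lambda>x. P i x * partial_deriv j \<zeta> x)"
      by (rule integral_representative[OF p \<Omega>(1) Pm \<zeta>m(2)])
    also have "\<dots> = ?I (\<lambda>x. weak_deriv \<Omega> [i] ?wv x * partial_deriv j \<zeta> x) - ?I (\<lambda>x. weak_deriv \<Omega> [i] ?wu x * partial_deriv j \<zeta> x)"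
      unfolding P_def left_diff_distrib using iw by simp
    also have "\<dots> = - (?I (\<lambda>x. ?wv x * ?z x) - ?I (\<lambda>x. ?wu x * ?z x))"
      using has_weak_deriv_eq[OF hw(1) \<zeta>1] has_weak_deriv_eq[OF hw(2) \<zeta>1] by simp
    also have "\<dots> = - (?I (\<lambda>x. v x * ?z x) - ?I (\<lambda>x. u x * ?z x))"
      unfolding left_diff_distrib using iz by simp
    also have "\<dots> = - (?I (\<lambda>x. weak_deriv \<Omega> [i, j] v x * \<zeta> x) - ?I (\<lambda>x. weak_deriv \<Omega> [i, j] u x * \<zeta> x))"
      using has_weak_deriv_eq[OF hh(1) \<zeta>] has_weak_deriv_eq[OF hh(2) \<zeta>] by simp
    also have "\<dots> = - ?I (\<lambda>x. D i j x * \<zeta> x)"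
      unfolding D_def left_diff_distrib using iw by simp
    also have "?I (\<lambda>x. D i j x * \<zeta> x) = (LINT x|lborel. M i j x * \<zeta> x)"
      by (rule integral_representative[symmetric, OF ML2 DM \<Omega>(1) Dm \<zeta>m(1)])
    finally show ?thesis .
  qed
  have \<psi>_lim: "(\<lambda>n. LINT x|lborel. (p i x - partial_deriv i (\<psi> n) x)\<^sup>2) \<longlonglongrightarrow> 0" for i
  proof -
    have t: "partial_deriv i (\<phi>v n) \<in> Lp_space 2 \<Omega>" "partial_deriv i (\<phi>u n) \<in> Lp_space 2 \<Omega>" for n
      using test_functions_Lp_space_2[OF test_functions_partial_deriv \<Omega>(1)] \<phi>u(1) \<phi>v(1) by blast+
    have "(\<lambda>n. LINT x|lebesgue_on \<Omega>. ((weak_deriv \<Omega> [i] ?wv x - partial_deriv i (\<phi>v n) x)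
        - (weak_deriv \<Omega> [i] ?wu x - partial_deriv i (\<phi>u n) x))\<^sup>2) \<longlonglongrightarrow> 0"
      by (rule tendsto_integral_square_diff[OF Lp_space_2_diff[OF PwL(1) t(1)] Lp_space_2_diff[OF PwL(2) t(2)] \<phi>v(3) \<phi>u(3)])
    moreover have "(LINT x|lebesgue_on \<Omega>. ((weak_deriv \<Omega> [i] ?wv x - partial_deriv i (\<phi>v n) x)
        - (weak_deriv \<Omega> [i] ?wu x - partial_deriv i (\<phi>u n) x))\<^sup>2) = (LINT x|lborel. (p i x - partial_deriv i (\<psi> n) x)\<^sup>2)" for n
    proof -
      note L = L2_on_diff[OF p(1)[of i] test_functions_L2_on[OF test_functions_partial_deriv[OF \<psi>[of n], of i]]]
      have m: "(\<lambda>x. (p i x - partial_deriv i (\<psi> n) x)\<^sup>2) \<in> borel_measurable borel"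
        using L2_onD(1)[OF L] by measurable
      have "(LINT x|lborel. (p i x - partial_deriv i (\<psi> n) x)\<^sup>2) = (LINT x|lebesgue_on \<Omega>. (p i x - partial_deriv i (\<psi> n) x)\<^sup>2)"
        by (rule lebesgue_on_borel(1)[symmetric, OF m \<Omega>b]) (use L2_onD(2)[OF L] in auto)
      also have "\<dots> = (LINT x|lebesgue_on \<Omega>. ((weak_deriv \<Omega> [i] ?wv x - partial_deriv i (\<phi>v n) x)
        - (weak_deriv \<Omega> [i] ?wu x - partial_deriv i (\<phi>u n) x))\<^sup>2)"
      proof (rule integral_cong_AE)
        show "(\<lambda>x. (p i x - partial_deriv i (\<psi> n) x)\<^sup>2) \<in> borel_measurable (lebesgue_on \<Omega>)"
          using m by (rule measurable_lebesgue_on_borel)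
        have "(\<lambda>x. (weak_deriv \<Omega> [i] ?wv x - partial_deriv i (\<phi>v n) x)
            - (weak_deriv \<Omega> [i] ?wu x - partial_deriv i (\<phi>u n) x)) \<in> Lp_space 2 \<Omega>"
          using Lp_space_2_diff[OF Lp_space_2_diff[OF PwL(1) t(1)] Lp_space_2_diff[OF PwL(2) t(2)]] .
        then show "(\<lambda>x. ((weak_deriv \<Omega> [i] ?wv x - partial_deriv i (\<phi>v n) x)
            - (weak_deriv \<Omega> [i] ?wu x - partial_deriv i (\<phi>u n) x))\<^sup>2) \<in> borel_measurable (lebesgue_on \<Omega>)"
          by (simp add: Lp_space_2_iff borel_measurable_power)
        show "AE x in lebesgue_on \<Omega>. (p i x - partial_deriv i (\<psi> n) x)\<^sup>2 = ((weak_deriv \<Omega> [i] ?wv x - partial_deriv i (\<phi>v n) x)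
            - (weak_deriv \<Omega> [i] ?wu x - partial_deriv i (\<phi>u n) x))\<^sup>2"
          using p(2)[of i]
        proof eventually_elim
          case (elim x)
          have "p i x - partial_deriv i (\<psi> n) x = (weak_deriv \<Omega> [i] ?wv x - partial_deriv i (\<phi>v n) x)
            - (weak_deriv \<Omega> [i] ?wu x - partial_deriv i (\<phi>u n) x)"
            unfolding \<psi>d elim[symmetric] P_def by linarith
          then show ?case by (rule arg_cong)
        qed
      qed
      finally show ?thesis ..
    qed
    ultimately show ?thesis by simp
  qed
  interpret H2_H10_planar \<Omega> p M \<psi>
  proof
    fix i j :: 2
    show "M i j = M j i" using exhaust_2[of i] exhaust_2[of j] by (auto simp: M_def)
  qed (use \<Omega> p(1) ML2 by_parts \<psi> \<psi>_lim in auto)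
  have "AE x in lebesgue_on \<Omega>. M 1 1 x * M 2 2 x - (M 1 2 x)\<^sup>2 \<le> - c * ((M 1 1 x)\<^sup>2 + (M 1 2 x)\<^sup>2 + (M 2 2 x)\<^sup>2)"
    using det DM[of 1 1] DM[of 1 2] DM[of 2 2]
  proof eventually_elim
    case (elim x)
    then show ?case
      by (simp only: simp_thms all_simps weak_hessian_def vector_minus_component vec_lambda_beta D_def)
  qed
  then have "AE x in lborel. x \<in> \<Omega> \<longrightarrow> M 1 1 x * M 2 2 x - (M 1 2 x)\<^sup>2 \<le> - c * ((M 1 1 x)\<^sup>2 + (M 1 2 x)\<^sup>2 + (M 2 2 x)\<^sup>2)"
    by (simp only: AE_lebesgue_on_iff[OF \<Omega>b])
  then have "AE x in lborel. M 1 1 x * M 2 2 x - (M 1 2 x)\<^sup>2 \<le> - c * ((M 1 1 x)\<^sup>2 + (M 1 2 x)\<^sup>2 + (M 2 2 x)\<^sup>2)"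
  proof eventually_elim
    case (elim x)
    then show ?case using L2_onD(2)[OF ML2] by (cases "x \<in> \<Omega>") auto
  qed
  from hessian_AE_eq_0[OF c this] have "AE x in lborel. M 1 1 x = 0" by eventually_elim simp
  then have "(\<lambda>n. LINT x|lborel. (\<psi> n x)\<^sup>2) \<longlonglongrightarrow> 0" by (rule approximants_tendsto_0)
  moreover have "(LINT x|lborel. (\<psi> n x)\<^sup>2) = (LINT x|lebesgue_on \<Omega>. (\<psi> n x)\<^sup>2)" for n
  proof -
    note L = L2_onD[OF test_functions_L2_on[OF \<psi>[of n]]]
    have "(\<lambda>x. (\<psi> n x)\<^sup>2) \<in> borel_measurable borel" using L(1) by measurable
    then show ?thesis using lebesgue_on_borel(1)[OF _ \<Omega>b] L(2) by simp
  qed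
  ultimately have lim\<psi>: "(\<lambda>n. LINT x|lebesgue_on \<Omega>. (\<psi> n x)\<^sup>2) \<longlonglongrightarrow> 0" by simp
  have wL: "?wv \<in> Lp_space 2 \<Omega>" "?wu \<in> Lp_space 2 \<Omega>" using W1 by (auto simp: sobolev_space_def)
  have tL: "\<phi>v n \<in> Lp_space 2 \<Omega>" "\<phi>u n \<in> Lp_space 2 \<Omega>" "\<psi> n \<in> Lp_space 2 \<Omega>" for n
    using test_functions_Lp_space_2[OF _ \<Omega>(1)] \<phi>u(1) \<phi>v(1) \<psi> by blast+
  have d1: "(\<lambda>n. LINT x|lebesgue_on \<Omega>. ((?wv x - \<phi>v n x) - (?wu x - \<phi>u n x))\<^sup>2) \<longlonglongrightarrow> 0"
    by (rule tendsto_integral_square_diff[OF Lp_space_2_diff[OF wL(1) tL(1)] Lp_space_2_diff[OF wL(2) tL(2)] \<phi>v(2) \<phi>u(2)])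
  have n\<psi>: "(\<lambda>x. - \<psi> n x) \<in> Lp_space 2 \<Omega>" for n using tL(3)[of n] by (simp add: Lp_space_2_iff)
  \<comment> \<open>The two approximation errors and \<open>\<psi> n\<close> all tend to 0 in L2,
    while their combination is \<open>v - u\<close> for every n.\<close>
  have "(\<lambda>n. LINT x|lebesgue_on \<Omega>. (((?wv x - \<phi>v n x) - (?wu x - \<phi>u n x)) - (- \<psi> n x))\<^sup>2) \<longlonglongrightarrow> 0"
    using lim\<psi> by (intro tendsto_integral_square_diff d1 n\<psi>
        Lp_space_2_diff[OF Lp_space_2_diff[OF wL(1) tL(1)] Lp_space_2_diff[OF wL(2) tL(2)]]) simp
  moreover have eq: "((?wv x - \<phi>v n x) - (?wu x - \<phi>u n x)) - (- \<psi> n x) = v x - u x" for n x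
    by (simp add: \<psi>_def)
  ultimately have "(LINT x|lebesgue_on \<Omega>. (v x - u x)\<^sup>2) = 0"
    by (simp only: eq LIMSEQ_const_iff)
  moreover have "integrable (lebesgue_on \<Omega>) (\<lambda>x. (v x - u x)\<^sup>2)"
    using Lp_space_2_diff[OF wL] by (simp add: Lp_space_2_iff)
  ultimately have "AE x in lebesgue_on \<Omega>. (v x - u x)\<^sup>2 = 0"
    by (subst integral_nonneg_eq_0_iff_AE[symmetric]) auto
  then show ?thesis by eventually_elim simp
qed

text \<open>\<open>real_of_ereal\<close> maps infinity to 0, so the bound hinges on the supremum
  being finite; it ranges over the finitely many index lists of length \<open>k\<close>.\<close>

lemma AE_weak_deriv_le_seminorm:
  fixes \<Omega> :: "(real^'n::finite) set"
  assumes "open \<Omega>" "u \<in> sobolev_space k \<infinity> \<Omega>" "length \<alpha> = k"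
  shows "AE x in lebesgue_on \<Omega>. \<bar>weak_deriv \<Omega> \<alpha> u x\<bar> \<le> sobolev_inf_seminorm k \<Omega> u"
proof -
  let ?e = "\<lambda>\<alpha>. esssup (lebesgue_on \<Omega>) (\<lambda>x. ereal \<bar>weak_deriv \<Omega> \<alpha> u x\<bar>)"
  let ?A = "{\<alpha> :: 'n list. length \<alpha> = k}"
  have fin: "finite ?A" using finite_lists_length_eq[of "UNIV :: 'n set" k] by simp
  have lt: "?e \<beta> < \<infinity>" if "\<beta> \<in> ?A" for \<beta>
    using sobolev_space_weak_deriv(2)[OF assms(1,2), of \<beta>] that by (simp add: Lp_space_def)
  have S: "(SUP \<beta>\<in>?A. ?e \<beta>) < \<infinity>"
  proof -
    have "(SUP \<beta>\<in>?A. ?e \<beta>) = Max (?e ` ?A)"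
      using fin assms(3) by (intro cSup_eq_Max) auto
    also have "\<dots> < \<infinity>" using fin assms(3) lt by (subst Max_less_iff) auto
    finally show ?thesis .
  qed
  have "?e \<alpha> \<le> (SUP \<beta>\<in>?A. ?e \<beta>)" using assms(3) by (intro SUP_upper) auto
  then have "AE x in lebesgue_on \<Omega>. ereal \<bar>weak_deriv \<Omega> \<alpha> u x\<bar> \<le> (SUP \<beta>\<in>?A. ?e \<beta>)"
    using esssup_AE[of "\<lambda>x. ereal \<bar>weak_deriv \<Omega> \<alpha> u x\<bar>" "lebesgue_on \<Omega>"]
    by (auto elim!: eventually_mono intro: order_trans)
  then show ?thesis
  proof eventually_elim
    case (elim x)
    then show ?case using S unfolding sobolev_inf_seminorm_def
      by (cases "SUP \<beta>\<in>?A. ?e \<beta>") auto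
  qed
qed

theorem theorem5p2:
  fixes \<Omega> :: "(real^2) set" and f :: "real^2 \<Rightarrow> real"
  assumes "open \<Omega>" and "\<Omega> \<noteq> {}" and "bounded \<Omega>" and "convex \<Omega>"
    and "continuous_on (closure \<Omega>) f" and "(INF x\<in>closure \<Omega>. f x) > 0"
  shows "\<exists>\<Xi> :: real \<Rightarrow> real. (\<forall>s. 0 < \<Xi> s \<and> \<Xi> s \<le> 1/4) \<and>
    (\<forall>g\<in>sobolev_space 2 \<infinity> \<Omega>. \<forall>u\<in>sobolev_space 2 \<infinity> \<Omega>.
      uniformly_convex \<Omega> u \<longrightarrow> monge_ampere_solution \<Omega> f g u \<longrightarrow>
      (let \<xi> = \<Xi> (sobolev_inf_seminorm 2 \<Omega> u) in
        u \<in> sobolev_space 2 2 \<Omega> \<and> hjb_solution \<xi> \<Omega> f g u \<and>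
        (\<forall>v\<in>sobolev_space 2 2 \<Omega>. hjb_solution \<xi> \<Omega> f g v \<longrightarrow>
          (AE x in lebesgue_on \<Omega>. v x = u x))))"
proof -
  define m where "m = (INF x\<in>closure \<Omega>. f x)"
  have m: "m > 0" using assms(6) by (simp add: m_def)
  have \<Omega>b: "\<Omega> \<in> sets borel" using assms(1) by auto
  have "compact (f ` closure \<Omega>)"
    using assms(3,5) by (intro compact_continuous_image) (simp_all add: compact_eq_bounded_closed bounded_closure)
  then have bdd: "bdd_below (f ` closure \<Omega>)" by (intro bounded_imp_bdd_below compact_imp_bounded)
  have fm: "f x \<ge> m" if "x \<in> \<Omega>" for x
    unfolding m_def using bdd that closure_subset[of \<Omega>] by (intro cINF_lower) auto
  \<comment> \<open>The trace of the Hessian is at most \<open>2 * s\<close>, so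
    \<open>\<Xi> s \<le> m / (4 * s\<^sup>2)\<close> would make the maximizer admissible. The
    summand \<open>4 * m\<close> also gives \<open>\<Xi> s \<le> 1/4\<close> and a positive
    denominator at \<open>s = 0\<close>. For fixed \<open>f\<close>, the value depends on
    \<open>u\<close> only through the seminorm.\<close>
  define \<Xi> where "\<Xi> s = m / (4 * s\<^sup>2 + 4 * m)" for s
  have den: "4 * s\<^sup>2 + 4 * m > 0" for s :: real using m by (simp add: add_nonneg_pos)
  have \<Xi>: "0 < \<Xi> s" "\<Xi> s \<le> 1/4" for s
    using m den[of s] by (auto simp: \<Xi>_def divide_simps)
  show ?thesis
  proof (intro exI[of _ \<Xi>] conjI allI ballI impI)
    show "0 < \<Xi> s" "\<Xi> s \<le> 1/4" for s by (fact \<Xi>)+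
    fix g u
    assume g: "g \<in> sobolev_space 2 \<infinity> \<Omega>" and u: "u \<in> sobolev_space 2 \<infinity> \<Omega>"
      and convex: "uniformly_convex \<Omega> u" and ma: "monge_ampere_solution \<Omega> f g u"
    have u2: "u \<in> sobolev_space 2 2 \<Omega>" and g2: "g \<in> sobolev_space 2 2 \<Omega>"
      using u g sobolev_space_infinity_subset_2[OF assms(1,3)] by auto
    define s where "s = sobolev_inf_seminorm 2 \<Omega> u"
    have in\<Omega>: "AE x in lebesgue_on \<Omega>. x \<in> \<Omega>" by (simp add: AE_lebesgue_on_iff[OF \<Omega>b])
    have sym: "AE x in lebesgue_on \<Omega>. weak_hessian \<Omega> w x $ 2 $ 1 = weak_hessian \<Omega> w x $ 1 $ 2"
      if "w \<in> sobolev_space 2 2 \<Omega>" for w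
      using weak_hessian_symmetric[OF assms(1) that, of 2 1] by (simp add: weak_hessian_def)
    obtain c where c: "c > 0" "AE x in lebesgue_on \<Omega>. \<forall>\<eta>. \<eta> \<bullet> (weak_hessian \<Omega> u x *v \<eta>) \<ge> c * (norm \<eta>)\<^sup>2"
      using convex by (auto simp: uniformly_convex_def)
    have det: "AE x in lebesgue_on \<Omega>. det (weak_hessian \<Omega> u x) = f x" and ug: "equal_on_boundary \<Omega> u g"
      using ma by (auto simp: monge_ampere_solution_def)
    have bound: "AE x in lebesgue_on \<Omega>. \<bar>weak_deriv \<Omega> [i, i] u x\<bar> \<le> s" for i
      unfolding s_def by (rule AE_weak_deriv_le_seminorm[OF assms(1) u]) simp
    have hjb_u: "hjb_solution (\<Xi> s) \<Omega> f g u"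
      unfolding hjb_solution_def
    proof
      show "AE x in lebesgue_on \<Omega>.
        (SUP W\<in>control_set_det (\<Xi> s). - (W \<bullet> weak_hessian \<Omega> u x) + 2 * sqrt (det W) * sqrt (f x)) = 0"
        using in\<Omega> sym[OF u2] c(2) det bound[of 1] bound[of 2]
      proof eventually_elim
        case (elim x)
        let ?M = "weak_hessian \<Omega> u x"
        \<comment> \<open>Uniform convexity tested on coordinate vectors. With the positive
          determinant it selects the convex branch of the Monge-Ampere equation.\<close>
        have diag: "?M $ i $ i > 0" for i
        proof -
          have "axis i 1 \<bullet> (?M *v axis i 1) \<ge> c * (norm (axis i 1 :: real^2))\<^sup>2" using elim(3) by blast
          then show ?thesis using c(1)
            by (simp add: norm_axis_1 inner_axis' matrix_vector_mul_component inner_axis)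
        qed
        have f: "f x \<ge> m" using fm elim(1) by blast
        have t: "0 < ?M $ 1 $ 1 + ?M $ 2 $ 2" "?M $ 1 $ 1 + ?M $ 2 $ 2 \<le> 2 * s"
          using diag[of 1] diag[of 2] elim(5,6) by (auto simp: weak_hessian_def)
        then have "(?M $ 1 $ 1 + ?M $ 2 $ 2)\<^sup>2 \<le> (2 * s)\<^sup>2" by (intro power_mono) auto
        also have "\<dots> \<le> 4 * s\<^sup>2 + 4 * m" using m by (simp add: power_mult_distrib)
        finally have "\<Xi> s * (?M $ 1 $ 1 + ?M $ 2 $ 2)\<^sup>2 \<le> \<Xi> s * (4 * s\<^sup>2 + 4 * m)"
          using \<Xi>(1)[of s] by (intro mult_left_mono) auto
        also have "\<dots> = m" using den[of s] by (simp add: \<Xi>_def)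
        finally show ?case
          using f m by (intro SUP_eq_0_of_det[OF elim(2) diag diag elim(4)] \<Xi>(1)) auto
      qed
    qed (fact ug)
    have "AE x in lebesgue_on \<Omega>. v x = u x" if v: "v \<in> sobolev_space 2 2 \<Omega>" and hjb_v: "hjb_solution (\<Xi> s) \<Omega> f g v" for v
    proof (rule eq_of_det_hessian_diff[OF assms(1-4) u2 v g2 ug])
      show "equal_on_boundary \<Omega> v g" using hjb_v by (simp add: hjb_solution_def)
      show "1 / (1 / \<Xi> s + 2) > 0" using \<Xi>(1)[of s] by (simp add: add_pos_pos)
      have "AE x in lebesgue_on \<Omega>. (SUP W\<in>control_set_det (\<Xi> s). - (W \<bullet> weak_hessian \<Omega> v x) + 2 * sqrt (det W) * sqrt (f x)) = 0"
        "AE x in lebesgue_on \<Omega>. (SUP W\<in>control_set_det (\<Xi> s). - (W \<bullet> weak_hessian \<Omega> u x) + 2 * sqrt (det W) * sqrt (f x)) = 0"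
        using hjb_u hjb_v by (simp_all add: hjb_solution_def)
      then show "AE x in lebesgue_on \<Omega>. \<forall>D. D = weak_hessian \<Omega> v x - weak_hessian \<Omega> u x \<longrightarrow>
          D$1$1 * D$2$2 - (D$1$2)\<^sup>2 \<le> - (1 / (1 / \<Xi> s + 2)) * ((D$1$1)\<^sup>2 + (D$1$2)\<^sup>2 + (D$2$2)\<^sup>2)"
        using in\<Omega> sym[OF v] sym[OF u2]
      proof eventually_elim
        case (elim x)
        have "f x \<ge> 0" using fm[OF elim(3)] m by linarith
        then have "sqrt (f x) \<ge> 0" by simp
        from det_diff_of_SUP[OF \<Xi> elim(4,5) this elim(1,2)] show ?case by blast
      qed
    qed
    then show "let \<xi> = \<Xi> (sobolev_inf_seminorm 2 \<Omega> u) in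
        u \<in> sobolev_space 2 2 \<Omega> \<and> hjb_solution \<xi> \<Omega> f g u \<and>
        (\<forall>v\<in>sobolev_space 2 2 \<Omega>. hjb_solution \<xi> \<Omega> f g v \<longrightarrow> (AE x in lebesgue_on \<Omega>. v x = u x))"
      using u2 hjb_u by (simp add: Let_def flip: s_def)
  qed
qed

end
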